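(* Complements of different solenoids have different fundamental groups: if $\Sigma$ and $\Sigma'$ are non-homeomorphic solenoids embedded in $S^3$, then $\pi_1(S^3-\Sigma)$ and $\pi_1(S^3-\Sigma')$ are not isomorphic.
   Context: Given a sequence $\{n_i\}_{i\ge1}$ of positive integers, let $f_i:S^1\to S^1$, $f_i(z)=z^{n_i}$, where $S^1$ is the unit circle in $\mathbb{C}$. The solenoid with defining sequence $\{n_i\}$ is the inverse limit $\Sigma(n_i)=\varprojlim(S^1,f_i)$. A solenoid is a space homeomorphic to some $\Sigma(n_i)$. Convention on embeddings: all embeddings of solenoids in $S^3$ are obtained as nested intersections of solid tori. That is, for some defining sequence $\{n_i\}$ of the solenoid, there are tame solid tori $T_0\supset T_1\supset T_2\supset\cdots$ in $S^3$ such that for each $i\ge1$, $T_i$ lies in the interior of $T_{i-1}$ and is a tubular neighborhood of a closed braid on $n_i$ strands in $T_{i-1}$ whose permutation of the strands is transitive (so that the closed braid is a single closed curve), the cross-sectional diameters $d_i$ of $T_i$ satisfy $d_i<d_{i-1}/2$, and the embedded copy of the solenoid is $\bigcap_i T_i$. *)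

theory Defs
  imports "HOL-Analysis.Analysis" "HOL-Algebra.Group" "HOL-Combinatorics.Permutations"
begin

subsection \<open>The fundamental group\<close>

definition loops :: "'a::topological_space set \<Rightarrow> 'a \<Rightarrow> (real \<Rightarrow> 'a) set" where
  "loops X x = {p. path p \<and> path_image p \<subseteq> X \<and> pathstart p = x \<and> pathfinish p = x}"

definition fundamental_group ::
    "'a::topological_space set \<Rightarrow> 'a \<Rightarrow> (real \<Rightarrow> 'a) set monoid" where
  "fundamental_group X x =
    \<lparr>carrier = {{q. homotopic_paths X p q} | p. p \<in> loops X x},
     mult = (\<lambda>A B. {r. \<exists>p\<in>A. \<exists>q\<in>B. homotopic_paths X (p +++ q) r}),
     one = {q. homotopic_paths X (\<lambda>_. x) q}\<rparr>"

lemma fundamental_group_mult: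
  assumes "p \<in> loops X x" "q \<in> loops X x"
  shows "{r. homotopic_paths X p r} \<otimes>\<^bsub>fundamental_group X x\<^esub> {r. homotopic_paths X q r}
         = {r. homotopic_paths X (p +++ q) r}"
proof -
  have "homotopic_paths X (p +++ q) r"
    if "homotopic_paths X p p'" "homotopic_paths X q q'" "homotopic_paths X (p' +++ q') r"
    for p' q' r
  proof -
    have "homotopic_paths X (p +++ q) (p' +++ q')"
      using that assms by (intro homotopic_paths_join) (auto simp: loops_def)
    then show ?thesis using that(3) homotopic_paths_trans by blast
  qed
  moreover have "homotopic_paths X p p" "homotopic_paths X q q"
    using assms by (auto simp: loops_def)
  ultimately show ?thesis
    unfolding fundamental_group_def monoid.simps by blast
qed

lemma homotopic_class_eq_iff:
  assumes "p \<in> loops X x"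
  shows "{r. homotopic_paths X p r} = {r. homotopic_paths X q r} \<longleftrightarrow> homotopic_paths X p q"
proof
  assume *: "{r. homotopic_paths X p r} = {r. homotopic_paths X q r}"
  have "homotopic_paths X p p" using assms by (auto simp: loops_def)
  then have "homotopic_paths X q p" using * by blast
  then show "homotopic_paths X p q" by (rule homotopic_paths_sym)
next
  assume "homotopic_paths X p q"
  then show "{r. homotopic_paths X p r} = {r. homotopic_paths X q r}"
    using homotopic_paths_sym homotopic_paths_trans by blast
qed

lemma loops_join: "p \<in> loops X x \<Longrightarrow> q \<in> loops X x \<Longrightarrow> p +++ q \<in> loops X x"
  by (auto simp: loops_def path_image_join)

lemma loops_reversepath: "p \<in> loops X x \<Longrightarrow> reversepath p \<in> loops X x"
  by (auto simp: loops_def)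

lemma group_fundamental_group:
  fixes X :: "'a::real_normed_vector set"
  assumes "x \<in> X"
  shows "group (fundamental_group X x)"
proof -
  let ?G = "fundamental_group X x"
  let ?c = "\<lambda>p. {r. homotopic_paths X p r}"
  have carr: "carrier ?G = ?c ` loops X x" 
    and one: "\<one>\<^bsub>?G\<^esub> = ?c (linepath x x)"
    by (auto simp: fundamental_group_def linepath_refl)
  have const: "linepath x x \<in> loops X x" using assms by (auto simp: loops_def)
  note mult = fundamental_group_mult[of _ X x]
  have eqI: "?c p = ?c q" if "homotopic_paths X p q" for p q
    using that homotopic_paths_sym homotopic_paths_trans by blast
  show ?thesis
  proof (rule groupI)
    fix A B assume "A \<in> carrier ?G" "B \<in> carrier ?G"
    then show "A \<otimes>\<^bsub>?G\<^esub> B \<in> carrier ?G"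
      unfolding carr by (auto simp: mult intro!: imageI loops_join)
  next
    show "\<one>\<^bsub>?G\<^esub> \<in> carrier ?G" unfolding carr one using const by blast
  next
    fix A B C assume "A \<in> carrier ?G" "B \<in> carrier ?G" "C \<in> carrier ?G"
    then obtain p q r where l: "p \<in> loops X x" "q \<in> loops X x" "r \<in> loops X x"
      and "A = ?c p" "B = ?c q" "C = ?c r"
      unfolding carr by auto
    moreover have "homotopic_paths X (p +++ (q +++ r)) ((p +++ q) +++ r)"
      using l by (intro homotopic_paths_assoc) (auto simp: loops_def)
    ultimately show "A \<otimes>\<^bsub>?G\<^esub> B \<otimes>\<^bsub>?G\<^esub> C = A \<otimes>\<^bsub>?G\<^esub> (B \<otimes>\<^bsub>?G\<^esub> C)"
      by (simp add: mult loops_join eqI)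
  next
    fix A assume "A \<in> carrier ?G"
    then obtain p where l: "p \<in> loops X x" and A: "A = ?c p" unfolding carr by auto
    have "homotopic_paths X (linepath x x +++ p) p"
      using l homotopic_paths_lid[of p X] by (auto simp: loops_def)
    then show "\<one>\<^bsub>?G\<^esub> \<otimes>\<^bsub>?G\<^esub> A = A"
      unfolding A one by (simp add: mult l const eqI)
    have "homotopic_paths X (reversepath p +++ p) (linepath x x)"
      using l homotopic_paths_linv[of p X] by (auto simp: loops_def)
    then have "?c (reversepath p) \<otimes>\<^bsub>?G\<^esub> A = \<one>\<^bsub>?G\<^esub>"
      unfolding A one by (simp add: mult l loops_reversepath eqI)
    then show "\<exists>B\<in>carrier ?G. B \<otimes>\<^bsub>?G\<^esub> A = \<one>\<^bsub>?G\<^esub>"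
      unfolding carr using loops_reversepath[OF l] by blast
  qed
qed


subsection \<open>Solenoids\<close>

text \<open>The bonding maps are numbered from 0, so \<open>n i\<close> is the usual \<open>n\<^sub>i\<^sub>+\<^sub>1\<close>. The topology
  on \<open>nat \<Rightarrow> complex\<close> is the product topology.\<close>

definition solenoid :: "(nat \<Rightarrow> nat) \<Rightarrow> (nat \<Rightarrow> complex) set" where
  "solenoid n = {x. \<forall>i. x i \<in> sphere 0 1 \<and> x i = x (Suc i) ^ n i}"


subsection \<open>Solid tori in the 3-sphere\<close>

abbreviation S3 :: "(real^4) set" where
  "S3 \<equiv> sphere 0 1"

abbreviation std_solid_torus :: "(complex \<times> complex) set" where
  "std_solid_torus \<equiv> cball 0 1 \<times> sphere 0 1"

text \<open>A proper subset of the 3-sphere is tame if some homeomorphism of the sphere with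
  \<open>\<real>\<^sup>3 \<union> {\<infinity>}\<close> maps it onto a compact polyhedron in \<open>\<real>\<^sup>3\<close>. Homeomorphisms from a punctured
  sphere to \<open>\<real>\<^sup>3\<close> extend uniquely to the one-point compactifications.\<close>

definition tame :: "(real^4) set \<Rightarrow> bool" where
  "tame X \<longleftrightarrow> (\<exists>p \<in> S3 - X. \<exists>f g \<C>.
      homeomorphism (S3 - {p}) (UNIV :: (real^3) set) f g \<and>
      simplicial_complex \<C> \<and> X \<subseteq> S3 \<and> f ` X = \<Union>\<C>)"

definition solid_torus_param :: "(complex \<times> complex \<Rightarrow> real^4) \<Rightarrow> (real^4) set \<Rightarrow> bool" where
  "solid_torus_param h T \<longleftrightarrow> T \<subseteq> S3 \<and> (\<exists>g. homeomorphism std_solid_torus T h g)"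

definition core :: "(complex \<times> complex \<Rightarrow> real^4) \<Rightarrow> (real^4) set" where
  "core h = h ` ({0} \<times> sphere 0 1)"

definition cross_section_diameter :: "(complex \<times> complex \<Rightarrow> real^4) \<Rightarrow> real" where
  "cross_section_diameter h = (SUP z \<in> sphere 0 1. diameter (h ` (cball 0 1 \<times> {z})))"

text \<open>The closure of a braid with strands \<open>\<gamma> 0, \<dots>, \<gamma> (n - 1)\<close> in the open disc, strand \<open>j\<close> ending
  where strand \<open>\<sigma> j\<close> starts.\<close>

definition transitive_closed_braid :: "nat \<Rightarrow> (complex \<times> complex) set \<Rightarrow> bool" where
  "transitive_closed_braid n K \<longleftrightarrow> (\<exists>\<gamma> \<sigma>.
      (\<forall>j<n. path (\<gamma> j) \<and> path_image (\<gamma> j) \<subseteq> ball 0 1) \<and>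
      (\<forall>t\<in>{0..1}. inj_on (\<lambda>j. \<gamma> j t) {..<n}) \<and>
      \<sigma> permutes {..<n} \<and>
      (\<forall>j<n. pathfinish (\<gamma> j) = pathstart (\<gamma> (\<sigma> j))) \<and>
      (\<forall>j<n. \<forall>k<n. \<exists>m. (\<sigma> ^^ m) j = k) \<and>
      K = {(\<gamma> j t, cis (2 * pi * t)) | j t. j < n \<and> t \<in> {0..1}})"


subsection \<open>Embedded solenoids\<close>

text \<open>\<open>T (Suc i)\<close> is a tubular neighbourhood, parametrized by \<open>h (Suc i)\<close>, of a closed braid in
  \<open>T i\<close>, where braids in \<open>T i\<close> and cross-sections of \<open>T i\<close> are understood via \<open>h i\<close>.\<close>

definition defining_tori :: "(nat \<Rightarrow> nat) \<Rightarrow> (nat \<Rightarrow> (real^4) set) \<Rightarrow> bool" where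
  "defining_tori n T \<longleftrightarrow> (\<exists>h.
      (\<forall>i. solid_torus_param (h i) (T i) \<and> tame (T i)) \<and>
      (\<forall>i. T (Suc i) \<subseteq> top_of_set S3 interior_of T i) \<and>
      (\<forall>i. \<exists>K. transitive_closed_braid (n i) K \<and> core (h (Suc i)) = h i ` K) \<and>
      (\<forall>i. cross_section_diameter (h (Suc i)) < cross_section_diameter (h i) / 2))"

definition embedded_solenoid :: "(real^4) set \<Rightarrow> bool" where
  "embedded_solenoid S \<longleftrightarrow> (\<exists>n T. (\<forall>i. n i > 0) \<and> S homeomorphic solenoid n \<and>
      defining_tori n T \<and> S = (\<Inter>i. T i))"

end

theory Submission
  imports Defs "HOL-Complex_Analysis.Winding_Numbers"
begin

text \<open>
  The solenoid can be read off from the group \<open>G = \<pi>\<^sub>1(S\<^sup>3 - \<Sigma>)\<close>: the space of all homomorphisms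
  from \<open>G\<close> to the unit circle, with the topology of pointwise convergence, is homeomorphic to
  \<open>\<Sigma>\<close> (\<open>character_space_solenoid_complement\<close>). Indeed \<open>H\<^sub>1(S\<^sup>3 - \<Sigma>)\<close> is the direct limit of
  \<open>\<int> \<rightarrow> \<int> \<rightarrow> \<dots>\<close> under multiplication by \<open>n\<^sub>1, n\<^sub>2, \<dots>\<close>, and Pontryagin duality turns it into the inverse
  limit of circles under the power maps. Isomorphic groups have homeomorphic character spaces.

  Computing the characters of the complement takes three facts about an open solid torus
  \<open>V = h(D \<times> S\<^sup>1)\<close> in the sphere and a concentric closed torus \<open>K = h(D\<^sub>r \<times> S\<^sup>1)\<close> in it.
  First, a character of \<open>\<pi>\<^sub>1(S\<^sup>3 - K)\<close> that is trivial on the meridian is trivial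
  (\<open>character_trivial_if_meridian_trivial\<close>): it extends over \<open>V\<close>, hence by van Kampen's argument to
  the simply connected sphere.
  Second, some map from the complement of the core circle to the nonzero complex numbers has winding number 1 on the meridian
  (\<open>linking_function\<close>). This is the triviality of complex line bundles on the 3-sphere, applied to
  the bundle glued by the coordinate \<open>z\<close> of \<open>h(z, w)\<close>: trivialise it on small pieces, correct one
  trivialisation by a logarithm whenever two pieces meet in a set on which logarithms exist, and finally glue
  two hemispheres along a 2-sphere, which is simply connected.
  Third, for a closed braid with \<open>n\<close> strands in \<open>V\<close>, the meridian of \<open>V\<close> winds \<open>\<plusminus> n\<close> times around the braid
  (\<open>winding_number_closed_braid\<close>): the polynomial \<open>\<Prod>\<^sub>j (z - \<gamma>\<^sub>j(t))\<close> vanishes exactly on the braid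
  and is compared with the linking function by the first fact.

  The limit over the tori is then taken by compactness: every loop and every homotopy in
  the complement of the solenoid avoids one of them.
\<close>

section \<open>Cutting convex sets into small pieces\<close>

text \<open>A set of diameter less than \<open>e\<close> is reached by slicing successively along all coordinate directions into slabs of
  width \<open>w\<close>; the induction is on the set \<open>D\<close> of directions in which slicing is still to be done. It
  serves two purposes below: homotopies are cut into squares and the hemispheres into cells.\<close>

lemma convex_subdivision:
  fixes P :: "'a::euclidean_space set \<Rightarrow> bool"
  assumes C0: "compact C0" "convex C0" and "e > 0"
    and small: "\<And>C. \<lbrakk>compact C; convex C; C \<subseteq> C0; diameter C < e\<rbrakk> \<Longrightarrow> P C"
    and glue: "\<And>C i c. \<lbrakk>compact C; convex C; C \<subseteq> C0; i \<in> Basis;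
                  P (C \<inter> {x. x \<bullet> i \<le> c}); P (C \<inter> {x. x \<bullet> i \<ge> c})\<rbrakk> \<Longrightarrow> P C"
  shows "P C0"
proof -
  define w where "w = e / (2 * real DIM('a))"
  have w: "w > 0" using \<open>e > 0\<close> by (simp add: w_def)
  define thin where "thin i C \<longleftrightarrow> (\<exists>c. C \<subseteq> {x. c \<le> x \<bullet> i \<and> x \<bullet> i \<le> c + w})" for i :: 'a and C
  have thin_mono: "thin i C \<Longrightarrow> D \<subseteq> C \<Longrightarrow> thin i D" for i C D
    unfolding thin_def by blast
  have *: "P C" if "finite D" "D \<subseteq> Basis" "compact C" "convex C" "C \<subseteq> C0" "\<forall>i\<in>Basis - D. thin i C"
    for D C
    using that
  proof (induction D arbitrary: C rule: finite_induct)
    case empty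
    have "dist x y \<le> e / 2" if "x \<in> C" "y \<in> C" for x y
    proof -
      have "\<bar>(x - y) \<bullet> i\<bar> \<le> w" if "i \<in> Basis" for i
      proof -
        obtain c where "C \<subseteq> {x. c \<le> x \<bullet> i \<and> x \<bullet> i \<le> c + w}"
          using empty \<open>i \<in> Basis\<close> unfolding thin_def by blast
        then have "c \<le> x \<bullet> i" "x \<bullet> i \<le> c + w" "c \<le> y \<bullet> i" "y \<bullet> i \<le> c + w"
          using \<open>x \<in> C\<close> \<open>y \<in> C\<close> by auto
        then show ?thesis by (simp add: inner_diff_left)
      qed
      then have "(\<Sum>i\<in>Basis. \<bar>(x - y) \<bullet> i\<bar>) \<le> (\<Sum>i\<in>(Basis::'a set). w)"
        by (rule sum_mono)
      then show ?thesis
        using norm_le_l1[of "x - y"] by (simp add: dist_norm w_def)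
    qed
    then have "diameter C \<le> e / 2"
      using \<open>e > 0\<close> by (intro diameter_le) (auto simp: dist_norm)
    then show ?case using small empty \<open>e > 0\<close> by simp
  next
    case (insert i D)
    have slab: "P C" if "compact C" "convex C" "C \<subseteq> C0" "\<forall>j\<in>Basis - insert i D. thin j C"
        "C \<subseteq> {x. c \<le> x \<bullet> i \<and> x \<bullet> i \<le> c + real n * w}" for n c C
      using that
    proof (induction n arbitrary: C)
      case 0
      have "thin i C" unfolding thin_def using 0 w by (intro exI[of _ c]) auto
      then show ?case using insert.IH[of C] insert.prems 0 by blast
    next
      case (Suc n)
      let ?d = "c + real n * w"
      have cl: "closed {x. x \<bullet> i \<le> ?d}" "closed {x. x \<bullet> i \<ge> ?d}"
        by (auto simp: closed_halfspace_component_le closed_halfspace_component_ge)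
      have cv: "convex {x. x \<bullet> i \<le> ?d}" "convex {x. x \<bullet> i \<ge> ?d}"
        using convex_halfspace_le[of i ?d] convex_halfspace_ge[of ?d i] by (auto simp: inner_commute)
      have "P (C \<inter> {x. x \<bullet> i \<le> ?d})"
        using Suc.prems thin_mono[OF _ Int_lower1] cl cv
        by (intro Suc.IH) (auto intro!: compact_Int_closed convex_Int)
      moreover have "P (C \<inter> {x. x \<bullet> i \<ge> ?d})"
      proof (rule insert.IH)
        have "thin i (C \<inter> {x. x \<bullet> i \<ge> ?d})" unfolding thin_def
          using Suc.prems(5) by (intro exI[of _ ?d]) (auto simp: algebra_simps)
        then show "\<forall>j\<in>Basis - D. thin j (C \<inter> {x. x \<bullet> i \<ge> ?d})"
          using Suc.prems(4) thin_mono[OF _ Int_lower1] by blast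
      qed (use Suc.prems insert.prems cl cv in \<open>auto intro!: compact_Int_closed convex_Int\<close>)
      ultimately show ?case
        using glue[of C i ?d] Suc.prems insert.prems by auto
    qed
    obtain B where B: "\<And>x. x \<in> C \<Longrightarrow> norm x \<le> B"
      using insert.prems compact_imp_bounded bounded_iff by metis
    obtain n where n: "2 * B / w \<le> real n" using real_arch_simple by blast
    have "\<bar>x \<bullet> i\<bar> \<le> B" if "x \<in> C" for x
      using B[OF that] Basis_le_norm[of i x] insert.prems by simp
    moreover have "2 * B \<le> real n * w" using n w by (simp add: field_simps)
    ultimately have "C \<subseteq> {x. - B \<le> x \<bullet> i \<and> x \<bullet> i \<le> - B + real n * w}" by force
    then show ?case using slab[of C "- B" n] insert.prems by blast
  qed
  show ?thesis using *[of Basis C0] C0 by simp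
qed

section \<open>Characters on paths\<close>

text \<open>A homomorphism from the fundamental groupoid of \<open>U\<close> to the multiplicative group of complex
  numbers. Working with all paths instead of the loops at a base point makes restriction to
  subsets and gluing immediate.\<close>

definition path_character :: "'a::topological_space set \<Rightarrow> ((real \<Rightarrow> 'a) \<Rightarrow> complex) \<Rightarrow> bool" where
  "path_character U \<omega> \<longleftrightarrow>
     (\<forall>p. path p \<and> path_image p \<subseteq> U \<longrightarrow> \<omega> p \<noteq> 0) \<and>
     (\<forall>p q. homotopic_paths U p q \<longrightarrow> \<omega> p = \<omega> q) \<and>
     (\<forall>p q. path p \<and> path_image p \<subseteq> U \<and> path q \<and> path_image q \<subseteq> U \<and> pathfinish p = pathstart q \<longrightarrow>
        \<omega> (p +++ q) = \<omega> p * \<omega> q)"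

lemma path_characterI:
  assumes "\<And>p. path p \<Longrightarrow> path_image p \<subseteq> U \<Longrightarrow> \<omega> p \<noteq> 0"
    and "\<And>p q. homotopic_paths U p q \<Longrightarrow> \<omega> p = \<omega> q"
    and "\<And>p q. \<lbrakk>path p; path_image p \<subseteq> U; path q; path_image q \<subseteq> U; pathfinish p = pathstart q\<rbrakk>
          \<Longrightarrow> \<omega> (p +++ q) = \<omega> p * \<omega> q"
  shows "path_character U \<omega>"
  using assms unfolding path_character_def by blast

lemma path_character_nonzero: "path_character U \<omega> \<Longrightarrow> path p \<Longrightarrow> path_image p \<subseteq> U \<Longrightarrow> \<omega> p \<noteq> 0"
  and path_character_homotopic: "path_character U \<omega> \<Longrightarrow> homotopic_paths U p q \<Longrightarrow> \<omega> p = \<omega> q"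
  and path_character_join: "\<lbrakk>path_character U \<omega>; path p; path_image p \<subseteq> U; path q; path_image q \<subseteq> U;
        pathfinish p = pathstart q\<rbrakk> \<Longrightarrow> \<omega> (p +++ q) = \<omega> p * \<omega> q"
  unfolding path_character_def by blast+

lemma path_character_cong:
  assumes "path_character U \<omega>" "path p" "path_image p \<subseteq> U" "\<And>t. t \<in> {0..1} \<Longrightarrow> p t = q t"
  shows "\<omega> p = \<omega> q"
  using path_character_homotopic[OF assms(1) homotopic_paths_eq[of p U q]] assms by blast

lemma path_character_subset:
  assumes "path_character U \<omega>" "V \<subseteq> U"
  shows "path_character V \<omega>"
  using assms homotopic_paths_subset[of V _ _ U] unfolding path_character_def by (meson subset_trans)

lemma path_character_const:
  assumes \<omega>: "path_character U \<omega>" and "path p" "path_image p \<subseteq> U" "\<And>t. t \<in> {0..1} \<Longrightarrow> p t = a"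
  shows "\<omega> p = 1"
proof -
  have a: "a \<in> U" using assms(3) assms(4)[of 0] by (auto simp: path_image_def)
  let ?c = "\<lambda>t::real. a"
  have c: "path ?c" "path_image ?c \<subseteq> U" using a by (auto simp: path_def path_image_def)
  have "\<omega> ?c = \<omega> (?c +++ ?c)" by (simp add: joinpaths_def)
  also have "\<dots> = \<omega> ?c * \<omega> ?c" using c by (intro path_character_join[OF \<omega>]) (auto simp: pathstart_def pathfinish_def)
  finally have "\<omega> ?c = 1" using path_character_nonzero[OF \<omega> c] by simp
  then show ?thesis using path_character_cong[OF \<omega> assms(2,3), of ?c] assms(4) by simp
qed

lemma path_compose_linepath:
  assumes "continuous_on D F" "closed_segment a b \<subseteq> D"
  shows "path (F \<circ> linepath a b)" "path_image (F \<circ> linepath a b) = F ` closed_segment a b"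
  using assms by (auto simp: path_image_compose intro!: path_continuous_image intro: continuous_on_subset)

lemma path_character_segments:
  fixes F :: "'b::real_normed_vector \<Rightarrow> 'a::topological_space"
  assumes \<omega>: "path_character U \<omega>" and F: "continuous_on D F" "convex D" "F ` D \<subseteq> U"
    and abc: "a \<in> D" "b \<in> D" "c \<in> D"
  shows "\<omega> (F \<circ> linepath a b) * \<omega> (F \<circ> linepath b c) = \<omega> (F \<circ> linepath a c)"
proof -
  have seg: "closed_segment x y \<subseteq> D" if "x \<in> D" "y \<in> D" for x y
    using F(2) that by (simp add: closed_segment_subset)
  have "homotopic_paths D (linepath a b +++ linepath b c) (linepath a c)"
  proof -
    have "simply_connected D" using F(2) convex_imp_simply_connected by blast
    then show ?thesis
      unfolding simply_connected_eq_homotopic_paths using seg abc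
      by (simp add: path_image_join)
  qed
  then have "homotopic_paths U (F \<circ> (linepath a b +++ linepath b c)) (F \<circ> linepath a c)"
    using F by (intro homotopic_paths_continuous_image[where S = D]) auto
  then have "\<omega> (F \<circ> linepath a c) = \<omega> ((F \<circ> linepath a b) +++ (F \<circ> linepath b c))"
    using path_character_homotopic[OF \<omega>] by (metis path_compose_join)
  also have "\<dots> = \<omega> (F \<circ> linepath a b) * \<omega> (F \<circ> linepath b c)"
  proof (rule path_character_join[OF \<omega>])
    have "F ` closed_segment a b \<subseteq> U" "F ` closed_segment b c \<subseteq> U"
      using seg abc F(3) by blast+
    then show "path_image (F \<circ> linepath a b) \<subseteq> U" "path_image (F \<circ> linepath b c) \<subseteq> U"
      using path_compose_linepath(2)[OF F(1) seg] abc by simp_all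
  qed (use path_compose_linepath(1)[OF F(1) seg] abc in \<open>simp_all add: pathfinish_compose pathstart_compose\<close>)
  finally show ?thesis ..
qed

section \<open>Van Kampen's argument for characters\<close>

text \<open>A potential for \<open>\<omega>\<close> pulled back along \<open>F\<close>. Only straight segments are tested because a segment crosses a cutting
  hyperplane at most once, whereas a path may cross it infinitely often; by homotopy invariance nothing is lost.\<close>

definition segment_potential ::
    "('b::real_normed_vector \<Rightarrow> 'a::topological_space) \<Rightarrow> 'a set \<Rightarrow> ((real \<Rightarrow> 'a) \<Rightarrow> complex) \<Rightarrow> 'b set \<Rightarrow> ('b \<Rightarrow> complex) \<Rightarrow> bool" where
  "segment_potential F U \<omega> C g \<longleftrightarrow>
     (\<forall>a b. closed_segment a b \<subseteq> C \<and> F ` closed_segment a b \<subseteq> U \<longrightarrow> g b = g a * \<omega> (F \<circ> linepath a b))"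

lemma segment_potential_scale: "segment_potential F U \<omega> C g \<Longrightarrow> segment_potential F U \<omega> C (\<lambda>x. k * g x)"
  unfolding segment_potential_def by (simp add: mult.assoc)

text \<open>The potential is integrated from \<open>c\<close>; it is path independent since \<open>C\<close> is convex and mapped into \<open>U\<close>.
  The statement is asymmetric so that it can be applied with \<open>U\<close> and \<open>V\<close> exchanged.\<close>

lemma segment_potential_exists:
  assumes \<omega>: "path_character U \<omega>" and F: "continuous_on C F" "convex C" "F ` C \<subseteq> U" and c: "c \<in> C"
    and "\<And>p. path p \<Longrightarrow> path_image p \<subseteq> U \<inter> V \<Longrightarrow> \<omega> p = \<omega>' p"
  shows "segment_potential F U \<omega> C (\<lambda>x. \<omega> (F \<circ> linepath c x))"
    and "segment_potential F V \<omega>' C (\<lambda>x. \<omega> (F \<circ> linepath c x))"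
    and "\<forall>x\<in>C. \<omega> (F \<circ> linepath c x) \<noteq> 0"
proof -
  have seg: "closed_segment x y \<subseteq> C" if "x \<in> C" "y \<in> C" for x y
    using F(2) that by (simp add: closed_segment_subset)
  have 1: "\<omega> (F \<circ> linepath c b) = \<omega> (F \<circ> linepath c a) * \<omega> (F \<circ> linepath a b)"
    if "closed_segment a b \<subseteq> C" for a b
  proof -
    have "a \<in> C" "b \<in> C" using that ends_in_segment by blast+
    then show ?thesis by (rule path_character_segments[OF \<omega> F c, symmetric])
  qed
  then show "segment_potential F U \<omega> C (\<lambda>x. \<omega> (F \<circ> linepath c x))"
    unfolding segment_potential_def by blast
  have 2: "\<omega> (F \<circ> linepath a b) = \<omega>' (F \<circ> linepath a b)" if "closed_segment a b \<subseteq> C" "F ` closed_segment a b \<subseteq> V" for a b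
    using assms(6) path_compose_linepath[OF F(1) that(1)] that F(3) by (metis Int_subset_iff image_mono subset_trans)
  show "segment_potential F V \<omega>' C (\<lambda>x. \<omega> (F \<circ> linepath c x))"
    unfolding segment_potential_def using 1 2 by metis
  show "\<forall>x\<in>C. \<omega> (F \<circ> linepath c x) \<noteq> 0"
  proof
    fix x assume "x \<in> C"
    then have "closed_segment c x \<subseteq> C" using seg c by blast
    then show "\<omega> (F \<circ> linepath c x) \<noteq> 0"
      using path_compose_linepath[OF F(1), of c x] F(3) by (intro path_character_nonzero[OF \<omega>]) auto
  qed
qed

lemma closed_segment_meets_hyperplane:
  fixes a b :: "'a::euclidean_space"
  assumes "a \<bullet> i \<le> c" "c \<le> b \<bullet> i"
  obtains m where "m \<in> closed_segment a b" "m \<bullet> i = c"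
    "closed_segment a m \<subseteq> {x. x \<bullet> i \<le> c}" "closed_segment m b \<subseteq> {x. x \<bullet> i \<ge> c}"
proof -
  have "connected (closed_segment a b)" by simp
  then obtain m where m: "m \<in> closed_segment a b" "m \<bullet> i = c"
    using connected_ivt_hyperplane[of "closed_segment a b" a b i c] assms
    by (auto simp: inner_commute)
  have "convex {x. x \<bullet> i \<le> c}" "convex {x. x \<bullet> i \<ge> c}"
    using convex_halfspace_le[of i c] convex_halfspace_ge[of c i] by (auto simp: inner_commute)
  then show ?thesis using m assms by (intro that[of m] closed_segment_subset) auto
qed

lemma segment_potential_glue:
  fixes F :: "'b::euclidean_space \<Rightarrow> 'a::topological_space"
  assumes \<omega>: "path_character U \<omega>" and F: "continuous_on C F" "convex C"
    and 1: "segment_potential F U \<omega> (C \<inter> {x. x \<bullet> i \<le> c}) g1"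
    and 2: "segment_potential F U \<omega> (C \<inter> {x. x \<bullet> i \<ge> c}) g2"
    and eq: "\<And>x. x \<in> C \<Longrightarrow> x \<bullet> i = c \<Longrightarrow> g1 x = g2 x"
  shows "segment_potential F U \<omega> C (\<lambda>x. if x \<bullet> i \<le> c then g1 x else g2 x)"
proof -
  let ?g = "\<lambda>x. if x \<bullet> i \<le> c then g1 x else g2 x"
  have rule1: "?g b = ?g a * \<omega> (F \<circ> linepath a b)"
    if ab: "closed_segment a b \<subseteq> C \<inter> {x. x \<bullet> i \<le> c}" "F ` closed_segment a b \<subseteq> U" for a b
  proof -
    have "a \<bullet> i \<le> c" "b \<bullet> i \<le> c" using ab by auto
    then show ?thesis using 1 ab unfolding segment_potential_def by simp
  qed
  have g2: "?g x = g2 x" if "x \<in> C" "x \<bullet> i \<ge> c" for x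
    using eq that by auto
  have rule2: "?g b = ?g a * \<omega> (F \<circ> linepath a b)"
    if ab: "closed_segment a b \<subseteq> C \<inter> {x. x \<bullet> i \<ge> c}" "F ` closed_segment a b \<subseteq> U" for a b
  proof -
    have "a \<in> C" "b \<in> C" "a \<bullet> i \<ge> c" "b \<bullet> i \<ge> c" using ab by auto
    then show ?thesis using 2 ab g2 unfolding segment_potential_def by simp
  qed
  have "?g b = ?g a * \<omega> (F \<circ> linepath a b)"
    if ab: "closed_segment a b \<subseteq> C" "F ` closed_segment a b \<subseteq> U" for a b
  proof -
    have cont: "continuous_on (closed_segment a b) F" using F(1) ab(1) continuous_on_subset by blast
    have trans: "\<omega> (F \<circ> linepath a m) * \<omega> (F \<circ> linepath m b) = \<omega> (F \<circ> linepath a b)" if "m \<in> closed_segment a b" for m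
      using that ab(2) by (intro path_character_segments[OF \<omega> cont]) auto
    have split: ?thesis if m: "m \<in> closed_segment a b" 
      and "?g m = ?g a * \<omega> (F \<circ> linepath a m)" "?g b = ?g m * \<omega> (F \<circ> linepath m b)" for m
      by (simp only: that(2,3) trans[OF m, symmetric] mult.assoc)
    have sub: "closed_segment a m \<subseteq> closed_segment a b" "closed_segment m b \<subseteq> closed_segment a b" if "m \<in> closed_segment a b" for m
      using Un_closed_segment[OF that] by auto
    consider "a \<bullet> i \<le> c" "c \<le> b \<bullet> i" | "b \<bullet> i \<le> c" "c \<le> a \<bullet> i" | "a \<bullet> i \<le> c" "b \<bullet> i \<le> c" | "a \<bullet> i \<ge> c" "b \<bullet> i \<ge> c"
      by linarith
    then show ?thesis
    proof cases
      case 1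
      then obtain m where m: "m \<in> closed_segment a b" "closed_segment a m \<subseteq> {x. x \<bullet> i \<le> c}" "closed_segment m b \<subseteq> {x. x \<bullet> i \<ge> c}"
        using closed_segment_meets_hyperplane by metis
      have "?g m = ?g a * \<omega> (F \<circ> linepath a m)"
        using sub[OF m(1)] m ab by (intro rule1) blast+
      moreover have "?g b = ?g m * \<omega> (F \<circ> linepath m b)"
        using sub[OF m(1)] m ab by (intro rule2) blast+
      ultimately show ?thesis by (rule split[OF m(1)])
    next
      case 2
      then obtain m where m: "m \<in> closed_segment a b" "closed_segment m b \<subseteq> {x. x \<bullet> i \<le> c}" "closed_segment a m \<subseteq> {x. x \<bullet> i \<ge> c}"
        using closed_segment_meets_hyperplane[of b i c a] by (metis closed_segment_commute)
      have "?g m = ?g a * \<omega> (F \<circ> linepath a m)"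
        using sub[OF m(1)] m ab by (intro rule2) blast+
      moreover have "?g b = ?g m * \<omega> (F \<circ> linepath m b)"
        using sub[OF m(1)] m ab by (intro rule1) blast+
      ultimately show ?thesis by (rule split[OF m(1)])
    next
      case 3
      have "convex {x. x \<bullet> i \<le> c}" using convex_halfspace_le[of i c] by (simp add: inner_commute)
      then have "closed_segment a b \<subseteq> {x. x \<bullet> i \<le> c}" using 3 by (simp add: closed_segment_subset)
      then show ?thesis using ab by (intro rule1) auto
    next
      case 4
      have "convex {x. x \<bullet> i \<ge> c}" using convex_halfspace_ge[of c i] by (simp add: inner_commute)
      then have "closed_segment a b \<subseteq> {x. x \<bullet> i \<ge> c}" using 4 by (simp add: closed_segment_subset)
      then show ?thesis using ab by (intro rule2) auto
    qed
  qed
  then show ?thesis unfolding segment_potential_def by blast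
qed

text \<open>On a piece that is mapped into \<open>U\<close> or into \<open>V\<close> the potential is given by integration. Two pieces are glued along a convex slice:
  there the quotient of the two potentials is locally constant, because the points of the slice near a given one are joined
  to it by segments that both potentials measure by the same character. Hence one potential
  has to be multiplied by a constant only.\<close>

lemma van_kampen_potential:
  fixes F :: "'b::euclidean_space \<Rightarrow> 'a::topological_space"
  assumes X: "openin (top_of_set X) U" "openin (top_of_set X) V" "U \<union> V = X"
    and \<omega>: "path_character U \<omega>" "path_character V \<omega>'"
    and agree: "\<And>p. path p \<Longrightarrow> path_image p \<subseteq> U \<inter> V \<Longrightarrow> \<omega> p = \<omega>' p"
    and F: "continuous_on Q F" "F ` Q \<subseteq> X" and Q: "compact Q" "convex Q"
  obtains g where "segment_potential F U \<omega> Q g" "\<And>x. x \<in> Q \<Longrightarrow> g x \<noteq> 0"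
proof -
  have pre: "\<exists>G. open G \<and> Q \<inter> F -` W = Q \<inter> G" if "openin (top_of_set X) W" for W
    using continuous_openin_preimage[of Q F X W] that F by (auto simp: openin_open)
  obtain OU OV where O: "open OU" "open OV" "Q \<inter> F -` U = Q \<inter> OU" "Q \<inter> F -` V = Q \<inter> OV"
    using pre[OF X(1)] pre[OF X(2)] by blast
  have "Q \<subseteq> \<Union> {OU, OV}"
  proof
    fix q assume q: "q \<in> Q"
    then have "F q \<in> U \<or> F q \<in> V" using F(2) X(3) by blast
    then show "q \<in> \<Union> {OU, OV}" using O(3,4) q by auto
  qed
  then obtain \<delta> where \<delta>: "\<delta> > 0" "\<And>T. T \<subseteq> Q \<Longrightarrow> diameter T < \<delta> \<Longrightarrow> \<exists>B\<in>{OU, OV}. T \<subseteq> B"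
    using Lebesgue_number_lemma[of Q "{OU, OV}"] Q(1) O(1,2) by blast
  define P where "P C \<longleftrightarrow> (\<exists>g. segment_potential F U \<omega> C g \<and> segment_potential F V \<omega>' C g \<and> (\<forall>x\<in>C. g x \<noteq> 0))" for C
  have "P Q"
  proof (rule convex_subdivision[OF Q \<delta>(1)])
    fix C assume C: "compact C" "convex C" "C \<subseteq> Q" "diameter C < \<delta>"
    have cont: "continuous_on C F" using F(1) C(3) continuous_on_subset by blast
    have or: "F ` C \<subseteq> U \<or> F ` C \<subseteq> V" using \<delta>(2)[OF C(3,4)] O(3,4) C(3) by blast
    show "P C"
    proof (cases "C = {}")
      case True
      then show ?thesis unfolding P_def segment_potential_def by simp
    next
      case False
      then obtain c where c: "c \<in> C" by blast
      from or show ?thesis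
      proof
        assume "F ` C \<subseteq> U"
        from segment_potential_exists[OF \<omega>(1) cont C(2) this c agree] show ?thesis unfolding P_def by blast
      next
        assume "F ` C \<subseteq> V"
        from segment_potential_exists[OF \<omega>(2) cont C(2) this c, of U \<omega>] agree show ?thesis unfolding P_def
          by (metis Int_commute)
      qed
    qed
  next
    fix C :: "'b set" and i :: 'b and c :: real
    let ?A = "C \<inter> {x. x \<bullet> i \<le> c}" and ?B = "C \<inter> {x. x \<bullet> i \<ge> c}"
    assume C: "compact C" "convex C" "C \<subseteq> Q" and "i \<in> Basis" and PA: "P ?A" and PB: "P ?B"
    have cont: "continuous_on C F" using F(1) C(3) continuous_on_subset by blast
    obtain g1 where g1: "segment_potential F U \<omega> ?A g1" "segment_potential F V \<omega>' ?A g1" "\<forall>x\<in>?A. g1 x \<noteq> 0"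
      using PA unfolding P_def by blast
    obtain g2 where g2: "segment_potential F U \<omega> ?B g2" "segment_potential F V \<omega>' ?B g2" "\<forall>x\<in>?B. g2 x \<noteq> 0"
      using PB unfolding P_def by blast
    let ?I = "C \<inter> {x. x \<bullet> i = c}"
    have cvI: "convex ?I"
      using C(2) convex_hyperplane[of i c] by (intro convex_Int) (auto simp: inner_commute)
    have const: "g1 a / g2 a = g1 b / g2 b" if ab: "a \<in> ?I" "b \<in> ?I" for a b
    proof (rule connected_local_const[where f = "\<lambda>x. g1 x / g2 x", OF convex_connected[OF cvI] ab], intro ballI)
      fix x assume x: "x \<in> ?I"
      have xO: "x \<in> OU \<or> x \<in> OV" using O x C(3) F(2) X(3) by blast
      have local: "\<forall>\<^sub>F y in at x within ?I. g1 x / g2 x = g1 y / g2 y"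
        if W: "open W" "x \<in> W" "Q \<inter> F -` S = Q \<inter> W"
          and sp: "segment_potential F S \<eta> ?A g1" "segment_potential F S \<eta> ?B g2" and \<eta>: "path_character S \<eta>" for W S \<eta>
      proof -
        obtain r where r: "r > 0" "ball x r \<subseteq> W" using W openE by blast
        have "g1 x / g2 x = g1 y / g2 y" if y: "y \<in> ?I" "dist y x < r" for y
        proof -
          have "closed_segment x y \<subseteq> ball x r"
            using y r by (intro closed_segment_subset) (auto simp: dist_commute)
          then have sub: "closed_segment x y \<subseteq> ?I" "F ` closed_segment x y \<subseteq> S"
            using closed_segment_subset[OF x y(1) cvI] r(2) W(3) C(3) by blast+
          then have "closed_segment x y \<subseteq> ?A" "closed_segment x y \<subseteq> ?B" by auto
          with sub(2) have "g1 y = g1 x * \<eta> (F \<circ> linepath x y)" "g2 y = g2 x * \<eta> (F \<circ> linepath x y)"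
            using sp unfolding segment_potential_def by blast+
          moreover have "\<eta> (F \<circ> linepath x y) \<noteq> 0"
            using path_compose_linepath[OF cont, of x y] sub by (intro path_character_nonzero[OF \<eta>]) auto
          ultimately show ?thesis by simp
        qed
        then show ?thesis unfolding eventually_at using r(1) by blast
      qed
      show "\<forall>\<^sub>F y in at x within ?I. g1 x / g2 x = g1 y / g2 y"
        using xO
      proof
        assume "x \<in> OU"
        then show ?thesis by (rule local[OF O(1) _ O(3) g1(1) g2(1) \<omega>(1)])
      next
        assume "x \<in> OV"
        then show ?thesis by (rule local[OF O(2) _ O(4) g1(2) g2(2) \<omega>(2)])
      qed
    qed
    obtain k where k: "k \<noteq> 0" "\<And>x. x \<in> ?I \<Longrightarrow> g1 x = k * g2 x"
    proof (cases "?I = {}")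
      case True
      show ?thesis by (rule that[of 1]) (use True in auto)
    next
      case False
      then obtain a where a: "a \<in> ?I" by blast
      show ?thesis
      proof (rule that[of "g1 a / g2 a"])
        show "g1 a / g2 a \<noteq> 0" using a g1(3) g2(3) by simp
        fix x assume x: "x \<in> ?I"
        then have "g2 x \<noteq> 0" using g2(3) by auto
        then show "g1 x = g1 a / g2 a * g2 x" using const[OF a x] by simp
      qed
    qed
    let ?g = "\<lambda>x. if x \<bullet> i \<le> c then g1 x else k * g2 x"
    have "segment_potential F U \<omega> C ?g"
      using k(2) by (intro segment_potential_glue[OF \<omega>(1) cont C(2) g1(1) segment_potential_scale[OF g2(1)]]) auto
    moreover have "segment_potential F V \<omega>' C ?g"
      using k(2) by (intro segment_potential_glue[OF \<omega>(2) cont C(2) g1(2) segment_potential_scale[OF g2(2)]]) auto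
    moreover have "\<forall>x\<in>C. ?g x \<noteq> 0" using g1(3) g2(3) k(1) by auto
    ultimately show "P C" unfolding P_def by blast
  qed
  then show ?thesis using that unfolding P_def by blast
qed

text \<open>A null-homotopy of \<open>\<gamma>\<close> is a map of a square. A potential on the square does not change along three of its
  sides, where the map is constant, hence not along the fourth, where it changes by the factor \<open>\<omega> \<gamma>\<close>.\<close>

theorem van_kampen_character_trivial:
  fixes X :: "'a::topological_space set"
  assumes X: "openin (top_of_set X) U" "openin (top_of_set X) V" "U \<union> V = X"
    and \<omega>: "path_character U \<omega>" "path_character V \<omega>'"
    and agree: "\<And>p. path p \<Longrightarrow> path_image p \<subseteq> U \<inter> V \<Longrightarrow> \<omega> p = \<omega>' p"
    and \<gamma>: "path \<gamma>" "path_image \<gamma> \<subseteq> U" and null: "homotopic_paths X \<gamma> (\<lambda>_. x)"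
  shows "\<omega> \<gamma> = 1"
proof -
  let ?Q = "{0..1::real} \<times> {0..1::real}"
  obtain F where F: "continuous_on ?Q F" "F ` ?Q \<subseteq> X" "\<And>t. t \<in> {0..1} \<Longrightarrow> F (0, t) = \<gamma> t"
      "\<And>t. t \<in> {0..1} \<Longrightarrow> F (1, t) = x"
      "\<And>t. t \<in> {0..1} \<Longrightarrow> F (t, 0) = pathstart \<gamma>" "\<And>t. t \<in> {0..1} \<Longrightarrow> F (t, 1) = pathfinish \<gamma>"
  proof -
    obtain F where "continuous_on ?Q F" "F \<in> ?Q \<rightarrow> X" "\<forall>t\<in>{0..1}. F (0, t) = \<gamma> t" "\<forall>t\<in>{0..1}. F (1, t) = x"
      "\<forall>t\<in>{0..1}. pathstart (F \<circ> Pair t) = pathstart \<gamma> \<and> pathfinish (F \<circ> Pair t) = pathfinish \<gamma>"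
      using null unfolding homotopic_paths by blast
    then show thesis by (intro that[of F]) (auto simp: pathstart_def pathfinish_def)
  qed
  have ends: "pathstart \<gamma> = x" "pathfinish \<gamma> = x"
    using F(4)[of 0] F(4)[of 1] F(5)[of 1] F(6)[of 1] by auto
  have xU: "x \<in> U" using \<gamma>(2) ends pathstart_in_path_image by blast
  have Q: "compact ?Q" "convex ?Q" by (auto intro: compact_Times convex_Times)
  obtain g where g: "segment_potential F U \<omega> ?Q g" "\<And>x. x \<in> ?Q \<Longrightarrow> g x \<noteq> 0"
    using van_kampen_potential[OF X \<omega> agree F(1,2) Q] by blast
  have seg: "closed_segment a b \<subseteq> ?Q" if "a \<in> ?Q" "b \<in> ?Q" for a b
    using Q(2) that by (simp add: closed_segment_subset)
  have const: "g b = g a" if ab: "a \<in> ?Q" "b \<in> ?Q" and "\<And>y. y \<in> closed_segment a b \<Longrightarrow> F y = x" for a b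
  proof -
    have *: "F ` closed_segment a b \<subseteq> U" using that(3) xU by auto
    have "\<omega> (F \<circ> linepath a b) = 1"
      using path_compose_linepath[OF F(1) seg[OF ab]] * that(3)
      by (intro path_character_const[OF \<omega>(1)]) (auto simp: linepath_in_path)
    moreover have "g b = g a * \<omega> (F \<circ> linepath a b)"
      using g(1) * seg[OF ab] unfolding segment_potential_def by blast
    ultimately show ?thesis by simp
  qed
  have vert: "closed_segment (s, 0) (s, 1) \<subseteq> {s} \<times> {0..1::real}" for s :: real
    by (rule closed_segment_subset) (auto intro!: convex_Times)
  have hor: "closed_segment (0, s) (1, s) \<subseteq> {0..1::real} \<times> {s}" for s :: real
    by (rule closed_segment_subset) (auto intro!: convex_Times)
  have "g (1, 0) = g (0, 0)" using hor[of 0] F(5) ends by (intro const) auto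
  moreover have "g (1, 1) = g (0, 1)" using hor[of 1] F(6) ends by (intro const) auto
  moreover have "g (1, 1) = g (1, 0)" using vert[of 1] F(4) by (intro const) auto
  ultimately have "g (0, 1) = g (0, 0)" by simp
  moreover have "g (0, 1) = g (0, 0) * \<omega> (F \<circ> linepath (0, 0) (0, 1))"
  proof -
    have "F ` closed_segment (0, 0) (0, 1) \<subseteq> U"
    proof
      fix y assume "y \<in> F ` closed_segment (0, 0) (0, 1)"
      then obtain t where "t \<in> {0..1}" "y = F (0, t)" using vert[of 0] by auto
      then show "y \<in> U" using F(3)[of t] \<gamma>(2) unfolding path_image_def by auto
    qed
    moreover have "closed_segment (0, 0) (0, 1) \<subseteq> ?Q" by (rule seg) auto
    ultimately show ?thesis using g(1) unfolding segment_potential_def by blast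
  qed
  moreover have "\<omega> \<gamma> = \<omega> (F \<circ> linepath (0, 0) (0, 1))"
    using F(3) by (intro path_character_cong[OF \<omega>(1) \<gamma>]) (simp add: linepath_def scaleR_prod_def)
  ultimately show ?thesis using g(2)[of "(0,0)"] by simp
qed

section \<open>Extending a character over a solid torus\<close>

lemma convex_homotopic_paths:
  fixes S :: "'a::real_normed_vector set"
  assumes "convex S" "path p" "path_image p \<subseteq> S" "path q" "path_image q \<subseteq> S"
    "pathstart q = pathstart p" "pathfinish q = pathfinish p"
  shows "homotopic_paths S p q"
  using convex_imp_simply_connected[OF assms(1)] assms(2-)
  unfolding simply_connected_eq_homotopic_paths by blast

lemma path_character_mult:
  "path_character U \<omega> \<Longrightarrow> path_character U \<eta> \<Longrightarrow> path_character U (\<lambda>p. \<omega> p * \<eta> p)"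
  unfolding path_character_def by auto

lemma path_character_coboundary:
  assumes "\<And>y. y \<in> U \<Longrightarrow> \<beta> y \<noteq> 0"
  shows "path_character U (\<lambda>p. \<beta> (pathfinish p) / \<beta> (pathstart p))"
proof (rule path_characterI)
  have ends: "\<beta> (pathstart p) \<noteq> 0" "\<beta> (pathfinish p) \<noteq> 0" if "path_image p \<subseteq> U" for p
    using that assms pathstart_in_path_image pathfinish_in_path_image by blast+
  show "\<beta> (pathfinish p) / \<beta> (pathstart p) \<noteq> 0" if "path_image p \<subseteq> U" for p
    using ends[OF that] by simp
  show "\<beta> (pathfinish p) / \<beta> (pathstart p) = \<beta> (pathfinish q) / \<beta> (pathstart q)" if "homotopic_paths U p q" for p q
    using homotopic_paths_imp_pathstart[OF that] homotopic_paths_imp_pathfinish[OF that] by simp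
  show "\<beta> (pathfinish (p +++ q)) / \<beta> (pathstart (p +++ q))
      = \<beta> (pathfinish p) / \<beta> (pathstart p) * (\<beta> (pathfinish q) / \<beta> (pathstart q))"
    if "path_image p \<subseteq> U" "path_image q \<subseteq> U" "pathfinish p = pathstart q" for p q
    using ends[OF that(1)] ends[OF that(2)] that(3) by simp
qed

lemma path_character_pullback:
  assumes \<omega>: "path_character U \<omega>" and f: "continuous_on V f" "f ` V \<subseteq> U"
  shows "path_character V (\<lambda>p. \<omega> (f \<circ> p))"
proof (rule path_characterI)
  have comp: "path (f \<circ> p)" "path_image (f \<circ> p) \<subseteq> U" if "path p" "path_image p \<subseteq> V" for p
    using that f continuous_on_subset[OF f(1) that(2)] path_image_compose[of f p]
    by (auto intro: path_continuous_image)
  show "\<omega> (f \<circ> p) \<noteq> 0" if "path p" "path_image p \<subseteq> V" for p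
    using path_character_nonzero[OF \<omega>] comp that by blast
  show "\<omega> (f \<circ> p) = \<omega> (f \<circ> q)" if "homotopic_paths V p q" for p q
    using that f by (intro path_character_homotopic[OF \<omega>] homotopic_paths_continuous_image[where S = V]) auto
  show "\<omega> (f \<circ> (p +++ q)) = \<omega> (f \<circ> p) * \<omega> (f \<circ> q)"
    if "path p" "path_image p \<subseteq> V" "path q" "path_image q \<subseteq> V" "pathfinish p = pathstart q" for p q
    using path_character_join[OF \<omega> comp[OF that(1,2)] comp[OF that(3,4)]] that(5)
    by (simp add: path_compose_join pathfinish_compose pathstart_compose)
qed

lemma path_character_winding:
  assumes u: "continuous_on U u" "\<And>y. y \<in> U \<Longrightarrow> u y \<noteq> 0"
  shows "path_character U (\<lambda>p. exp (c * winding_number (u \<circ> p) 0))"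
proof -
  have base: "path_character (- {0}) (\<lambda>p. exp (c * winding_number p 0))"
  proof (rule path_characterI)
    show "exp (c * winding_number p 0) = exp (c * winding_number q 0)" if "homotopic_paths (- {0}) p q" for p q
      using winding_number_homotopic_paths[OF that] by simp
    show "exp (c * winding_number (p +++ q) 0) = exp (c * winding_number p 0) * exp (c * winding_number q 0)"
      if "path p" "path_image p \<subseteq> - {0}" "path q" "path_image q \<subseteq> - {0}" "pathfinish p = pathstart q" for p q
    proof -
      have "0 \<notin> path_image p" "0 \<notin> path_image q" using that by blast+
      then show ?thesis using winding_number_join[of p 0 q] that by (simp add: distrib_left exp_add)
    qed
  qed simp
  have "u ` U \<subseteq> - {0}" using u(2) by auto
  from path_character_pullback[OF base u(1) this] show ?thesis .
qed

text \<open>The path need not be closed: its winding number is then the total change of a logarithm.\<close>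

lemma winding_number_exp_lift:
  assumes "path p" "\<And>t. t \<in> {0..1} \<Longrightarrow> q t = exp (p t)"
  shows "winding_number q 0 = (p 1 - p 0) / (2 * of_real pi * \<i>)"
proof -
  have "winding_number q 0 = winding_number (exp \<circ> p) 0"
    using assms(2) by (intro winding_number_cong) auto
  then show ?thesis using winding_number_compose_exp[OF assms(1)] by (simp add: pathstart_def pathfinish_def)
qed

lemma path_logarithm:
  assumes "path q" "0 \<notin> path_image q"
  obtains p where "path p" "\<And>t. t \<in> {0..1} \<Longrightarrow> q t = exp (p t :: complex)"
  using continuous_logarithm_on_contractible[of "{0..1}" q] assms
  unfolding path_def path_image_def by (metis convex_imp_contractible convex_real_interval(5) imageI)

lemma int_translation_invariant:
  fixes F :: "int \<Rightarrow> 'a"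
  assumes "\<And>m. F (m + 1) = F m"
  shows "F m = F 0"
proof (induction m rule: int_induct[of _ 0])
  case (step2 i)
  then show ?case using assms[of "i - 1"] by simp
qed (use assms in auto)

text \<open>The fundamental group of annulus times circle is generated by the meridian and a longitude. If \<open>\<omega>\<close> is
  trivial on the meridian, then up to a coboundary it depends on the circle coordinate only, namely through \<open>e\<^sup>l\<close>,
  its value on the longitude. The function \<open>\<beta>\<close> is obtained on the universal cover, a convex set, by integrating \<open>\<omega>\<close>
  and then dividing by the expected growth \<open>e\<^bsup>l \<theta>\<^esup>\<close>; what remains is invariant under deck transformations.
  Since the values of characters are not topologised, \<open>\<beta>\<close> need not be continuous.\<close>

lemma annulus_circle_character:
  fixes \<omega> :: "(real \<Rightarrow> complex \<times> complex) \<Rightarrow> complex"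
  defines "A \<equiv> \<lambda>r. {z. r < norm z \<and> norm z < 1} \<times> sphere 0 1"
  assumes r: "0 \<le> r" and s: "r < s" "s < 1" and \<omega>: "path_character (A r) \<omega>"
    and mer: "\<omega> (\<lambda>t. (of_real s * exp (2 * of_real pi * \<i> * of_real t), 1)) = 1"
  obtains l \<beta> where "\<And>y. y \<in> A r \<Longrightarrow> \<beta> y \<noteq> 0"
    "\<And>p. path p \<Longrightarrow> path_image p \<subseteq> A r \<Longrightarrow>
       \<omega> p = exp (l * winding_number (snd \<circ> p) 0) * (\<beta> (pathfinish p) / \<beta> (pathstart p))"
proof -
  define E :: "complex \<times> real \<Rightarrow> complex \<times> complex" where "E = (\<lambda>(x, \<theta>). (exp x, cis (2 * pi * \<theta>)))"
  define L :: "(complex \<times> real) set" where "L = (Re -` {x. r < exp x \<and> exp x < 1}) \<times> UNIV"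
  have cvL: "convex L"
  proof -
    have "is_interval {x. r < exp x \<and> exp x < (1::real)}"
      unfolding is_interval_1
    proof (intro ballI allI impI)
      fix a b x :: real
      assume "a \<in> {x. r < exp x \<and> exp x < 1}" "b \<in> {x. r < exp x \<and> exp x < 1}" "a \<le> x \<and> x \<le> b"
      then have "r < exp a" "exp b < 1" "exp a \<le> exp x" "exp x \<le> exp b" by simp_all
      then have "r < exp x" "exp x < 1" by linarith+
      then show "x \<in> {x. r < exp x \<and> exp x < 1}" by blast
    qed
    then have "convex {x. r < exp x \<and> exp x < (1::real)}" using is_interval_convex by blast
    then have "convex (Re -` {x. r < exp x \<and> exp x < 1})"
      by (intro convex_linear_vimage) (auto intro: bounded_linear.linear bounded_linear_Re)
    then show ?thesis unfolding L_def by (intro convex_Times) auto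
  qed
  have EL: "continuous_on L E" "E ` L \<subseteq> A r"
    unfolding E_def L_def A_def by (auto simp: case_prod_unfold intro!: continuous_intros continuous_on_cis)
  define \<Omega> where "\<Omega> a b = \<omega> (E \<circ> linepath a b)" for a b
  have trans: "\<Omega> a b * \<Omega> b c = \<Omega> a c" if "a \<in> L" "b \<in> L" "c \<in> L" for a b c
    unfolding \<Omega>_def using path_character_segments[OF \<omega> EL(1) cvL EL(2)] that by blast
  have nz: "\<Omega> a b \<noteq> 0" if "a \<in> L" "b \<in> L" for a b
  proof -
    have "closed_segment a b \<subseteq> L" using closed_segment_subset[OF that cvL] .
    then show ?thesis unfolding \<Omega>_def
      using path_compose_linepath[OF EL(1), of a b] EL(2) by (intro path_character_nonzero[OF \<omega>]) auto
  qed
  define a0 where "a0 = (complex_of_real (ln s), 0::real)"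
  have a0: "a0 \<in> L" using r s by (simp add: a0_def L_def)
  define B where "B a = \<Omega> a0 a" for a
  have Bnz: "B a \<noteq> 0" if "a \<in> L" for a using nz[OF a0 that] by (simp add: B_def)
  have shift: "B (a + \<tau>) = \<Omega> a0 (a0 + \<tau>) * B a"
    if a: "a \<in> L" and \<tau>: "a0 + \<tau> \<in> L" "a + \<tau> \<in> L" "\<And>x. E (x + \<tau>) = E x" for a \<tau>
  proof -
    have "E \<circ> linepath (a0 + \<tau>) (a + \<tau>) = E \<circ> linepath a0 a"
    proof
      fix t
      have "linepath (a0 + \<tau>) (a + \<tau>) t = linepath a0 a t + \<tau>" by (simp add: linepath_def algebra_simps)
      then show "(E \<circ> linepath (a0 + \<tau>) (a + \<tau>)) t = (E \<circ> linepath a0 a) t" using \<tau>(3) by simp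
    qed
    then have "\<Omega> (a0 + \<tau>) (a + \<tau>) = B a" by (simp add: \<Omega>_def B_def)
    then show ?thesis using trans[OF a0 \<tau>(1,2)] by (simp add: B_def)
  qed
  have Lm: "a + (2 * of_real pi * \<i>, 0) \<in> L" "a + (0, 1) \<in> L" if "a \<in> L" for a
    using that by (auto simp: L_def)
  have Em: "E (x + (2 * of_real pi * \<i>, 0)) = E x" "E (x + (0, 1)) = E x" for x
    by (auto simp: E_def case_prod_unfold exp_add cis_mult[symmetric] distrib_left)
  have mer1: "\<Omega> a0 (a0 + (2 * of_real pi * \<i>, 0)) = 1"
  proof -
    have "E \<circ> linepath a0 (a0 + (2 * of_real pi * \<i>, 0)) = (\<lambda>t. (of_real s * exp (2 * of_real pi * \<i> * of_real t), 1))"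
    proof
      fix t
      have "linepath a0 (a0 + (2 * of_real pi * \<i>, 0)) t = (of_real (ln s) + 2 * of_real pi * \<i> * of_real t, 0)"
        by (simp add: linepath_def a0_def algebra_simps scaleR_conv_of_real)
      moreover have "exp (complex_of_real (ln s)) = of_real s" using r s by (simp add: exp_of_real)
      ultimately show "(E \<circ> linepath a0 (a0 + (2 * of_real pi * \<i>, 0))) t = (of_real s * exp (2 * of_real pi * \<i> * of_real t), 1)"
        by (simp add: E_def exp_add)
    qed
    then show ?thesis unfolding \<Omega>_def using mer by simp
  qed
  have B1: "B (a + (2 * of_real pi * \<i>, 0)) = B a" if "a \<in> L" for a
    using shift[OF that Lm(1)[OF a0] Lm(1)[OF that] Em(1)] mer1 by simp
  obtain l where l: "\<Omega> a0 (a0 + (0, 1)) = exp l"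
    using nz[OF a0 Lm(2)[OF a0]] by (metis exp_Ln)
  have B2: "B (a + (0, 1)) = exp l * B a" if "a \<in> L" for a
    using shift[OF that Lm(2)[OF a0] Lm(2)[OF that] Em(2)] l by simp
  \<comment> \<open>Divide by the growth of \<open>B\<close> along the longitude.\<close>
  define \<beta>' where "\<beta>' a = B a * exp (- l * of_real (snd a))" for a
  have \<beta>'1: "\<beta>' (a + (2 * of_real pi * \<i>, 0)) = \<beta>' a" if "a \<in> L" for a
    using B1[OF that] by (simp add: \<beta>'_def)
  have \<beta>'2: "\<beta>' (a + (0, 1)) = \<beta>' a" if "a \<in> L" for a
    using B2[OF that] by (simp add: \<beta>'_def distrib_left exp_diff exp_minus field_simps flip: exp_add)
  have inv: "\<beta>' (a + (of_int m * (2 * of_real pi * \<i>), of_int n)) = \<beta>' a" if a: "a \<in> L" for a m n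
  proof -
    have in_L: "a + (of_int m * (2 * of_real pi * \<i>), of_int n) \<in> L" for m n :: int
      using a by (auto simp: L_def)
    have "\<beta>' (a + (of_int m * (2 * of_real pi * \<i>), of_int n)) = \<beta>' (a + (of_int 0 * (2 * of_real pi * \<i>), of_int n))"
    proof (rule int_translation_invariant)
      fix m :: int
      show "\<beta>' (a + (of_int (m + 1) * (2 * of_real pi * \<i>), of_int n)) = \<beta>' (a + (of_int m * (2 * of_real pi * \<i>), of_int n))"
        using \<beta>'1[OF in_L[of m n]] by (simp add: algebra_simps)
    qed
    also have "\<dots> = \<beta>' (a + (of_int 0 * (2 * of_real pi * \<i>), of_int 0))"
    proof (rule int_translation_invariant)
      fix n :: int
      show "\<beta>' (a + (of_int 0 * (2 * of_real pi * \<i>), of_int (n + 1))) = \<beta>' (a + (of_int 0 * (2 * of_real pi * \<i>), of_int n))"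
        using \<beta>'2[OF in_L[of 0 n]] by (simp add: algebra_simps)
    qed
    finally show ?thesis by (simp add: zero_prod_def[symmetric])
  qed
  have Einj: "\<beta>' a = \<beta>' b" if ab: "a \<in> L" "b \<in> L" "E a = E b" for a b
  proof -
    obtain x \<theta> y \<phi> where xy: "a = (x, \<theta>)" "b = (y, \<phi>)" by (metis surj_pair)
    have "exp x = exp y" "cis (2 * pi * \<theta>) = cis (2 * pi * \<phi>)" using ab(3) by (auto simp: E_def xy)
    obtain m where m: "x = y + of_int m * (2 * of_real pi * \<i>)"
    proof -
      obtain m :: int where "x = y + of_real (of_int (2 * m) * pi) * \<i>"
        using \<open>exp x = exp y\<close> unfolding exp_eq by blast
      moreover have "of_real (of_int (2 * m) * pi) * \<i> = of_int m * (2 * of_real pi * \<i>)" by simp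
      ultimately show ?thesis using that by metis
    qed
    obtain n where n: "\<theta> = \<phi> + of_int n"
    proof -
      have "exp (\<i> * of_real (2 * pi * \<theta>)) = exp (\<i> * of_real (2 * pi * \<phi>))"
        using \<open>cis _ = cis _\<close> by (simp add: cis_conv_exp)
      then obtain n where "\<i> * complex_of_real (2 * pi * \<theta>) = \<i> * of_real (2 * pi * \<phi>) + of_real (of_int (2 * n) * pi) * \<i>"
        unfolding exp_eq by blast
      then have "Im (\<i> * complex_of_real (2 * pi * \<theta>)) = Im (\<i> * of_real (2 * pi * \<phi>) + of_real (of_int (2 * n) * pi) * \<i>)"
        by (rule arg_cong)
      then have "2 * pi * \<theta> = 2 * pi * (\<phi> + of_int n)" by (simp add: algebra_simps)
      then show ?thesis using that by simp
    qed
    show ?thesis using inv[OF ab(2), of m n] by (simp add: xy m n)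
  qed
  define \<beta> where "\<beta> y = \<beta>' (SOME a. a \<in> L \<and> E a = y)" for y
  have \<beta>E: "\<beta> (E a) = \<beta>' a" if "a \<in> L" for a
  proof -
    have "(SOME b. b \<in> L \<and> E b = E a) \<in> L \<and> E (SOME b. b \<in> L \<and> E b = E a) = E a"
      by (rule someI[of _ a]) (simp add: that)
    then show ?thesis unfolding \<beta>_def using Einj that by blast
  qed
  have lift: "\<exists>q. path q \<and> path_image q \<subseteq> L \<and> (\<forall>t\<in>{0..1}. p t = E (q t)) \<and>
       winding_number (snd \<circ> p) 0 = of_real (snd (q 1) - snd (q 0))"
    if p: "path p" "path_image p \<subseteq> A r" for p
  proof -
    have ps: "fst (p t) \<noteq> 0" "r < norm (fst (p t))" "norm (fst (p t)) < 1" "norm (snd (p t)) = 1" if "t \<in> {0..1}" for t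
      using p(2) that r unfolding path_image_def A_def by force+
    have paths: "path (fst \<circ> p)" "path (snd \<circ> p)"
      using p(1) by (auto simp: path_def o_def intro!: continuous_intros)
    have "0 \<notin> path_image (fst \<circ> p)" using ps(1) by (force simp: path_image_def)
    then obtain x where x: "path x" "\<And>t. t \<in> {0..1} \<Longrightarrow> (fst \<circ> p) t = exp (x t)"
      using path_logarithm[OF paths(1)] by blast
    have "0 \<notin> path_image (snd \<circ> p)" using ps by (force simp: path_image_def)
    then obtain y where y: "path y" "\<And>t. t \<in> {0..1} \<Longrightarrow> (snd \<circ> p) t = exp (y t)"
      using path_logarithm[OF paths(2)] by blast
    have y0: "y t = \<i> * of_real (Im (y t))" if "t \<in> {0..1}" for t
    proof -
      have "exp (Re (y t)) = 1" using ps(4)[OF that] y(2)[OF that] by simp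
      then show ?thesis by (simp add: complex_eq_iff)
    qed
    \<comment> \<open>The real part of \<open>y\<close> vanishes, as the second coordinate has norm 1.\<close>
    define q where "q t = (x t, Im (y t) / (2 * pi))" for t
    have "path q" using x(1) y(1) unfolding q_def path_def by (intro continuous_intros) auto
    moreover have "p t = E (q t)" if "t \<in> {0..1}" for t
    proof -
      have "snd (p t) = cis (Im (y t))" using y(2)[OF that] y0[OF that] by (simp add: cis_conv_exp)
      then show ?thesis using x(2)[OF that] by (simp add: q_def E_def prod_eq_iff)
    qed
    moreover have "path_image q \<subseteq> L"
    proof -
      have "q t \<in> L" if "t \<in> {0..1}" for t
        using ps(2,3)[OF that] x(2)[OF that] by (simp add: q_def L_def)
      then show ?thesis by (auto simp: path_image_def)
    qed
    moreover have "winding_number (snd \<circ> p) 0 = of_real (snd (q 1) - snd (q 0))"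
    proof -
      have "winding_number (snd \<circ> p) 0 = (y 1 - y 0) / (2 * of_real pi * \<i>)"
        using winding_number_exp_lift[OF y] .
      also have "\<dots> = (\<i> * of_real (Im (y 1)) - \<i> * of_real (Im (y 0))) / (2 * of_real pi * \<i>)"
        using y0[of 0] y0[of 1] by simp
      also have "\<dots> = of_real (snd (q 1) - snd (q 0))" by (simp add: q_def field_simps)
      finally show ?thesis .
    qed
    ultimately show ?thesis by blast
  qed
  have \<omega>B: "B (q 1) = B (q 0) * \<omega> p"
    if p: "path p" "path_image p \<subseteq> A r" and q: "path q" "path_image q \<subseteq> L" "\<And>t. t \<in> {0..1} \<Longrightarrow> p t = E (q t)" for p q
  proof -
    have ends: "q 0 \<in> L" "q 1 \<in> L" using q(2) by (auto simp: path_image_def)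
    have "\<omega> p = \<omega> (E \<circ> q)" using q(3) by (intro path_character_cong[OF \<omega> p]) auto
    also have "\<dots> = \<Omega> (q 0) (q 1)"
      unfolding \<Omega>_def
    proof (rule path_character_homotopic[OF \<omega> homotopic_paths_continuous_image[OF _ EL(1)]])
      show "homotopic_paths L q (linepath (q 0) (q 1))"
        using q(1,2) closed_segment_subset[OF ends cvL]
        by (intro convex_homotopic_paths[OF cvL]) (simp_all, simp_all add: pathstart_def pathfinish_def)
    qed (use EL in auto)
    finally show ?thesis using trans[OF a0 ends] by (simp add: B_def)
  qed
  show ?thesis
  proof (rule that[of \<beta> l])
    fix y assume y: "y \<in> A r"
    have "path (\<lambda>_::real. y)" "path_image (\<lambda>_::real. y) \<subseteq> A r" using y by (auto simp: path_def path_image_def)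
    from lift[OF this] obtain q where "path_image q \<subseteq> L" "\<forall>t\<in>{0..1}. y = E (q t)" by blast
    then have "q 0 \<in> L" "y = E (q 0)" by (auto simp: path_image_def)
    then show "\<beta> y \<noteq> 0" using \<beta>E Bnz by (simp add: \<beta>'_def)
  next
    fix p :: "real \<Rightarrow> complex \<times> complex" assume p: "path p" "path_image p \<subseteq> A r"
    obtain q where q: "path q" "path_image q \<subseteq> L" "\<And>t. t \<in> {0..1} \<Longrightarrow> p t = E (q t)"
       "winding_number (snd \<circ> p) 0 = of_real (snd (q 1) - snd (q 0))"
      using lift[OF p] by blast
    have ends: "q 0 \<in> L" "q 1 \<in> L" using q(2) by (auto simp: path_image_def)
    have \<beta>q: "\<beta> (pathstart p) = \<beta>' (q 0)" "\<beta> (pathfinish p) = \<beta>' (q 1)"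
      using q(3) \<beta>E ends by (auto simp: pathstart_def pathfinish_def)
    have "exp (l * of_real (snd (q 1) - snd (q 0))) * (\<beta>' (q 1) / \<beta>' (q 0)) = B (q 1) / B (q 0)"
      by (simp add: \<beta>'_def right_diff_distrib exp_diff exp_minus field_simps)
    also have "\<dots> = \<omega> p" using \<omega>B[OF p q(1-3)] Bnz[OF ends(1)] by simp
    finally show "\<omega> p = exp (l * winding_number (snd \<circ> p) 0) * (\<beta> (pathfinish p) / \<beta> (pathstart p))"
      using \<beta>q q(4) by simp
  qed
qed

text \<open>The formula for \<open>\<omega>\<close> on the annular part makes sense on the whole torus, as the
  circle coordinate is defined there and \<open>\<beta>\<close> may be continued by any nonzero values.\<close>

lemma torus_character_extends:
  fixes h :: "complex \<times> complex \<Rightarrow> 'a::topological_space"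
  assumes hom: "homeomorphism (ball 0 1 \<times> sphere 0 1) V h g"
    and r: "0 \<le> r" and s: "r < s" "s < 1"
    and \<omega>: "path_character (h ` ({z. r < norm z \<and> norm z < 1} \<times> sphere 0 1)) \<omega>"
    and mer: "\<omega> (\<lambda>t. h (of_real s * exp (2 * of_real pi * \<i> * of_real t), 1)) = 1"
  obtains \<omega>' where "path_character V \<omega>'"
    "\<And>p. path p \<Longrightarrow> path_image p \<subseteq> h ` ({z. r < norm z \<and> norm z < 1} \<times> sphere 0 1) \<Longrightarrow> \<omega> p = \<omega>' p"
proof -
  let ?D = "ball 0 1 \<times> sphere 0 1 :: (complex \<times> complex) set"
  let ?A = "{z. r < norm z \<and> norm z < 1} \<times> sphere 0 1 :: (complex \<times> complex) set"
  have sub: "?A \<subseteq> ?D" by auto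
  have h: "continuous_on ?D h" "h ` ?D = V" "continuous_on V g" "g ` V = ?D" "\<And>x. x \<in> ?D \<Longrightarrow> g (h x) = x" "\<And>y. y \<in> V \<Longrightarrow> h (g y) = y"
    using hom by (auto simp: homeomorphism_def)
  have ch: "path_character ?A (\<lambda>p. \<omega> (h \<circ> p))"
    using continuous_on_subset[OF h(1) sub] by (intro path_character_pullback[OF \<omega>]) auto
  have mer': "\<omega> (h \<circ> (\<lambda>t. (of_real s * exp (2 * of_real pi * \<i> * of_real t), 1))) = 1"
    using mer by (simp add: o_def)
  obtain l \<beta> where \<beta>: "\<And>y. y \<in> ?A \<Longrightarrow> \<beta> y \<noteq> 0"
    "\<And>p. path p \<Longrightarrow> path_image p \<subseteq> ?A \<Longrightarrow>
       \<omega> (h \<circ> p) = exp (l * winding_number (snd \<circ> p) 0) * (\<beta> (pathfinish p) / \<beta> (pathstart p))"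
    by (rule annulus_circle_character[OF r s ch mer']) blast
  define \<beta>' where "\<beta>' y = (if y \<in> ?A then \<beta> y else 1)" for y
  define \<eta> where "\<eta> = (\<lambda>p. exp (l * winding_number (snd \<circ> p) 0) * (\<beta>' (pathfinish p) / \<beta>' (pathstart p)))"
  have "path_character ?D \<eta>"
    unfolding \<eta>_def
  proof (rule path_character_mult)
    show "path_character ?D (\<lambda>p. exp (l * winding_number (snd \<circ> p) 0))"
      by (rule path_character_winding) (auto intro!: continuous_intros)
    show "path_character ?D (\<lambda>p. \<beta>' (pathfinish p) / \<beta>' (pathstart p))"
      by (rule path_character_coboundary) (use \<beta>(1) in \<open>auto simp: \<beta>'_def\<close>)
  qed
  then have "path_character V (\<lambda>p. \<eta> (g \<circ> p))"
    using h by (intro path_character_pullback) auto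
  moreover have "\<omega> p = \<eta> (g \<circ> p)" if p: "path p" "path_image p \<subseteq> h ` ?A" for p
  proof -
    have hA: "h ` ?A \<subseteq> V" using h(2) sub by blast
    have "\<omega> p = \<omega> (h \<circ> (g \<circ> p))"
    proof (rule path_character_cong[OF \<omega> p])
      fix t :: real assume "t \<in> {0..1}"
      then have "p t \<in> path_image p" by (simp add: path_image_def)
      then have "p t \<in> V" using p(2) hA by blast
      then show "p t = (h \<circ> (g \<circ> p)) t" using h(6) by simp
    qed
    moreover have "path (g \<circ> p)"
      using path_continuous_image[OF p(1) continuous_on_subset[OF h(3) subset_trans[OF p(2) hA]]] .
    moreover have gp: "path_image (g \<circ> p) \<subseteq> ?A"
    proof -
      have "g ` h ` ?A \<subseteq> ?A" using h(5) sub by auto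
      then show ?thesis unfolding path_image_compose using image_mono[OF p(2), of g] by blast
    qed
    ultimately have "\<omega> p = exp (l * winding_number (snd \<circ> (g \<circ> p)) 0) * (\<beta> (pathfinish (g \<circ> p)) / \<beta> (pathstart (g \<circ> p)))"
      using \<beta>(2)[of "g \<circ> p"] by simp
    moreover have "pathstart (g \<circ> p) \<in> ?A" "pathfinish (g \<circ> p) \<in> ?A" using gp pathstart_in_path_image pathfinish_in_path_image by blast+
    ultimately show ?thesis unfolding \<eta>_def \<beta>'_def by simp
  qed
  ultimately show ?thesis by (rule that)
qed

section \<open>Line bundles on the 3-sphere\<close>

text \<open>The transition function \<open>f\<close> between \<open>U\<close> and \<open>V\<close> defines a complex line bundle; \<open>u\<close> and \<open>v\<close> trivialise it over \<open>C\<close>.\<close>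

definition trivial_cocycle_on ::
    "'a::topological_space set \<Rightarrow> 'a set \<Rightarrow> ('a \<Rightarrow> complex) \<Rightarrow> 'a set \<Rightarrow> bool" where
  "trivial_cocycle_on U V f C \<longleftrightarrow>
     (\<exists>u v. continuous_on (C \<inter> U) u \<and> continuous_on (C \<inter> V) v \<and> (\<forall>y\<in>C \<inter> U. u y \<noteq> 0) \<and> (\<forall>y\<in>C \<inter> V. v y \<noteq> 0) \<and>
            (\<forall>y\<in>C \<inter> U \<inter> V. u y = f y * v y))"

lemma trivial_cocycle_on_small:
  assumes f: "continuous_on (U \<inter> V) f" "\<And>y. y \<in> U \<inter> V \<Longrightarrow> f y \<noteq> 0" and C: "C \<subseteq> U \<or> C \<subseteq> V"
  shows "trivial_cocycle_on U V f C"
  using C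
proof
  assume "C \<subseteq> U"
  then have sub: "C \<inter> V \<subseteq> U \<inter> V" by blast
  show ?thesis unfolding trivial_cocycle_on_def
    by (rule exI[of _ "\<lambda>_. 1"], rule exI[of _ "\<lambda>y. 1 / f y"])
      (use sub f(2) in \<open>auto intro!: continuous_intros continuous_on_subset[OF f(1) sub]\<close>)
next
  assume "C \<subseteq> V"
  then have sub: "C \<inter> U \<subseteq> U \<inter> V" by blast
  show ?thesis unfolding trivial_cocycle_on_def
    by (rule exI[of _ f], rule exI[of _ "\<lambda>_. 1"])
      (use sub f(2) in \<open>auto intro!: continuous_intros continuous_on_subset[OF f(1) sub]\<close>)
qed

lemma continuous_on_closed_glue:
  fixes u1 u2 :: "'a::topological_space \<Rightarrow> 'b::topological_space"
  assumes "closed C1" "closed C2" "continuous_on (C1 \<inter> U) u1" "continuous_on (C2 \<inter> U) u2"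
    and "\<And>y. y \<in> C1 \<inter> C2 \<inter> U \<Longrightarrow> u1 y = u2 y"
  shows "continuous_on ((C1 \<union> C2) \<inter> U) (\<lambda>y. if y \<in> C1 then u1 y else u2 y)"
proof -
  have eq: "(C1 \<union> C2) \<inter> U = (C1 \<inter> U) \<union> (C2 \<inter> U)" by blast
  have "closedin (top_of_set (C1 \<inter> U \<union> C2 \<inter> U)) (C1 \<inter> U)" "closedin (top_of_set (C1 \<inter> U \<union> C2 \<inter> U)) (C2 \<inter> U)"
    using closedin_closed_Int[OF assms(1), of "C1 \<inter> U \<union> C2 \<inter> U"] closedin_closed_Int[OF assms(2), of "C1 \<inter> U \<union> C2 \<inter> U"]
    by (simp_all add: closedin_closed) (metis Int_Un_distrib2 Int_assoc assms(1,2) inf_commute inf_sup_absorb sup_commute)+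
  then show ?thesis unfolding eq
    using assms(3-5) by (intro continuous_on_cases_local) auto
qed

text \<open>The two trivialisations differ on \<open>C1 \<inter> C2\<close> by a nonvanishing function \<open>g\<close>, which is well defined because the factors
  \<open>f\<close> cancel. It has a logarithm on the intersection, and Tietze's theorem extends the logarithm to a correction of the
  trivialisation over \<open>C2\<close>.\<close>

lemma trivial_cocycle_on_glue:
  fixes f :: "'a::euclidean_space \<Rightarrow> complex"
  assumes cl: "closed C1" "closed C2" and bor: "Borsukian (C1 \<inter> C2)"
    and U: "openin (top_of_set X) U" "openin (top_of_set X) V" "U \<union> V = X" and C: "C1 \<subseteq> X" "C2 \<subseteq> X"
    and f: "\<And>y. y \<in> U \<inter> V \<Longrightarrow> f y \<noteq> 0"
    and 1: "trivial_cocycle_on U V f C1" and 2: "trivial_cocycle_on U V f C2"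
  shows "trivial_cocycle_on U V f (C1 \<union> C2)"
proof -
  obtain u1 v1 where 1: "continuous_on (C1 \<inter> U) u1" "continuous_on (C1 \<inter> V) v1"
     "\<And>y. y \<in> C1 \<inter> U \<Longrightarrow> u1 y \<noteq> 0" "\<And>y. y \<in> C1 \<inter> V \<Longrightarrow> v1 y \<noteq> 0" "\<And>y. y \<in> C1 \<inter> U \<inter> V \<Longrightarrow> u1 y = f y * v1 y"
    using 1 unfolding trivial_cocycle_on_def by blast
  obtain u2 v2 where 2: "continuous_on (C2 \<inter> U) u2" "continuous_on (C2 \<inter> V) v2"
     "\<And>y. y \<in> C2 \<inter> U \<Longrightarrow> u2 y \<noteq> 0" "\<And>y. y \<in> C2 \<inter> V \<Longrightarrow> v2 y \<noteq> 0" "\<And>y. y \<in> C2 \<inter> U \<inter> V \<Longrightarrow> u2 y = f y * v2 y"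
    using 2 unfolding trivial_cocycle_on_def by blast
  let ?I = "C1 \<inter> C2"
  define g where "g y = (if y \<in> U then u1 y / u2 y else v1 y / v2 y)" for y
  have gV: "g y = v1 y / v2 y" if "y \<in> ?I \<inter> V" for y
    using that f 1(5) 2(5) by (auto simp: g_def)
  have I: "?I = ?I \<inter> U \<union> ?I \<inter> V" using U(3) C by blast
  have "continuous_on (?I \<inter> U \<union> ?I \<inter> V) g"
    unfolding g_def
  proof (rule continuous_on_cases_local_open)
    have op: "openin (top_of_set ?I) (?I \<inter> W)" if W: "openin (top_of_set X) W" for W
    proof -
      obtain G where "open G" "W = X \<inter> G" using W unfolding openin_open by blast
      then have "?I \<inter> W = ?I \<inter> G" using C by blast
      then show ?thesis using \<open>open G\<close> by (auto simp: openin_open)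
    qed
    then show "openin (top_of_set (?I \<inter> U \<union> ?I \<inter> V)) (?I \<inter> U)" "openin (top_of_set (?I \<inter> U \<union> ?I \<inter> V)) (?I \<inter> V)"
      using U I by metis+
    show "continuous_on (?I \<inter> U) (\<lambda>y. u1 y / u2 y)"
      by (intro continuous_on_divide continuous_on_subset[OF 1(1)] continuous_on_subset[OF 2(1)]) (use 2 in auto)
    show "continuous_on (?I \<inter> V) (\<lambda>y. v1 y / v2 y)"
      by (intro continuous_on_divide continuous_on_subset[OF 1(2)] continuous_on_subset[OF 2(2)]) (use 2 in auto)
    show "u1 x / u2 x = v1 x / v2 x" if "x \<in> ?I \<inter> U \<and> x \<notin> U \<or> x \<in> ?I \<inter> V \<and> x \<in> U" for x
      using that gV[of x] by (auto simp: g_def)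
  qed
  then have "continuous_on ?I g" using I by metis
  moreover have gnz: "g \<in> ?I \<rightarrow> - {0}"
    using 1(3,4) 2(3,4) U(3) C unfolding g_def by (auto split: if_splits)
  ultimately obtain \<theta> where \<theta>: "continuous_on ?I \<theta>" "\<And>y. y \<in> ?I \<Longrightarrow> g y = exp (\<theta> y)"
    using bor unfolding Borsukian_continuous_logarithm by metis
  obtain \<Theta> where \<Theta>: "continuous_on UNIV \<Theta>" "\<And>y. y \<in> ?I \<Longrightarrow> \<Theta> y = \<theta> y"
    using Tietze_unbounded[OF \<theta>(1), of UNIV] cl by (metis closed_Int closed_closedin subtopology_UNIV)
  have cont\<Theta>: "continuous_on A (\<lambda>y. exp (\<Theta> y))" for A
    using continuous_on_subset[OF \<Theta>(1), of A] by (auto intro: continuous_intros)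
  have eq: "g y = exp (\<Theta> y)" if "y \<in> ?I" for y using \<theta>(2) \<Theta>(2) that by simp
  let ?u = "\<lambda>y. if y \<in> C1 then u1 y else u2 y * exp (\<Theta> y)"
  let ?v = "\<lambda>y. if y \<in> C1 then v1 y else v2 y * exp (\<Theta> y)"
  have "continuous_on ((C1 \<union> C2) \<inter> U) ?u"
  proof (rule continuous_on_closed_glue[OF cl 1(1)])
    show "continuous_on (C2 \<inter> U) (\<lambda>y. u2 y * exp (\<Theta> y))" by (intro continuous_on_mult 2 cont\<Theta>)
    fix y assume y: "y \<in> C1 \<inter> C2 \<inter> U"
    then show "u1 y = u2 y * exp (\<Theta> y)" using eq[of y] 2(3)[of y] by (simp add: g_def field_simps)
  qed
  moreover have "continuous_on ((C1 \<union> C2) \<inter> V) ?v"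
  proof (rule continuous_on_closed_glue[OF cl 1(2)])
    show "continuous_on (C2 \<inter> V) (\<lambda>y. v2 y * exp (\<Theta> y))" by (intro continuous_on_mult 2 cont\<Theta>)
    fix y assume y: "y \<in> C1 \<inter> C2 \<inter> V"
    then show "v1 y = v2 y * exp (\<Theta> y)" using eq[of y] gV[of y] 2(4)[of y] by (simp add: field_simps)
  qed
  moreover have "\<forall>y\<in>(C1 \<union> C2) \<inter> U. ?u y \<noteq> 0" "\<forall>y\<in>(C1 \<union> C2) \<inter> V. ?v y \<noteq> 0" 
    "\<forall>y\<in>(C1 \<union> C2) \<inter> U \<inter> V. ?u y = f y * ?v y"
    using 1 2 by auto
  ultimately show ?thesis unfolding trivial_cocycle_on_def by blast
qed

text \<open>Convex sets are cut along hyperplanes, and the slices are convex, hence Borsukian.\<close>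

lemma trivial_cocycle_on_convex_image:
  fixes q :: "'a::euclidean_space \<Rightarrow> 'a" and f :: "'a \<Rightarrow> complex"
  assumes D: "compact D" "convex D" and q: "continuous_on D q" "inj_on q D" "q ` D \<subseteq> X"
    and U: "openin (top_of_set X) U" "openin (top_of_set X) V" "U \<union> V = X"
    and f: "continuous_on (U \<inter> V) f" "\<And>y. y \<in> U \<inter> V \<Longrightarrow> f y \<noteq> 0"
  shows "trivial_cocycle_on U V f (q ` D)"
proof -
  have pre: "\<exists>G. open G \<and> D \<inter> q -` W = D \<inter> G" if "openin (top_of_set X) W" for W
    using continuous_openin_preimage[of D q X W] that q by (auto simp: openin_open)
  obtain OU OV where O: "open OU" "open OV" "D \<inter> q -` U = D \<inter> OU" "D \<inter> q -` V = D \<inter> OV"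
    using pre[OF U(1)] pre[OF U(2)] by blast
  have "D \<subseteq> \<Union> {OU, OV}"
  proof
    fix y assume y: "y \<in> D"
    then have "q y \<in> U \<or> q y \<in> V" using q(3) U(3) by blast
    then show "y \<in> \<Union> {OU, OV}" using O(3,4) y by auto
  qed
  then obtain \<delta> where \<delta>: "\<delta> > 0" "\<And>T. T \<subseteq> D \<Longrightarrow> diameter T < \<delta> \<Longrightarrow> \<exists>B\<in>{OU, OV}. T \<subseteq> B"
    using Lebesgue_number_lemma[of D "{OU, OV}"] D(1) O(1,2) by blast
  show ?thesis
  proof (rule convex_subdivision[where P = "\<lambda>C. trivial_cocycle_on U V f (q ` C)", OF D \<delta>(1)])
    fix C assume C: "C \<subseteq> D" "diameter C < \<delta>"
    have "q ` C \<subseteq> U \<or> q ` C \<subseteq> V" using \<delta>(2)[OF C] O(3,4) C(1) by blast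
    then show "trivial_cocycle_on U V f (q ` C)" using trivial_cocycle_on_small[OF f] by blast
  next
    fix C :: "'a set" and i :: 'a and c :: real
    let ?A = "C \<inter> {x. x \<bullet> i \<le> c}" and ?B = "C \<inter> {x. x \<bullet> i \<ge> c}"
    assume C: "compact C" "convex C" "C \<subseteq> D"
      and A: "trivial_cocycle_on U V f (q ` ?A)" and B: "trivial_cocycle_on U V f (q ` ?B)"
    have cmp: "compact ?A" "compact ?B"
      using C(1) by (auto intro!: compact_Int_closed closed_halfspace_component_le closed_halfspace_component_ge)
    have cl: "closed (q ` E)" if "compact E" "E \<subseteq> D" for E
      using that q(1) by (meson compact_continuous_image compact_imp_closed continuous_on_subset)
    have int: "q ` ?A \<inter> q ` ?B = q ` (?A \<inter> ?B)"
      using inj_on_image_Int[OF q(2), of ?A ?B] C(3) by blast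
    have "convex (?A \<inter> ?B)"
    proof -
      have "convex {x. x \<bullet> i \<le> c}" "convex {x. x \<bullet> i \<ge> c}"
        using convex_halfspace_le[of i c] convex_halfspace_ge[of c i] by (auto simp: inner_commute)
      then show ?thesis using C(2) by (intro convex_Int)
    qed
    moreover have "(?A \<inter> ?B) homeomorphic q ` (?A \<inter> ?B)"
    proof -
      have "compact (?A \<inter> ?B)" using cmp by blast
      then show ?thesis
        using q C(3) by (intro homeomorphic_compact[where f = q]) (auto intro: continuous_on_subset inj_on_subset)
    qed
    ultimately have "Borsukian (q ` (?A \<inter> ?B))"
      using convex_imp_Borsukian homeomorphic_Borsukian by blast
    then have "trivial_cocycle_on U V f (q ` ?A \<union> q ` ?B)"
      using q(3) C(3) cl[OF cmp(1)] cl[OF cmp(2)] int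
      by (intro trivial_cocycle_on_glue[OF _ _ _ U _ _ f(2) A B]) auto
    moreover have "q ` ?A \<union> q ` ?B = q ` C"
    proof -
      have "?A \<union> ?B = C" by auto
      then show ?thesis by (simp only: image_Un[symmetric])
    qed
    ultimately show "trivial_cocycle_on U V f (q ` C)" by simp
  qed
qed

text \<open>The hemispheres are graphs over the unit disc \<open>D\<close> of the equatorial hyperplane \<open>H\<close>, and they meet in a 2-sphere, which is simply connected.\<close>

lemma trivial_cocycle_on_sphere:
  fixes f :: "real^4 \<Rightarrow> complex"
  assumes U: "openin (top_of_set S3) U" "openin (top_of_set S3) V" "U \<union> V = S3"
    and f: "continuous_on (U \<inter> V) f" "\<And>y. y \<in> U \<inter> V \<Longrightarrow> f y \<noteq> 0"
  shows "trivial_cocycle_on U V f S3"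
proof -
  obtain e :: "real^4" where e: "norm e = 1" "e \<noteq> 0" using vector_choose_size[of 1, where 'a = "real^4"] by (metis norm_zero zero_le_one zero_neq_one)
  have ee: "e \<bullet> e = 1" using e by (simp add: norm_eq_1)
  define H where "H = {x::real^4. e \<bullet> x = 0}"
  define D where "D = cball 0 1 \<inter> H"
  have D: "compact D" "convex D"
    unfolding D_def H_def by (auto intro!: compact_Int_closed convex_Int closed_hyperplane convex_hyperplane)
  define q where "q c y = y + (c * sqrt (1 - y \<bullet> y)) *\<^sub>R e" for c y
  have proj: "q c y - (e \<bullet> q c y) *\<^sub>R e = y" "e \<bullet> q c y = c * sqrt (1 - y \<bullet> y)" if "y \<in> D" for c y
    using that ee by (auto simp: q_def D_def H_def inner_add_right algebra_simps)
  have yy: "y \<bullet> y \<le> 1" "e \<bullet> y = 0" if "y \<in> D" for y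
    using that by (auto simp: D_def H_def power_le_one simp flip: power2_norm_eq_inner)
  have norm_q: "q c y \<bullet> q c y = 1" if "y \<in> D" "c\<^sup>2 = 1" for c y
    using yy[OF that(1)] that(2) ee
    by (simp add: q_def inner_add_left inner_add_right inner_commute power_mult_distrib flip: power2_eq_square)
  have qS: "q c ` D \<subseteq> S3" if "c\<^sup>2 = 1" for c using norm_q that by (auto simp: norm_eq_1)
  have q: "continuous_on D (q c)" "inj_on (q c) D" for c
  proof -
    show "continuous_on D (q c)" unfolding q_def by (intro continuous_intros)
    show "inj_on (q c) D" by (rule inj_on_inverseI[where g = "\<lambda>x. x - (e \<bullet> x) *\<^sub>R e"]) (rule proj)
  qed
  have decomp: "x \<in> q c ` D" if x: "x \<in> S3" "c * (e \<bullet> x) \<ge> 0" "c\<^sup>2 = 1" for x c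
  proof
    define y where "y = x - (e \<bullet> x) *\<^sub>R e"
    have xx: "x \<bullet> x = 1" using x by (simp add: norm_eq_1)
    have ey: "e \<bullet> y = 0" by (simp add: y_def inner_diff_right ee)
    have yy: "y \<bullet> y = 1 - (e \<bullet> x)\<^sup>2"
      by (simp add: y_def inner_diff_left inner_diff_right inner_commute xx ee power2_eq_square)
    then show "y \<in> D" unfolding D_def H_def using ey by (simp add: norm_eq_sqrt_inner)
    have "c * sqrt (1 - y \<bullet> y) = c * \<bar>c * (e \<bullet> x)\<bar>"
      using x(3) by (auto simp: yy power2_eq_1_iff)
    also have "\<dots> = e \<bullet> x" using x(2,3) by (simp add: power2_eq_square)
    finally show "x = q c y" by (simp add: q_def y_def)
  qed
  have un: "q 1 ` D \<union> q (- 1) ` D = S3"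
    using qS[of 1] qS[of "-1"] decomp[where c=1] decomp[where c="-1"] by (auto, meson linorder_le_cases)
  have int: "q 1 ` D \<inter> q (- 1) ` D = sphere 0 1 \<inter> H"
  proof safe
    fix y z assume yz: "y \<in> D" "z \<in> D" "q 1 y = q (- 1) z"
    have "sqrt (1 - y \<bullet> y) = - sqrt (1 - z \<bullet> z)" using proj(2)[OF yz(1), of 1] proj(2)[OF yz(2), of "-1"] yz(3) by simp
    moreover have "sqrt (1 - y \<bullet> y) \<ge> 0" "sqrt (1 - z \<bullet> z) \<ge> 0" using yy yz by auto
    ultimately have "sqrt (1 - y \<bullet> y) = 0" by linarith
    then have "q 1 y = y" "y \<bullet> y = 1" by (auto simp: q_def)
    then show "q 1 y \<in> sphere 0 1" "q 1 y \<in> H" using yz by (auto simp: D_def norm_eq_1)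
  next
    fix x assume x: "x \<in> sphere 0 1" "x \<in> H"
    then show "x \<in> q 1 ` D" "x \<in> q (-1) ` D" using decomp[of x 1] decomp[of x "-1"] by (auto simp: H_def)
  qed
  have "Borsukian (sphere 0 1 \<inter> H)"
  proof -
    have "dim H = dim (UNIV :: (real^3) set)" using dim_hyperplane[of e] e by (simp add: H_def)
    moreover have "subspace H" unfolding H_def by (rule subspace_hyperplane)
    ultimately obtain \<phi> :: "real^4 \<Rightarrow> real^3" where \<phi>: "linear \<phi>" "\<phi> ` H = UNIV" "\<And>x. x \<in> H \<Longrightarrow> norm (\<phi> x) = norm x"
      using isometry_subspaces[of H "UNIV :: (real^3) set"] by (metis subspace_UNIV)
    have "\<phi> ` (sphere 0 1 \<inter> H) = sphere 0 1"
    proof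
      show "sphere 0 1 \<subseteq> \<phi> ` (sphere 0 1 \<inter> H)"
      proof
        fix z :: "real^3" assume "z \<in> sphere 0 1"
        moreover obtain x where "x \<in> H" "z = \<phi> x" using \<phi>(2) by blast
        ultimately show "z \<in> \<phi> ` (sphere 0 1 \<inter> H)" using \<phi>(3)[of x] by auto
      qed
    qed (use \<phi>(3) in auto)
    moreover have "inj_on \<phi> H"
    proof (rule inj_onI)
      fix x y assume xy: "x \<in> H" "y \<in> H" "\<phi> x = \<phi> y"
      have "x - y \<in> H" using xy by (simp add: H_def inner_diff_right)
      then show "x = y" using \<phi>(3)[of "x - y"] xy(3) linear_diff[OF \<phi>(1), of x y] by simp
    qed
    moreover have "compact (sphere 0 1 \<inter> H)" unfolding H_def by (intro compact_Int_closed closed_hyperplane) auto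
    ultimately have "(sphere 0 1 \<inter> H) homeomorphic (sphere 0 1 :: (real^3) set)"
      using linear_continuous_on[OF linear_conv_bounded_linear[THEN iffD1, OF \<phi>(1)], of "sphere 0 1 \<inter> H"]
      by (intro homeomorphic_compact[where f = \<phi>]) (auto intro: inj_on_subset)
    moreover have "Borsukian (sphere 0 1 :: (real^3) set)" by (rule Borsukian_sphere) simp
    ultimately show ?thesis using homeomorphic_Borsukian homeomorphic_sym by blast
  qed
  moreover have "trivial_cocycle_on U V f (q c ` D)" if "c\<^sup>2 = 1" for c
    using trivial_cocycle_on_convex_image[OF D q qS[OF that] U f] .
  moreover have "closed (q c ` D)" for c
    using D(1) q by (meson compact_continuous_image compact_imp_closed)
  ultimately have "trivial_cocycle_on U V f (q 1 ` D \<union> q (- 1) ` D)"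
    using qS by (intro trivial_cocycle_on_glue[OF _ _ _ U _ _ f(2)]) (auto simp: int)
  then show ?thesis by (simp only: un)
qed

section \<open>Invariance of domain for solid tori\<close>

text \<open>The standard embedding of the solid torus, as a tube around a circle of radius 2 in \<open>\<complex> \<times> \<real>\<close>. It is injective for
  \<open>norm z < 2\<close>, thus beyond the boundary of the standard solid torus, and gives access to
  invariance of domain in dimension 3.\<close>

definition straighten_torus :: "complex \<times> complex \<Rightarrow> complex \<times> real" where
  "straighten_torus = (\<lambda>(z, w). (of_real (2 + Re z) * w, Im z))"

definition unstraighten_torus :: "complex \<times> real \<Rightarrow> complex \<times> complex" where
  "unstraighten_torus = (\<lambda>(a, b). (Complex (norm a - 2) b, a / of_real (norm a)))"

lemma unstraighten_straighten:
  assumes "norm z < 2" "norm w = 1"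
  shows "unstraighten_torus (straighten_torus (z, w)) = (z, w)"
proof -
  have "\<bar>Re z\<bar> < 2" using assms(1) abs_Re_le_cmod[of z] by linarith
  then have "norm (of_real (2 + Re z) * w) = 2 + Re z" by (simp only: norm_mult assms(2)) (simp del: of_real_add)
  moreover have "of_real (2 + Re z) * w / of_real (2 + Re z) = w"
    using \<open>\<bar>Re z\<bar> < 2\<close> by (simp del: of_real_add)
  ultimately show ?thesis by (simp add: unstraighten_torus_def straighten_torus_def)
qed

lemma straighten_unstraighten: "a \<noteq> 0 \<Longrightarrow> straighten_torus (unstraighten_torus (a, b)) = (a, b)"
  by (simp add: unstraighten_torus_def straighten_torus_def)

lemma continuous_straighten: "continuous_on S straighten_torus"
  unfolding straighten_torus_def case_prod_unfold by (intro continuous_intros)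

lemma continuous_unstraighten: "0 \<notin> fst ` S \<Longrightarrow> continuous_on S unstraighten_torus"
  unfolding unstraighten_torus_def case_prod_unfold Complex_eq by (intro continuous_intros) auto

lemma open_straightened_torus: "open (straighten_torus ` (ball 0 1 \<times> sphere 0 1))"
proof -
  let ?S = "{x :: complex \<times> real. fst x \<noteq> 0}"
  have S: "open ?S" by (intro open_Collect_neq continuous_intros)
  have "straighten_torus ` (ball 0 1 \<times> sphere 0 1) = ?S \<inter> unstraighten_torus -` (ball 0 1 \<times> UNIV)"
  proof (intro equalityI subsetI)
    fix x assume "x \<in> straighten_torus ` (ball 0 1 \<times> sphere 0 1)"
    then obtain z w :: complex where z: "norm z < 1" and w: "norm w = 1" and x: "x = straighten_torus (z, w)" by auto
    have "unstraighten_torus x = (z, w)"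
      unfolding x using z w by (intro unstraighten_straighten) auto
    moreover have "fst x \<noteq> 0"
    proof -
      have "\<bar>Re z\<bar> < 1" using z abs_Re_le_cmod[of z] by simp
      then have "complex_of_real (2 + Re z) \<noteq> 0" by (simp only: of_real_eq_0_iff)
      then show ?thesis using w by (auto simp: x straighten_torus_def simp del: of_real_add)
    qed
    ultimately show "x \<in> ?S \<inter> unstraighten_torus -` (ball 0 1 \<times> UNIV)" using z by simp
  next
    fix x assume "x \<in> ?S \<inter> unstraighten_torus -` (ball 0 1 \<times> UNIV)"
    then obtain a b where ab: "fst (a, b) \<noteq> 0" and un: "unstraighten_torus (a, b) \<in> ball 0 1 \<times> UNIV" and x: "x = (a, b)"
      by (cases x) auto
    have "unstraighten_torus (a, b) \<in> ball 0 1 \<times> sphere 0 1"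
      using un ab by (auto simp: unstraighten_torus_def norm_divide)
    then show "x \<in> straighten_torus ` (ball 0 1 \<times> sphere 0 1)"
      unfolding x using straighten_unstraighten[of a b] ab by (metis fst_conv image_eqI)
  qed
  moreover have "open (?S \<inter> unstraighten_torus -` (ball 0 1 \<times> UNIV))"
    using S by (intro continuous_open_preimage continuous_unstraighten) (auto intro: open_Times)
  ultimately show ?thesis by simp
qed

text \<open>Both claims are invariance of domain, once for \<open>h\<close> and once for its inverse. Tameness enters in that \<open>T\<close> misses a point \<open>p\<close>, so that
  everything takes place in \<open>S3 - {p}\<close>, a copy of \<open>\<real>\<^sup>3\<close>. For the second claim, an
  interior point of \<open>T\<close> with \<open>norm z = 1\<close> would have points with \<open>norm z > 1\<close> in its image under \<open>straighten_torus\<close>.\<close>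

lemma open_torus_openin_sphere:
  fixes h :: "complex \<times> complex \<Rightarrow> real^4"
  assumes hom: "homeomorphism std_solid_torus T h g" and T: "T \<subseteq> S3" "tame T"
  shows "openin (top_of_set S3) (h ` (ball 0 1 \<times> sphere 0 1))"
    and "top_of_set S3 interior_of T \<subseteq> h ` (ball 0 1 \<times> sphere 0 1)"
proof -
  let ?B = "ball 0 1 \<times> sphere 0 1 :: (complex \<times> complex) set"
  obtain p f f' where p: "p \<in> S3" "p \<notin> T" and f: "homeomorphism (S3 - {p}) (UNIV :: (real^3) set) f f'"
    using T(2) unfolding tame_def by blast
  have T': "T \<subseteq> S3 - {p}" using T(1) p(2) by blast
  have opp: "openin (top_of_set S3) (S3 - {p})" by (simp add: openin_delete)
  note f = f[unfolded homeomorphism_def]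
  have f_inj: "f' (f y) = y" if "y \<in> S3 - {p}" for y using f that by blast
  have h: "continuous_on std_solid_torus h" "h ` std_solid_torus = T" "\<And>x. x \<in> std_solid_torus \<Longrightarrow> g (h x) = x"
    "continuous_on T g" "g ` T = std_solid_torus" "\<And>y. y \<in> T \<Longrightarrow> h (g y) = y"
    using hom unfolding homeomorphism_def by blast+
  have BT: "?B \<subseteq> std_solid_torus" by auto
  have hB: "h ` ?B \<subseteq> T" using h(2) BT by blast
  show "openin (top_of_set S3) (h ` ?B)"
  proof -
    have un: "unstraighten_torus (straighten_torus x) = x" if "x \<in> ?B" for x
      using that unstraighten_straighten by force
    let ?k = "\<lambda>x. f (h (unstraighten_torus x))"
    have "open (?k ` straighten_torus ` ?B)"
    proof (rule invariance_of_domain_gen[OF open_straightened_torus])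
      have "0 \<notin> fst ` (straighten_torus ` ?B)"
      proof
        assume "0 \<in> fst ` (straighten_torus ` ?B)"
        then obtain z w :: complex where zw: "norm z < 1" "norm w = 1" "of_real (2 + Re z) * w = 0"
          by (auto simp: straighten_torus_def simp del: of_real_add)
        have "\<bar>Re z\<bar> < 1" using zw(1) abs_Re_le_cmod[of z] by linarith
        then show False using zw(2,3) by (auto simp del: of_real_add)
      qed
      then have cu: "continuous_on (straighten_torus ` ?B) unstraighten_torus" by (rule continuous_unstraighten)
      have imB: "unstraighten_torus ` straighten_torus ` ?B = ?B"
        unfolding image_image using un by (simp cong: image_cong)
      have ch: "continuous_on (straighten_torus ` ?B) (\<lambda>x. h (unstraighten_torus x))"
        by (rule continuous_on_compose2[OF continuous_on_subset[OF h(1) BT] cu]) (use imB in blast)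
      have "continuous_on (S3 - {p}) f" using f by blast
      moreover have "(\<lambda>x. h (unstraighten_torus x)) ` straighten_torus ` ?B \<subseteq> S3 - {p}"
      proof -
        have "(\<lambda>x. h (unstraighten_torus x)) ` straighten_torus ` ?B = h ` ?B"
          by (subst (2) imB[symmetric]) (simp only: image_image)
        then show ?thesis using hB T' by blast
      qed
      ultimately show "continuous_on (straighten_torus ` ?B) ?k"
        using continuous_on_compose2[OF _ ch] by blast
      show "inj_on ?k (straighten_torus ` ?B)"
      proof (rule inj_on_inverseI[where g = "\<lambda>y. straighten_torus (g (f' y))"])
        fix x assume "x \<in> straighten_torus ` ?B"
        then obtain b where b: "b \<in> ?B" "x = straighten_torus b" by blast
        then have "h b \<in> S3 - {p}" "b \<in> std_solid_torus" using hB T' BT by blast+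
        then show "straighten_torus (g (f' (?k x))) = x" using b f_inj un h(3) by simp
      qed
    qed simp
    also have "?k ` straighten_torus ` ?B = f ` h ` ?B"
      unfolding image_image using un by (simp cong: image_cong)
    finally have o: "open (f ` h ` ?B)" .
    have "h ` ?B = (S3 - {p}) \<inter> f -` (f ` h ` ?B)"
    proof (intro equalityI subsetI)
      fix y assume "y \<in> (S3 - {p}) \<inter> f -` (f ` h ` ?B)"
      then obtain b where "y \<in> S3 - {p}" "b \<in> h ` ?B" "f y = f b" by blast
      moreover have "b \<in> S3 - {p}" using \<open>b \<in> h ` ?B\<close> hB T' by blast
      ultimately show "y \<in> h ` ?B" using f_inj[of y] f_inj[of b] by metis
    qed (use hB T' in blast)
    moreover have "openin (top_of_set (S3 - {p})) ((S3 - {p}) \<inter> f -` (f ` h ` ?B))"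
      using continuous_openin_preimage_gen[of "S3 - {p}" f "f ` h ` ?B"] f o by blast
    ultimately show ?thesis using opp by (metis openin_trans)
  qed
  show "top_of_set S3 interior_of T \<subseteq> h ` ?B"
  proof
    let ?O = "top_of_set S3 interior_of T"
    fix y assume y: "y \<in> ?O"
    have OT: "?O \<subseteq> T" by (rule interior_of_subset)
    have "openin (top_of_set (S3 - {p})) ?O"
      using OT T' by (intro openin_subset_trans[OF openin_interior_of]) auto
    then have o: "open (f ` ?O)"
      using homeomorphism_imp_open_map[of "S3 - {p}" UNIV f f'] f by (auto simp: homeomorphism_def)
    have f'f: "f' (f x) = x" if "x \<in> ?O" for x using f_inj OT T' that by blast
    let ?k = "\<lambda>x. straighten_torus (g (f' x))"
    have un: "unstraighten_torus (straighten_torus (g x)) = g x" if "x \<in> T" for x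
    proof -
      have "g x \<in> std_solid_torus" using h(5) that by blast
      then obtain z w where "g x = (z, w)" "norm z \<le> 1" "norm w = 1" by (cases "g x") auto
      then show ?thesis using unstraighten_straighten[of z w] by simp
    qed
    have "open (?k ` f ` ?O)"
    proof (rule invariance_of_domain_gen[OF o])
      have f'O: "f' ` f ` ?O = ?O" unfolding image_image using f'f by simp
      have "continuous_on UNIV f'" using f by blast
      then have "continuous_on (f ` ?O) f'" by (rule continuous_on_subset) simp
      moreover have "continuous_on ?O g" using h(4) OT continuous_on_subset by blast
      ultimately have "continuous_on (f ` ?O) (\<lambda>x. g (f' x))"
        using continuous_on_compose2[of ?O g "f ` ?O" f'] f'O by blast
      then show "continuous_on (f ` ?O) ?k"
        by (rule continuous_on_compose2[OF continuous_straighten[of UNIV]]) simp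
      show "inj_on ?k (f ` ?O)"
      proof (rule inj_on_inverseI[where g = "\<lambda>x. f (h (unstraighten_torus x))"])
        fix x assume "x \<in> f ` ?O"
        then obtain y where "y \<in> ?O" "x = f y" by blast
        then show "f (h (unstraighten_torus (?k x))) = x" using f'f un h(6) OT by auto
      qed
    qed simp
    moreover have "?k ` f ` ?O = (\<lambda>x. straighten_torus (g x)) ` ?O"
      unfolding image_image using f'f by (simp cong: image_cong)
    ultimately have o: "open ((\<lambda>x. straighten_torus (g x)) ` ?O)" by simp
    have yT: "y \<in> T" using y OT by blast
    then have "g y \<in> std_solid_torus" using h(5) by blast
    then obtain z w where zw: "g y = (z, w)" "norm z \<le> 1" "norm w = 1" by (cases "g y") auto
    have "norm z \<noteq> 1"
    proof
      assume z1: "norm z = 1"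
      let ?c = "\<lambda>s::real. straighten_torus (of_real s * z, w)"
      have "isCont ?c 1"
        unfolding straighten_torus_def prod.case by (intro continuous_intros isCont_Re isCont_Im)
      moreover have "?c 1 \<in> (\<lambda>x. straighten_torus (g x)) ` ?O" using y zw(1) by force
      ultimately have "\<forall>\<^sub>F s in at 1. ?c s \<in> (\<lambda>x. straighten_torus (g x)) ` ?O"
        using o by (simp add: isCont_def topological_tendstoD)
      then obtain d where d: "d > 0" "\<And>s. s \<noteq> 1 \<Longrightarrow> dist s 1 < d \<Longrightarrow> ?c s \<in> (\<lambda>x. straighten_torus (g x)) ` ?O"
        unfolding eventually_at by blast
      \<comment> \<open>Small enough to stay in the open image, and below 2 for injectivity.\<close>
      define s where "s = 1 + min (d / 2) (1 / 2)"
      have s: "1 < s" "s < 2" "dist s 1 < d" using d(1) by (auto simp: s_def dist_real_def min_def)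
      then obtain x where x: "x \<in> ?O" "?c s = straighten_torus (g x)" using d(2)[of s] by auto
      have "norm (of_real s * z) = s" using s(1) z1 by (simp add: norm_mult)
      then have "(of_real s * z, w) = g x"
        using unstraighten_straighten[of "of_real s * z" w] un[of x] x OT s(2) zw(3) by auto
      moreover have "g x \<in> std_solid_torus" using h(5) x(1) OT by blast
      ultimately have "norm (of_real s * z) \<le> 1" by (metis mem_Sigma_iff mem_cball_0)
      then show False using \<open>norm (of_real s * z) = s\<close> s(1) by simp
    qed
    then have "g y \<in> ?B" using zw by simp
    then show "y \<in> h ` ?B" using h(6)[OF yT] by (metis image_eqI)
  qed
qed

section \<open>The complement of a solid torus\<close>

definition meridian :: "(complex \<times> complex \<Rightarrow> 'a) \<Rightarrow> real \<Rightarrow> real \<Rightarrow> 'a" where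
  "meridian h s = (\<lambda>t. h (of_real s * exp (2 * of_real pi * \<i> * of_real t), 1))"

lemma meridian_in:
  assumes "0 < s"
  shows "meridian h s t \<in> h ` (sphere 0 s \<times> sphere 0 1)"
  using assms by (auto simp: meridian_def norm_mult)

lemma path_meridian:
  assumes "continuous_on (ball 0 1 \<times> sphere 0 1) h" "0 < s" "s < 1"
  shows "path (meridian h s)" "path_image (meridian h s) \<subseteq> h ` (sphere 0 s \<times> sphere 0 1)"
    "pathfinish (meridian h s) = pathstart (meridian h s)"
proof -
  show "path (meridian h s)"
    unfolding path_def meridian_def
    by (rule continuous_on_compose2[OF assms(1)]) (use assms in \<open>auto intro!: continuous_intros simp: norm_mult\<close>)
  show "path_image (meridian h s) \<subseteq> h ` (sphere 0 s \<times> sphere 0 1)"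
    using meridian_in[OF assms(2)] by (auto simp: path_image_def)
  show "pathfinish (meridian h s) = pathstart (meridian h s)"
    by (simp add: pathfinish_def pathstart_def meridian_def)
qed

lemma convex_image_loop_null:
  fixes F :: "'b::real_normed_vector \<Rightarrow> 'a::topological_space"
  assumes C: "convex C" and F: "continuous_on C F" "F ` C \<subseteq> X"
    and p: "path p" "path_image p \<subseteq> C" "pathfinish p = pathstart p"
  shows "homotopic_paths X (F \<circ> p) (\<lambda>_. F (pathstart p))"
proof -
  have "homotopic_paths C p (linepath (pathstart p) (pathstart p))"
    using p pathstart_in_path_image[of p] by (intro convex_homotopic_paths[OF C]) auto
  from homotopic_paths_continuous_image[OF this F(1), of X] F(2)
  show ?thesis by (simp add: o_def linepath_refl image_subset_iff_funcset)
qed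

lemma meridian_null:
  fixes h :: "complex \<times> complex \<Rightarrow> 'a::topological_space"
  assumes h: "continuous_on (ball 0 1 \<times> sphere 0 1) h" and s: "0 < s" "s < 1"
    and X: "h ` (ball 0 1 \<times> sphere 0 1) \<subseteq> X"
  obtains x where "homotopic_paths X (meridian h s) (\<lambda>_. x)"
proof -
  let ?p = "\<lambda>t::real. (of_real s * exp (2 * of_real pi * \<i> * of_real t), 1::complex)"
  have "homotopic_paths X (h \<circ> ?p) (\<lambda>_. h (pathstart ?p))"
  proof (rule convex_image_loop_null[where C = "ball 0 1 \<times> {1}"])
    show "continuous_on (ball 0 1 \<times> {1}) h" by (rule continuous_on_subset[OF h]) auto
    show "h ` (ball 0 1 \<times> {1}) \<subseteq> X" using X by auto
    show "path ?p" unfolding path_def by (intro continuous_intros)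
    show "path_image ?p \<subseteq> ball 0 1 \<times> {1}" using s by (auto simp: path_image_def norm_mult)
  qed (auto simp: pathfinish_def pathstart_def intro: convex_Times)
  then show ?thesis using that by (simp add: meridian_def o_def)
qed

lemma winding_number_mult:
  assumes "path p" "0 \<notin> path_image p" "path q" "0 \<notin> path_image q"
  shows "winding_number (\<lambda>t. p t * q t) 0 = winding_number p 0 + winding_number q 0"
proof -
  obtain a where a: "path a" "\<And>t. t \<in> {0..1} \<Longrightarrow> p t = exp (a t)" using path_logarithm assms by blast
  obtain b where b: "path b" "\<And>t. t \<in> {0..1} \<Longrightarrow> q t = exp (b t)" using path_logarithm assms by blast
  have "path (\<lambda>t. a t + b t)" using a b by (auto simp: path_def intro: continuous_intros)
  then have "winding_number (\<lambda>t. p t * q t) 0 = ((a 1 + b 1) - (a 0 + b 0)) / (2 * of_real pi * \<i>)"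
    using a b by (intro winding_number_exp_lift) (auto simp: exp_add)
  then show ?thesis using winding_number_exp_lift[OF a] winding_number_exp_lift[OF b]
    by (simp add: diff_divide_distrib add_divide_distrib)
qed

lemma exp_int_eq_1_iff: "exp (of_int k :: complex) = 1 \<longleftrightarrow> k = 0"
proof
  assume "exp (of_int k :: complex) = 1"
  then have "norm (exp (of_int k :: complex)) = 1" by simp
  then show "k = 0" by simp
qed simp

lemma homeomorphism_torus_diff:
  fixes h :: "complex \<times> complex \<Rightarrow> 'a::topological_space"
  assumes hom: "homeomorphism (ball 0 1 \<times> sphere 0 1) V h g" and r: "r < 1"
  shows "V - h ` (cball 0 r \<times> sphere 0 1) = h ` ({z. r < norm z \<and> norm z < 1} \<times> sphere 0 1)"
    and "h ` (cball 0 r \<times> sphere 0 1) \<subseteq> V" and "compact (h ` (cball 0 r \<times> sphere 0 1))"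
proof -
  let ?D = "ball 0 1 \<times> sphere 0 1 :: (complex \<times> complex) set"
  let ?K = "cball 0 r \<times> sphere 0 1 :: (complex \<times> complex) set"
  have KD: "?K \<subseteq> ?D" using r by auto
  have h: "h ` ?D = V" "inj_on h ?D" "continuous_on ?D h"
    using hom by (auto simp: homeomorphism_def intro: inj_on_inverseI)
  have "?D - ?K = {z. r < norm z \<and> norm z < 1} \<times> sphere 0 1" by auto
  then show "V - h ` ?K = h ` ({z. r < norm z \<and> norm z < 1} \<times> sphere 0 1)"
    using inj_on_image_set_diff[OF h(2) Diff_subset KD] h(1) by simp
  show "h ` ?K \<subseteq> V" using KD h(1) by blast
  show "compact (h ` ?K)"
    using continuous_on_subset[OF h(3) KD] by (intro compact_continuous_image compact_Times) auto
qed

text \<open>Killing the meridian is the same as filling in the torus, and in \<open>X\<close> the loop \<open>\<gamma>\<close> is null-homotopic. The case where \<open>X\<close> is not the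
  sphere is needed to compare functions near a closed braid.\<close>

theorem character_trivial_if_meridian_trivial:
  fixes h :: "complex \<times> complex \<Rightarrow> 'a::t2_space"
  assumes hom: "homeomorphism (ball 0 1 \<times> sphere 0 1) V h g" and V: "openin (top_of_set X) V"
    and r: "0 \<le> r" and s: "r < s" "s < 1"
    and \<omega>: "path_character (X - h ` (cball 0 r \<times> sphere 0 1)) \<omega>" and mer: "\<omega> (meridian h s) = 1"
    and \<gamma>: "path \<gamma>" "path_image \<gamma> \<subseteq> X - h ` (cball 0 r \<times> sphere 0 1)" and null: "homotopic_paths X \<gamma> (\<lambda>_. x)"
  shows "\<omega> \<gamma> = 1"
proof -
  let ?K = "h ` (cball 0 r \<times> sphere 0 1)"
  have r1: "r < 1" using s by simp
  note d = homeomorphism_torus_diff[OF hom r1]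
  have VX: "V \<subseteq> X" using V openin_imp_subset by blast
  have int: "(X - ?K) \<inter> V = h ` ({z. r < norm z \<and> norm z < 1} \<times> sphere 0 1)" using VX d(1) by blast
  then have "h ` ({z. r < norm z \<and> norm z < 1} \<times> sphere 0 1) \<subseteq> X - ?K" by blast
  then have ch: "path_character (h ` ({z. r < norm z \<and> norm z < 1} \<times> sphere 0 1)) \<omega>"
    by (rule path_character_subset[OF \<omega>])
  obtain \<omega>' where \<omega>': "path_character V \<omega>'"
    "\<And>p. path p \<Longrightarrow> path_image p \<subseteq> h ` ({z. r < norm z \<and> norm z < 1} \<times> sphere 0 1) \<Longrightarrow> \<omega> p = \<omega>' p"
    by (rule torus_character_extends[where \<omega> = \<omega>, OF hom r s ch mer[unfolded meridian_def]]) blast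
  have op: "openin (top_of_set X) (X - ?K)"
    using d(3) by (simp add: compact_imp_closed openin_diff closedin_closed_Int openin_open_Int Diff_eq open_Compl)
  show ?thesis
    using op V d(2) VX \<omega> \<omega>' \<gamma> null
    by (intro van_kampen_character_trivial[of X "X - ?K" V \<omega> \<omega>' \<gamma> x]) (auto simp: int)
qed

text \<open>The line bundle with transition function \<open>z\<close> is trivial, so \<open>u = z v\<close> near the core, where \<open>v\<close> does not vanish on
  the whole open torus and therefore has winding number 0 on the meridian.\<close>

lemma linking_function:
  fixes h :: "complex \<times> complex \<Rightarrow> real^4"
  assumes hom: "homeomorphism (ball 0 1 \<times> sphere 0 1) V h g" and V: "openin (top_of_set S3) V"
  obtains u where "continuous_on (S3 - core h) u" "\<And>y. y \<in> S3 - core h \<Longrightarrow> u y \<noteq> 0"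
    "\<And>s. 0 < s \<Longrightarrow> s < 1 \<Longrightarrow> winding_number (u \<circ> meridian h s) 0 = 1"
proof -
  let ?D = "ball 0 1 \<times> sphere 0 1 :: (complex \<times> complex) set"
  let ?U = "S3 - core h"
  have core: "core h = h ` (cball 0 0 \<times> sphere 0 1)" by (simp add: core_def)
  note d = homeomorphism_torus_diff[OF hom, of 0, folded core, simplified]
  have h: "h ` ?D = V" "\<And>x. x \<in> ?D \<Longrightarrow> g (h x) = x" "continuous_on ?D h" "continuous_on V g" "g ` V = ?D"
    using hom by (auto simp: homeomorphism_def)
  have VX: "V \<subseteq> S3" using V openin_imp_subset by blast
  have op: "openin (top_of_set S3) ?U"
    using d(3) by (simp add: compact_imp_closed openin_diff closedin_closed_Int openin_open_Int Diff_eq open_Compl)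
  have un: "?U \<union> V = S3" using VX d(2) by blast
  have int: "?U \<inter> V = h ` ({z. z \<noteq> 0 \<and> norm z < 1} \<times> sphere 0 1)" using VX d(1) by blast
  have "trivial_cocycle_on ?U V (\<lambda>y. fst (g y)) S3"
  proof (rule trivial_cocycle_on_sphere[OF op V un])
    show "continuous_on (?U \<inter> V) (\<lambda>y. fst (g y))"
      by (intro continuous_intros continuous_on_subset[OF h(4)]) auto
    show "fst (g y) \<noteq> 0" if "y \<in> ?U \<inter> V" for y
      using that h(2) unfolding int by force
  qed
  then obtain u v where uv: "continuous_on (S3 \<inter> ?U) u" "continuous_on (S3 \<inter> V) v"
    "\<And>y. y \<in> S3 \<inter> ?U \<Longrightarrow> u y \<noteq> 0" "\<And>y. y \<in> S3 \<inter> V \<Longrightarrow> v y \<noteq> 0"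
    "\<And>y. y \<in> S3 \<inter> ?U \<inter> V \<Longrightarrow> u y = fst (g y) * v y"
    unfolding trivial_cocycle_on_def by metis
  have eq: "S3 \<inter> ?U = ?U" "S3 \<inter> V = V" using VX by auto
  note uv = uv[unfolded eq]
  show ?thesis
  proof (rule that[of u])
    fix s :: real assume s: "0 < s" "s < 1"
    let ?m = "meridian h s"
    note pm = path_meridian[OF h(3) s]
    have in_V: "?m t \<in> ?U \<inter> V" for t
      unfolding int using meridian_in[OF s(1), of h t] s by auto
    have "(u \<circ> ?m) t = circlepath 0 s t * (v \<circ> ?m) t" for t
    proof -
      have "fst (g (?m t)) = circlepath 0 s t"
        unfolding meridian_def using s by (subst h(2)) (auto simp: circlepath norm_mult)
      then show ?thesis using uv(5)[of "?m t"] in_V[of t] by simp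
    qed
    then have "winding_number (u \<circ> ?m) 0 = winding_number (\<lambda>t. circlepath 0 s t * (v \<circ> ?m) t) 0" by presburger
    also have "\<dots> = winding_number (circlepath 0 s) 0 + winding_number (v \<circ> ?m) 0"
    proof (rule winding_number_mult)
      have "path_image ?m \<subseteq> V" using in_V by (auto simp: path_image_def)
      then show "path (v \<circ> ?m)" "0 \<notin> path_image (v \<circ> ?m)"
        using path_continuous_image[OF pm(1) continuous_on_subset[OF uv(2)]] uv(4) 
        by (auto simp: path_image_compose)
    qed (use s in auto)
    also have "winding_number (v \<circ> ?m) 0 = 0"
    proof -
      obtain x where x: "homotopic_paths V ?m (\<lambda>_. x)" using meridian_null[OF h(3) s] h(1) by blast
      then have "homotopic_paths (- {0}) (v \<circ> ?m) (v \<circ> (\<lambda>_. x))"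
        using uv(2,4) by (intro homotopic_paths_continuous_image[OF x]) auto
      moreover have "v x \<noteq> 0"
        using homotopic_paths_imp_subset[OF x] uv(4) by (auto simp: path_image_def)
      ultimately show ?thesis
        using winding_number_homotopic_paths[of 0 "v \<circ> ?m" "v \<circ> (\<lambda>_. x)"] winding_number_zero_const by (simp add: o_def)
    qed
    also have "winding_number (circlepath 0 s) 0 = 1" using s by (intro winding_number_circlepath) simp
    finally show "winding_number (u \<circ> ?m) 0 = 1" by (simp add: o_def)
  qed (use uv in auto)
qed

text \<open>A separation of the complement would extend to one of the sphere, because the part of the complement that
  lies in \<open>V\<close> is connected.\<close>

lemma path_connected_torus_complement:
  fixes h :: "complex \<times> complex \<Rightarrow> real^4"
  assumes hom: "homeomorphism (ball 0 1 \<times> sphere 0 1) V h g" and V: "openin (top_of_set S3) V"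
    and r: "0 \<le> r" "r < 1"
  shows "path_connected (S3 - h ` (cball 0 r \<times> sphere 0 1))"
proof -
  let ?K = "h ` (cball 0 r \<times> sphere 0 1)"
  let ?U = "S3 - ?K"
  let ?A = "{z. r < norm z \<and> norm z < 1} \<times> sphere 0 1 :: (complex \<times> complex) set"
  note d = homeomorphism_torus_diff[OF hom r(2)]
  have VX: "V \<subseteq> S3" using V openin_imp_subset by blast
  have op: "openin (top_of_set S3) ?U"
    using d(3) by (simp add: compact_imp_closed openin_diff closedin_closed_Int openin_open_Int Diff_eq open_Compl)
  have int: "?U \<inter> V = h ` ?A" using VX d(1) by blast
  have "connected ?A"
    using connected_annulus(1)[of r "0::complex" 1] connected_sphere[of "0::complex" 1] by (intro connected_Times) auto
  then have connUV: "connected (?U \<inter> V)"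
    unfolding int using hom by (intro connected_continuous_image) (auto simp: homeomorphism_def elim!: continuous_on_subset)
  have S3: "connected S3" by (rule connected_sphere) simp
  have conn: "connected ?U"
    unfolding connected_openin
  proof (rule notI, elim exE conjE)
    fix E1 E2 assume E: "openin (top_of_set ?U) E1" "openin (top_of_set ?U) E2" "?U \<subseteq> E1 \<union> E2" "E1 \<inter> E2 = {}" "E1 \<noteq> {}" "E2 \<noteq> {}"
    have key: False if A: "openin (top_of_set S3) A" and B: "openin (top_of_set S3) B" and AB: "?U \<subseteq> A \<union> B" "A \<inter> B = {}" "B \<noteq> {}"
      "?U \<inter> V \<subseteq> A" "B \<subseteq> ?U" for A B
    proof -
      have "openin (top_of_set S3) (A \<union> V)" using A V by blast
      moreover have "S3 \<subseteq> (A \<union> V) \<union> B" using AB(1) d(2) by blast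
      moreover have "(A \<union> V) \<inter> B = {}" using AB by blast
      moreover have "A \<union> V \<noteq> {}"
      proof -
        have "(0, 1) \<in> (ball 0 1 \<times> sphere 0 1 :: (complex \<times> complex) set)" by simp
        then have "V \<noteq> {}" using hom unfolding homeomorphism_def by blast
        then show ?thesis by blast
      qed
      ultimately show False using S3 B AB(3) unfolding connected_openin by blast
    qed
    have E': "openin (top_of_set S3) E1" "openin (top_of_set S3) E2" "E1 \<subseteq> ?U" "E2 \<subseteq> ?U"
      using openin_trans[OF E(1) op] openin_trans[OF E(2) op] openin_imp_subset[OF E(1)] openin_imp_subset[OF E(2)]
      by blast+
    have "?U \<inter> V \<subseteq> E1 \<or> ?U \<inter> V \<subseteq> E2"
    proof -
      have "openin (top_of_set (?U \<inter> V)) ((?U \<inter> V) \<inter> E1)" "openin (top_of_set (?U \<inter> V)) ((?U \<inter> V) \<inter> E2)"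
        using E(1,2) by (auto simp: openin_open)
      moreover have "?U \<inter> V \<subseteq> (?U \<inter> V \<inter> E1) \<union> (?U \<inter> V \<inter> E2)" using E(3) by blast
      moreover have "(?U \<inter> V \<inter> E1) \<inter> (?U \<inter> V \<inter> E2) = {}" using E(4) by blast
      ultimately have "?U \<inter> V \<inter> E1 = {} \<or> ?U \<inter> V \<inter> E2 = {}"
        using connUV unfolding connected_openin by metis
      then show ?thesis using E(3) by blast
    qed
    then show False using key[of E1 E2] key[of E2 E1] E E' by blast
  qed
  have lpc: "locally path_connected ?U"
    using locally_open_subset[OF locally_path_connected_sphere op] .
  show ?thesis
    unfolding path_connected_component_set
    using path_component_eq_connected_component_set[OF lpc] connected_component_eq_self[OF conn] by simp
qed

section \<open>Closed braids\<close>

lemma winding_number_prod: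
  assumes "finite A" "\<And>j. j \<in> A \<Longrightarrow> path (p j)" "\<And>j. j \<in> A \<Longrightarrow> 0 \<notin> path_image (p j)"
  shows "winding_number (\<lambda>t. \<Prod>j\<in>A. p j t) 0 = (\<Sum>j\<in>A. winding_number (p j) 0)"
  using assms
proof (induction A rule: finite_induct)
  case empty
  then show ?case by (simp add: winding_number_zero_const)
next
  case (insert a A)
  have "path (\<lambda>t. \<Prod>j\<in>A. p j t)"
    using insert.prems unfolding path_def by (intro continuous_intros) auto
  moreover have "0 \<notin> path_image (\<lambda>t. \<Prod>j\<in>A. p j t)"
  proof
    assume "0 \<in> path_image (\<lambda>t. \<Prod>j\<in>A. p j t)"
    then obtain t j where "t \<in> {0..1}" "j \<in> A" "p j t = 0"
      using insert.hyps(1) unfolding path_image_def by (auto simp: prod_zero_iff)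
    then show False using insert.prems(2)[of j] unfolding path_image_def by (metis imageI insertI2)
  qed
  ultimately show ?case
    using insert winding_number_mult[of "p a" "\<lambda>t. \<Prod>j\<in>A. p j t"] by simp
qed

text \<open>The polynomial in \<open>z\<close> whose roots are the points of the closed braid over \<open>w\<close>. The angle jumps at \<open>w = 1\<close>, but the
  roots are only permuted there.\<close>

definition braid_polynomial :: "nat \<Rightarrow> (nat \<Rightarrow> real \<Rightarrow> complex) \<Rightarrow> complex \<times> complex \<Rightarrow> complex" where
  "braid_polynomial n \<gamma> x = (\<Prod>j<n. fst x - \<gamma> j (Arg2pi (snd x) / (2 * pi)))"

lemma braid_polynomial_cis:
  assumes \<sigma>: "\<sigma> permutes {..<n}" "\<And>j. j < n \<Longrightarrow> pathfinish (\<gamma> j) = pathstart (\<gamma> (\<sigma> j))" and t: "t \<in> {0..1}"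
  shows "braid_polynomial n \<gamma> (z, cis (2 * pi * t)) = (\<Prod>j<n. z - \<gamma> j t)"
proof (cases "t = 1")
  case True
  have "Arg2pi 1 = 0" by (rule Arg2pi_unique[of 1]) auto
  then have "braid_polynomial n \<gamma> (z, cis (2 * pi * t)) = (\<Prod>j<n. z - \<gamma> j 0)"
    using True by (simp add: braid_polynomial_def)
  also have "\<dots> = (\<Prod>j<n. z - \<gamma> (\<sigma> j) 0)"
    using prod.permute[OF \<sigma>(1), of "\<lambda>j. z - \<gamma> j 0"] by (simp add: o_def)
  also have "\<dots> = (\<Prod>j<n. z - \<gamma> j t)"
    using \<sigma>(2) True by (intro prod.cong) (auto simp: pathfinish_def pathstart_def)
  finally show ?thesis .
next
  case False
  then have "Arg2pi (cis (2 * pi * t)) = 2 * pi * t"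
    using t by (intro Arg2pi_unique[of 1]) (auto simp: cis_conv_exp)
  then show ?thesis by (simp add: braid_polynomial_def)
qed

lemma unit_circle_cis: 
  assumes "norm w = 1"
  obtains t where "t \<in> {0..1}" "w = cis (2 * pi * t)"
proof
  have "w = cis (Arg2pi w)" using Arg2pi_eq[of w] assms by (simp add: cis_conv_exp)
  then show "w = cis (2 * pi * (Arg2pi w / (2 * pi)))" by simp
  show "Arg2pi w / (2 * pi) \<in> {0..1}"
    using Arg2pi_ge_0[of w] Arg2pi_lt_2pi[of w] by simp
qed

text \<open>Continuity can be tested after composition with the map that closes up the cylinder \<open>D \<times> [0, 1]\<close>, which is a
  quotient map, as the cylinder is compact.\<close>

lemma continuous_on_braid_polynomial:
  assumes \<gamma>: "\<And>j. j < n \<Longrightarrow> path (\<gamma> j)"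
    and \<sigma>: "\<sigma> permutes {..<n}" "\<And>j. j < n \<Longrightarrow> pathfinish (\<gamma> j) = pathstart (\<gamma> (\<sigma> j))"
  shows "continuous_on std_solid_torus (braid_polynomial n \<gamma>)"
proof -
  let ?Q = "cball 0 1 \<times> {0..1} :: (complex \<times> real) set"
  let ?q = "\<lambda>x::complex \<times> real. (fst x, cis (2 * pi * snd x))"
  let ?P = "\<lambda>x. \<Prod>j<n. fst x - \<gamma> j (snd x)"
  have P: "continuous_on ?Q ?P"
  proof (intro continuous_intros)
    fix j assume "j \<in> {..<n}"
    then have "continuous_on {0..1} (\<gamma> j)" using \<gamma> by (simp add: path_def)
    then show "continuous_on ?Q (\<lambda>x. \<gamma> j (snd x))"
      by (rule continuous_on_compose2) (auto intro: continuous_intros)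
  qed
  have bP: "braid_polynomial n \<gamma> (?q x) = ?P x" if "x \<in> ?Q" for x
    using braid_polynomial_cis[where \<gamma> = \<gamma> and \<sigma> = \<sigma> and n = n, OF \<sigma>] that by auto
  have qQ: "?q ` ?Q = std_solid_torus"
  proof
    show "std_solid_torus \<subseteq> ?q ` ?Q"
    proof
      fix x :: "complex \<times> complex" assume "x \<in> std_solid_torus"
      then obtain z w where x: "x = (z, w)" "norm z \<le> 1" "norm w = 1" by (cases x) auto
      obtain t where "t \<in> {0..1}" "w = cis (2 * pi * t)" using unit_circle_cis[OF x(3)] .
      then have "x = ?q (z, t)" "(z, t) \<in> ?Q" using x by auto
      then show "x \<in> ?q ` ?Q" by blast
    qed
  qed auto
  have cq: "continuous_on S ?q" for S by (intro continuous_intros continuous_on_cis)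
  have cst: "closed std_solid_torus" by (intro closed_Times) auto
  show ?thesis
    unfolding continuous_on_closed_vimage[OF cst]
  proof (intro allI impI)
    fix C :: "complex set" assume C: "closed C"
    have "braid_polynomial n \<gamma> -` C \<inter> std_solid_torus = ?q ` (?P -` C \<inter> ?Q)"
    proof (intro equalityI subsetI)
      fix y assume y: "y \<in> braid_polynomial n \<gamma> -` C \<inter> std_solid_torus"
      then obtain x where x: "x \<in> ?Q" "y = ?q x" using qQ by blast
      then show "y \<in> ?q ` (?P -` C \<inter> ?Q)" using y bP[OF x(1)] by auto
    next
      fix y assume "y \<in> ?q ` (?P -` C \<inter> ?Q)"
      then obtain x where x: "x \<in> ?Q" "y = ?q x" "?P x \<in> C" by blast
      then show "y \<in> braid_polynomial n \<gamma> -` C \<inter> std_solid_torus"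
        using bP[OF x(1)] qQ by auto
    qed
    moreover have "compact (?q ` (?P -` C \<inter> ?Q))"
    proof (rule compact_continuous_image[OF cq])
      have cpQ: "compact ?Q" by (intro compact_Times) auto
      have "closed (?P -` C \<inter> ?Q)"
        using P C compact_imp_closed[OF cpQ] by (simp add: continuous_on_closed_vimage)
      then have "compact (?Q \<inter> (?P -` C \<inter> ?Q))" by (rule compact_Int_closed[OF cpQ])
      moreover have "?Q \<inter> (?P -` C \<inter> ?Q) = ?P -` C \<inter> ?Q" by blast
      ultimately show "compact (?P -` C \<inter> ?Q)" by (simp only:)
    qed
    ultimately show "closed (braid_polynomial n \<gamma> -` C \<inter> std_solid_torus)"
      by (simp add: compact_imp_closed)
  qed
qed

lemma braid_polynomial_eq_0_iff:
  assumes \<sigma>: "\<sigma> permutes {..<n}" "\<And>j. j < n \<Longrightarrow> pathfinish (\<gamma> j) = pathstart (\<gamma> (\<sigma> j))"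
    and x: "snd x \<in> sphere 0 1"
  shows "braid_polynomial n \<gamma> x = 0 \<longleftrightarrow> x \<in> {(\<gamma> j t, cis (2 * pi * t)) | j t. j < n \<and> t \<in> {0..1}}"
proof
  obtain z w where zw: "x = (z, w)" by (cases x)
  {
    assume 0: "braid_polynomial n \<gamma> x = 0"
    have "norm w = 1" using x by (simp add: zw)
    from unit_circle_cis[OF this] obtain t where t: "t \<in> {0..1}" "w = cis (2 * pi * t)" .
    have "(\<Prod>j<n. z - \<gamma> j t) = 0" using 0 braid_polynomial_cis[where \<gamma> = \<gamma> and \<sigma> = \<sigma> and n = n, OF \<sigma> t(1)] by (simp add: zw t)
    then obtain j where "j < n" "z = \<gamma> j t" by (auto simp: prod_zero_iff)
    then show "x \<in> {(\<gamma> j t, cis (2 * pi * t)) | j t. j < n \<and> t \<in> {0..1}}" using zw t by blast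
  next
    assume "x \<in> {(\<gamma> j t, cis (2 * pi * t)) | j t. j < n \<and> t \<in> {0..1}}"
    then obtain j t where jt: "j < n" "t \<in> {0..1}" "x = (\<gamma> j t, cis (2 * pi * t))" by blast
    show "braid_polynomial n \<gamma> x = 0"
      using jt by (auto simp: braid_polynomial_cis[where \<gamma> = \<gamma> and \<sigma> = \<sigma> and n = n, OF \<sigma> jt(2)] prod_zero_iff)
  }
qed

lemma winding_number_linear_factors:
  assumes "finite A" "\<And>j. j \<in> A \<Longrightarrow> a j \<notin> sphere c r" "r > 0"
  shows "winding_number (\<lambda>t. \<Prod>j\<in>A. circlepath c r t - a j) 0 = of_nat (card {j\<in>A. a j \<in> ball c r})"
proof -
  have "winding_number (\<lambda>t. \<Prod>j\<in>A. circlepath c r t - a j) 0 = (\<Sum>j\<in>A. winding_number (\<lambda>t. circlepath c r t - a j) 0)"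
  proof (rule winding_number_prod[OF assms(1)])
    fix j assume "j \<in> A"
    show "path (\<lambda>t. circlepath c r t - a j)"
      using path_circlepath[of c r] unfolding path_def by (intro continuous_intros)
    have "a j \<notin> path_image (circlepath c r)" using assms(2)[OF \<open>j \<in> A\<close>] assms(3) by simp
    then show "0 \<notin> path_image (\<lambda>t. circlepath c r t - a j)"
    proof (rule contrapos_nn)
      assume "0 \<in> path_image (\<lambda>t. circlepath c r t - a j)"
      then obtain t where "t \<in> {0..1}" "circlepath c r t - a j = 0"
        unfolding path_image_def by (metis (no_types, lifting) imageE)
      then show "a j \<in> path_image (circlepath c r)"
        unfolding path_image_def by (intro image_eqI[of _ _ t]) simp_all
    qed
  qed
  also have "\<dots> = (\<Sum>j\<in>A. if a j \<in> ball c r then 1 else 0)"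
  proof (rule sum.cong[OF refl])
    fix j assume j: "j \<in> A"
    have "winding_number (circlepath c r) (a j) = (if a j \<in> ball c r then 1 else 0)"
    proof (cases "a j \<in> ball c r")
      case True
      then show ?thesis using winding_number_circlepath[of "a j" c r] by (simp add: dist_norm norm_minus_commute)
    next
      case False
      then have "a j \<notin> cball c r" using assms(2)[OF j] by auto
      then have "winding_number (circlepath c r) (a j) = 0"
        using assms(3) by (intro winding_number_zero_outside[of _ "cball c r"]) auto
      then show ?thesis using False by simp
    qed
    then show "winding_number (\<lambda>t. circlepath c r t - a j) 0 = (if a j \<in> ball c r then 1 else 0)"
      by (simp only: winding_number_offset[of "circlepath c r" "a j"])
  qed
  also have "\<dots> = of_nat (card {j\<in>A. a j \<in> ball c r})"
    using assms(1) by (simp add: sum.If_cases Int_def)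
  finally show ?thesis .
qed

text \<open>\<open>H\<^sup>1\<close> of the complement is generated by \<open>u\<close>: the difference of the two sides, exponentiated, is a character that
  is trivial on the meridian.\<close>

lemma winding_number_proportional:
  fixes h :: "complex \<times> complex \<Rightarrow> 'a::t2_space"
  assumes hom: "homeomorphism (ball 0 1 \<times> sphere 0 1) V h g" and V: "openin (top_of_set X) V"
    and r: "0 \<le> r" and s: "r < s" "s < 1" and K: "K = h ` (cball 0 r \<times> sphere 0 1)"
    and u: "continuous_on (X - K) u" "\<And>y. y \<in> X - K \<Longrightarrow> u y \<noteq> 0" and u1: "winding_number (u \<circ> meridian h s) 0 = 1"
    and v: "continuous_on (X - K) v" "\<And>y. y \<in> X - K \<Longrightarrow> v y \<noteq> 0"
    and \<gamma>: "path \<gamma>" "path_image \<gamma> \<subseteq> X - K" "pathfinish \<gamma> = pathstart \<gamma>" and null: "homotopic_paths X \<gamma> (\<lambda>_. x)"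
  shows "winding_number (v \<circ> \<gamma>) 0 = winding_number (v \<circ> meridian h s) 0 * winding_number (u \<circ> \<gamma>) 0"
proof -
  have loop_int: "winding_number (f \<circ> p) 0 \<in> \<int>"
    if "continuous_on (X - K) f" "\<And>y. y \<in> X - K \<Longrightarrow> f y \<noteq> 0" "path p" "path_image p \<subseteq> X - K" "pathfinish p = pathstart p"
    for f :: "'a \<Rightarrow> complex" and p
    using that path_continuous_image[OF that(3) continuous_on_subset[OF that(1,4)]]
    by (intro integer_winding_number) (auto simp: path_image_compose pathfinish_compose pathstart_compose)
  have VX: "V \<subseteq> X" using V openin_imp_subset by blast
  have h: "continuous_on (ball 0 1 \<times> sphere 0 1) h" "h ` (ball 0 1 \<times> sphere 0 1) = V" using hom by (auto simp: homeomorphism_def)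
  have s0: "0 < s" using r s by simp
  note pm = path_meridian[OF h(1) s0 s(2)]
  have mer: "path_image (meridian h s) \<subseteq> X - K"
  proof -
    have "r < 1" using s by simp
    have "sphere 0 s \<times> sphere 0 1 \<subseteq> {z. r < norm z \<and> norm z < 1} \<times> (sphere 0 1 :: complex set)" using s by auto
    then have "h ` (sphere 0 s \<times> sphere 0 1) \<subseteq> V - K"
      unfolding K homeomorphism_torus_diff(1)[OF hom \<open>r < 1\<close>] by blast
    then show ?thesis using pm(2) VX by blast
  qed
  obtain m where m: "winding_number (v \<circ> meridian h s) 0 = of_int m"
    using loop_int[OF v pm(1) mer pm(3)] by (auto elim: Ints_cases)
  obtain a where a: "winding_number (u \<circ> \<gamma>) 0 = of_int a" using loop_int[OF u \<gamma>] by (auto elim: Ints_cases)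
  obtain b where b: "winding_number (v \<circ> \<gamma>) 0 = of_int b" using loop_int[OF v \<gamma>] by (auto elim: Ints_cases)
  let ?\<omega> = "\<lambda>p. exp (of_int m * winding_number (u \<circ> p) 0) * exp ((- 1) * winding_number (v \<circ> p) 0)"
  have "path_character (X - K) ?\<omega>"
    by (intro path_character_mult path_character_winding u v)
  then have "?\<omega> \<gamma> = 1"
  proof (rule character_trivial_if_meridian_trivial[where \<omega> = ?\<omega>, OF hom V r s, folded K])
    show "?\<omega> (meridian h s) = 1" by (simp add: u1 m flip: exp_add)
  qed (use \<gamma> null in auto)
  then have "exp (of_int (m * a - b) :: complex) = 1"
    by (simp add: a b flip: exp_add)
  then have "b = m * a" unfolding exp_int_eq_1_iff by simp
  then show ?thesis by (simp add: a b m)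
qed

text \<open>Let \<open>m\<close> be the winding number of the braid polynomial \<open>v\<close> on the meridian of \<open>V'\<close>. Proportionality in \<open>V\<close>, applied to the
  meridian of \<open>V\<close>, gives \<open>m N = n\<close> for the winding number \<open>N\<close> of \<open>u\<close>, since all \<open>n\<close> roots lie inside. Proportionality in
  \<open>V'\<close>, applied to a small circle around one strand in a cross-section of \<open>V\<close>, shows that \<open>m\<close> divides 1,
  since only one root lies inside. Hence \<open>m = \<plusminus>1\<close>.\<close>

theorem winding_number_closed_braid:
  fixes h h' :: "complex \<times> complex \<Rightarrow> real^4"
  assumes hom: "homeomorphism (ball 0 1 \<times> sphere 0 1) V h g" 
    and hom': "homeomorphism (ball 0 1 \<times> sphere 0 1) V' h' g'"
    and V: "openin (top_of_set S3) V" and V': "openin (top_of_set S3) V'"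
    and r: "r < s" "0 < s" "s < 1" and V'r: "V' \<subseteq> h ` (cball 0 r \<times> sphere 0 1)"
    and n: "n > 0" and K: "transitive_closed_braid n K" and core: "core h' = h ` K"
    and u: "continuous_on (S3 - core h') u" "\<And>y. y \<in> S3 - core h' \<Longrightarrow> u y \<noteq> 0"
    and u1: "\<And>s. 0 < s \<Longrightarrow> s < 1 \<Longrightarrow> winding_number (u \<circ> meridian h' s) 0 = 1"
  obtains e :: int where "e = 1 \<or> e = -1" "winding_number (u \<circ> meridian h s) 0 = of_int (e * int n)"
proof -
  let ?D = "ball 0 1 \<times> sphere 0 1 :: (complex \<times> complex) set"
  obtain \<gamma> \<sigma> where \<gamma>: "\<And>j. j < n \<Longrightarrow> path (\<gamma> j)" "\<And>j. j < n \<Longrightarrow> path_image (\<gamma> j) \<subseteq> ball 0 1"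
    and inj: "\<And>t. t \<in> {0..1} \<Longrightarrow> inj_on (\<lambda>j. \<gamma> j t) {..<n}"
    and \<sigma>: "\<sigma> permutes {..<n}" "\<And>j. j < n \<Longrightarrow> pathfinish (\<gamma> j) = pathstart (\<gamma> (\<sigma> j))"
    and K: "K = {(\<gamma> j t, cis (2 * pi * t)) | j t. j < n \<and> t \<in> {0..1}}"
    using K unfolding transitive_closed_braid_def by blast
  have \<gamma>D: "norm (\<gamma> j t) < 1" if "j < n" "t \<in> {0..1}" for j t
  proof -
    have "\<gamma> j t \<in> path_image (\<gamma> j)" using that(2) by (simp add: path_image_def)
    then show ?thesis using \<gamma>(2)[OF that(1)] by auto
  qed
  have KD: "K \<subseteq> ?D" unfolding K using \<gamma>D by auto
  have h: "continuous_on ?D h" "h ` ?D = V" "\<And>x. x \<in> ?D \<Longrightarrow> g (h x) = x" "continuous_on V g" "g ` V = ?D"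
    "\<And>y. y \<in> V \<Longrightarrow> h (g y) = y" "inj_on h ?D"
    using hom by (auto simp: homeomorphism_def intro: inj_on_inverseI)
  have h': "continuous_on ?D h'" "h' ` ?D = V'" "\<And>x. x \<in> ?D \<Longrightarrow> g' (h' x) = x" "continuous_on V' g'" "g' ` V' = ?D"
    "\<And>y. y \<in> V' \<Longrightarrow> h' (g' y) = y"
    using hom' by (auto simp: homeomorphism_def)
  have VX: "V \<subseteq> S3" using V openin_imp_subset by blast
  have "r < 1" using r by simp
  have V'V: "V' \<subseteq> V" using V'r homeomorphism_torus_diff(2)[OF hom \<open>r < 1\<close>] by blast
  have opV: "openin (top_of_set V) V'" using V' V'V VX openin_subset_trans by blast
  have core0: "core h' = h' ` (cball 0 0 \<times> sphere 0 1)" by (simp add: core_def)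
  have coreV': "core h' \<subseteq> V'" using homeomorphism_torus_diff(2)[OF hom', of 0] core0 by simp

  define v where "v = braid_polynomial n \<gamma> \<circ> g"
  have v0: "v y = 0 \<longleftrightarrow> y \<in> core h'" if y: "y \<in> V" for y
  proof -
    have gy: "g y \<in> ?D" using h(5) y by blast
    then have "v y = 0 \<longleftrightarrow> g y \<in> K"
      unfolding v_def o_def K by (intro braid_polynomial_eq_0_iff[where \<sigma> = \<sigma>]) (use \<sigma> in auto)
    also have "\<dots> \<longleftrightarrow> y \<in> h ` K"
      using inj_on_image_mem_iff[OF h(7) gy KD] h(6)[OF y] by simp
    finally show ?thesis by (simp add: core)
  qed
  have contv: "continuous_on V v"
    unfolding v_def o_def
  proof (rule continuous_on_compose2[OF continuous_on_braid_polynomial[of n \<gamma> \<sigma>] h(4)])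
    show "g ` V \<subseteq> std_solid_torus" unfolding h(5) by auto
  qed (use \<gamma> \<sigma> in auto)
  define s' :: real where "s' = 1 / 2"
  have s': "0 < s'" "s' < 1" by (auto simp: s'_def)
  \<comment> \<open>Meridians of \<open>V'\<close> of all radii are homotopic; this is one of them.\<close>
  define m where "m = winding_number (v \<circ> meridian h' s') 0"
  have slice: "v (h (z, 1)) = (\<Prod>j<n. z - \<gamma> j 0)" if "norm z < 1" for z
    using braid_polynomial_cis[where \<gamma> = \<gamma> and \<sigma> = \<sigma> and n = n, OF \<sigma>, of 0 z] h(3)[of "(z, 1)"] that by (simp add: v_def)
  have \<gamma>r: "norm (\<gamma> j 0) \<le> r" if "j < n" for j
  proof -
    have "(\<gamma> j 0, 1) \<in> K" unfolding K using that by force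
    then have 1: "h (\<gamma> j 0, 1) \<in> h ` (cball 0 r \<times> sphere 0 1)" "(\<gamma> j 0, 1) \<in> ?D"
      using core coreV' V'r KD by blast+
    have "cball 0 r \<times> sphere 0 1 \<subseteq> ?D" using \<open>r < 1\<close> by auto
    then have "(\<gamma> j 0, 1) \<in> cball 0 r \<times> (sphere 0 1 :: complex set)" using inj_on_image_mem_iff[OF h(7) 1(2)] 1(1) by blast
    then show ?thesis by simp
  qed

  have mer_eq: "m * winding_number (u \<circ> meridian h s) 0 = of_nat n"
  proof -
    note pm = path_meridian[OF h(1) r(2,3)]
    have in_V: "path_image (meridian h s) \<subseteq> V - core h'"
    proof -
      have "sphere 0 s \<times> sphere 0 1 \<subseteq> {z. r < norm z \<and> norm z < 1} \<times> (sphere 0 1 :: complex set)" using r by auto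
      then have "h ` (sphere 0 s \<times> sphere 0 1) \<subseteq> V - h ` (cball 0 r \<times> sphere 0 1)"
        unfolding homeomorphism_torus_diff(1)[OF hom \<open>r < 1\<close>] by blast
      then show ?thesis using pm(2) coreV' V'r by blast
    qed
    obtain x where x: "homotopic_paths V (meridian h s) (\<lambda>_. x)"
      using meridian_null[OF h(1) r(2,3)] h(2) by blast
    have "winding_number (v \<circ> meridian h s) 0 = m * winding_number (u \<circ> meridian h s) 0"
      unfolding m_def
    proof (rule winding_number_proportional[OF hom' opV order_refl s' core0 _ _ u1[OF s'] _ _ pm(1) in_V pm(3) x])
      show "continuous_on (V - core h') u" by (rule continuous_on_subset[OF u(1)]) (use VX in blast)
      show "u y \<noteq> 0" if "y \<in> V - core h'" for y using u(2) VX that by blast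
      show "continuous_on (V - core h') v" by (rule continuous_on_subset[OF contv]) blast
      show "v y \<noteq> 0" if "y \<in> V - core h'" for y using v0 that by blast
    qed
    moreover have "v \<circ> meridian h s = (\<lambda>t. \<Prod>j<n. circlepath 0 s t - \<gamma> j 0)"
      using r(2,3) by (auto simp: meridian_def circlepath slice norm_mult)
    moreover have "winding_number (\<lambda>t. \<Prod>j<n. circlepath 0 s t - \<gamma> j 0) 0 = of_nat (card {j\<in>{..<n}. \<gamma> j 0 \<in> ball 0 s})"
      using \<gamma>r r by (intro winding_number_linear_factors) fastforce+
    moreover have "{j\<in>{..<n}. \<gamma> j 0 \<in> ball 0 s} = {..<n}" using \<gamma>r r(1) by fastforce
    ultimately show ?thesis by simp
  qed

  have m_unit: "\<exists>k\<in>\<int>. 1 = m * k"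
  proof -
    let ?a = "\<gamma> 0 0"
    let ?G = "ball 0 1 \<inter> (\<lambda>z. h (z, 1)) -` V'"
    have "continuous_on (ball 0 1) (\<lambda>z. h (z, 1))"
      by (rule continuous_on_compose2[OF h(1)]) (auto intro!: continuous_intros)
    moreover have "(\<lambda>z. h (z, 1)) \<in> ball 0 1 \<rightarrow> V" using h(2) by auto
    ultimately have "openin (top_of_set (ball 0 1)) ?G" using opV by (rule continuous_openin_preimage)
    then have "open ?G" by (simp add: openin_open_eq)
    \<comment> \<open>The circle has to stay inside \<open>V'\<close> and to enclose no other strand.\<close>
    then have "open (?G - (\<lambda>j. \<gamma> j 0) ` {1..<n})" by (intro open_Diff finite_imp_closed) auto
    moreover have "?a \<in> ?G - (\<lambda>j. \<gamma> j 0) ` {1..<n}"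
    proof -
      have "(?a, 1) \<in> K" unfolding K using n by force
      then have "h (?a, 1) \<in> V'" using core coreV' by blast
      moreover have "?a \<noteq> \<gamma> j 0" if "j \<in> {1..<n}" for j
        using inj[of 0] n that unfolding inj_on_def by force
      ultimately have "?a \<notin> (\<lambda>j. \<gamma> j 0) ` {1..<n}" by blast
      then show ?thesis using \<gamma>D[of 0 0] n \<open>h (?a, 1) \<in> V'\<close> by simp
    qed
    ultimately obtain \<rho> where \<rho>: "\<rho> > 0" "cball ?a \<rho> \<subseteq> ?G - (\<lambda>j. \<gamma> j 0) ` {1..<n}"
      using open_contains_cball by blast
    have away: "\<gamma> j 0 \<notin> cball ?a \<rho>" if "j < n" "j \<noteq> 0" for j
      using \<rho>(2) that by (cases "j \<in> {1..<n}") auto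
    let ?c = "\<lambda>t. h (circlepath ?a \<rho> t, 1)"
    let ?p = "\<lambda>t. (circlepath ?a \<rho> t, 1 :: complex)"
    have circ: "circlepath ?a \<rho> t \<in> sphere ?a \<rho>" for t
      using \<rho>(1) by (simp add: circlepath dist_norm norm_mult)
    have cG: "circlepath ?a \<rho> t \<in> ?G" for t using circ[of t] sphere_cball \<rho>(2) by blast
    then have cD: "norm (circlepath ?a \<rho> t) < 1" for t by simp
    have contc: "continuous_on (cball ?a \<rho> \<times> {1}) h" by (rule continuous_on_subset[OF h(1)]) (use \<rho>(2) in auto)
    have pp: "path ?p" "path_image ?p \<subseteq> cball ?a \<rho> \<times> {1}" "pathfinish ?p = pathstart ?p"
    proof -
      show "path ?p" using path_circlepath[of ?a \<rho>] unfolding path_def by (intro continuous_intros)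
      show "path_image ?p \<subseteq> cball ?a \<rho> \<times> {1}" using circ by (fastforce simp: path_image_def)
      show "pathfinish ?p = pathstart ?p" by (simp add: pathfinish_def pathstart_def circlepath)
    qed
    have null: "homotopic_paths V' ?c (\<lambda>_. h (pathstart ?p))"
    proof -
      have "homotopic_paths V' (h \<circ> ?p) (\<lambda>_. h (pathstart ?p))"
        by (rule convex_image_loop_null[OF _ contc _ pp]) (use \<rho>(2) in \<open>auto intro: convex_Times\<close>)
      then show ?thesis by (simp add: o_def)
    qed
    have pc: "path ?c" "pathfinish ?c = pathstart ?c"
      using homotopic_paths_imp_path[OF null] pp(3) by (auto simp: pathfinish_def pathstart_def)
    have vc: "v \<circ> ?c = (\<lambda>t. \<Prod>j<n. circlepath ?a \<rho> t - \<gamma> j 0)" using slice cD by auto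
    have off: "\<gamma> j 0 \<notin> sphere ?a \<rho>" if "j \<in> {..<n}" for j
      using away[of j] that \<rho>(1) by (cases "j = 0") auto
    have "v (?c t) \<noteq> 0" for t
      using fun_cong[OF vc, of t] off circ[of t] by (auto simp: prod_zero_iff)
    moreover have "?c t \<in> V'" for t using cG[of t] by blast
    ultimately have in_V': "path_image ?c \<subseteq> V' - core h'"
      using v0 V'V by (auto simp: path_image_def)
    have V'diff: "V' - core h' = h' ` ({z. 0 < norm z \<and> norm z < 1} \<times> sphere 0 1)"
      using homeomorphism_torus_diff(1)[OF hom', of 0] core0 by simp
    have w: "continuous_on (V' - core h') (\<lambda>y. fst (g' y))"
      by (intro continuous_intros continuous_on_subset[OF h'(4)]) auto
    have w0: "fst (g' y) \<noteq> 0" if "y \<in> V' - core h'" for y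
      using that h'(3) unfolding V'diff by force
    have w1: "winding_number ((\<lambda>y. fst (g' y)) \<circ> meridian h' s') 0 = 1"
    proof -
      have "(\<lambda>y. fst (g' y)) \<circ> meridian h' s' = circlepath 0 s'"
        using s' h'(3) by (auto simp: meridian_def circlepath norm_mult)
      then show ?thesis using s' by (simp add: winding_number_circlepath)
    qed
    have "winding_number (v \<circ> ?c) 0 = m * winding_number ((\<lambda>y. fst (g' y)) \<circ> ?c) 0"
      unfolding m_def
    proof (rule winding_number_proportional[OF hom' openin_subtopology_self order_refl s' core0 w w0 w1 _ _ pc(1) in_V' pc(2) null])
      show "continuous_on (V' - core h') v" by (rule continuous_on_subset[OF contv]) (use V'V in blast)
      show "v y \<noteq> 0" if "y \<in> V' - core h'" for y using v0 V'V that by blast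
    qed
    moreover have "winding_number (v \<circ> ?c) 0 = 1"
    proof -
      have "winding_number (v \<circ> ?c) 0 = of_nat (card {j\<in>{..<n}. \<gamma> j 0 \<in> ball ?a \<rho>})"
        unfolding vc using off \<rho>(1) by (intro winding_number_linear_factors) auto
      also have "{j\<in>{..<n}. \<gamma> j 0 \<in> ball ?a \<rho>} = {0}"
      proof (intro equalityI subsetI)
        fix j assume j: "j \<in> {j\<in>{..<n}. \<gamma> j 0 \<in> ball ?a \<rho>}"
        then have "\<gamma> j 0 \<in> cball ?a \<rho>" "j < n" using ball_subset_cball by auto
        then show "j \<in> {0}" using away[of j] by blast
      qed (use n \<rho>(1) in auto)
      finally show ?thesis by (simp add: o_def)
    qed
    moreover have "winding_number ((\<lambda>y. fst (g' y)) \<circ> ?c) 0 \<in> \<int>"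
      using path_continuous_image[OF pc(1) continuous_on_subset[OF w in_V']] w0 in_V' pc(2)
      by (intro integer_winding_number) (auto simp: path_image_compose pathfinish_compose pathstart_compose)
    ultimately show ?thesis by metis
  qed

  have "m \<in> \<int>"
  proof -
    note pm = path_meridian[OF h'(1) s']
    have in_V': "path_image (meridian h' s') \<subseteq> V' - core h'"
    proof -
      have "sphere 0 s' \<times> sphere 0 1 \<subseteq> {z. 0 < norm z \<and> norm z < 1} \<times> (sphere 0 1 :: complex set)" using s' by auto
      then have "h' ` (sphere 0 s' \<times> sphere 0 1) \<subseteq> V' - core h'"
        using homeomorphism_torus_diff(1)[OF hom', of 0] core0 by auto
      then show ?thesis using pm(2) by blast
    qed
    have v_nz: "v y \<noteq> 0" if "y \<in> path_image (meridian h' s')" for y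
      using v0[of y] in_V' V'V that by blast
    have "path_image (meridian h' s') \<subseteq> V" using in_V' V'V by blast
    then show ?thesis unfolding m_def
      using path_continuous_image[OF pm(1) continuous_on_subset[OF contv]] v_nz pm(3)
      by (intro integer_winding_number) (auto simp: path_image_compose pathfinish_compose pathstart_compose)
  qed
  then obtain e where e: "m = of_int e" by (auto elim: Ints_cases)
  obtain k where "1 = m * of_int k" using m_unit by (auto elim: Ints_cases)
  then have "(of_int (e * k) :: complex) = of_int 1" by (simp add: e)
  then have "e * k = 1" by (simp only: of_int_eq_iff)
  then have e1: "e = 1 \<or> e = -1" by (simp add: zmult_eq_1_iff) blast
  show ?thesis
  proof (rule that[OF e1])
    have "m * m = 1" using e1 by (auto simp: e)
    then have "winding_number (u \<circ> meridian h s) 0 = m * (m * winding_number (u \<circ> meridian h s) 0)"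
      by (simp flip: mult.assoc)
    also have "\<dots> = of_int (e * int n)" unfolding mer_eq by (simp add: e)
    finally show "winding_number (u \<circ> meridian h s) 0 = of_int (e * int n)" .
  qed
qed

section \<open>Character spaces\<close>

text \<open>The values of a character outside the carrier are fixed, so that the product topology on functions induces the topology of pointwise convergence on the
  carrier.\<close>

definition character_space :: "('g, 'b) monoid_scheme \<Rightarrow> ('g \<Rightarrow> complex) set" where
  "character_space G = {\<phi>. \<phi> \<in> extensional (carrier G) \<and> \<phi> ` carrier G \<subseteq> sphere 0 1 \<and>
      (\<forall>a\<in>carrier G. \<forall>b\<in>carrier G. \<phi> (a \<otimes>\<^bsub>G\<^esub> b) = \<phi> a * \<phi> b)}"

lemma homeomorphic_function_spacesI:
  fixes S :: "('a \<Rightarrow> 'b::topological_space) set" and T :: "('c \<Rightarrow> 'd::topological_space) set"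
  assumes "\<And>i. continuous_on S (\<lambda>x. f x i)" "\<And>i. continuous_on T (\<lambda>y. g y i)"
    and "\<And>x. x \<in> S \<Longrightarrow> f x \<in> T" "\<And>y. y \<in> T \<Longrightarrow> g y \<in> S"
    and "\<And>x. x \<in> S \<Longrightarrow> g (f x) = x" "\<And>y. y \<in> T \<Longrightarrow> f (g y) = y"
  shows "S homeomorphic T"
proof -
  have "continuous_on S f" "continuous_on T g"
    using assms(1,2) by (auto intro: continuous_on_coordinatewise_then_product)
  moreover have "f ` S = T" "g ` T = S" using assms(3-6) by force+
  ultimately show ?thesis unfolding homeomorphic_def homeomorphism_def using assms(5,6) by blast
qed

lemma continuous_on_coordinate: "continuous_on S (\<lambda>x. x i)"
  by (rule continuous_on_subset[OF continuous_on_product_coordinates]) simp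

lemma character_space_iso:
  assumes G: "group G" and iso: "G \<cong> H"
  shows "character_space G homeomorphic character_space H"
proof -
  obtain f where f: "f \<in> iso G H" using iso by (auto simp: is_iso_def)
  define f' where "f' = inv_into (carrier G) f"
  have f': "f' \<in> iso H G" unfolding f'_def using group.iso_set_sym[OF G f] .
  have bij: "bij_betw f (carrier G) (carrier H)" using f by (simp add: iso_def)
  have inv: "f' (f a) = a" if "a \<in> carrier G" for a
    unfolding f'_def using bij that by (simp add: bij_betw_inv_into_left)
  have inv': "f (f' b) = b" if "b \<in> carrier H" for b
    unfolding f'_def using bij that by (simp add: bij_betw_inv_into_right)
  have fc: "f a \<in> carrier H" if "a \<in> carrier G" for a using f that by (auto simp: iso_def hom_def)
  have fc': "f' b \<in> carrier G" if "b \<in> carrier H" for b using f' that by (auto simp: iso_def hom_def)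
  have pull: "restrict (\<phi> \<circ> k) (carrier A) \<in> character_space A"
    if k: "k \<in> hom A B" and "\<phi> \<in> character_space B" "\<And>a b. a \<in> carrier A \<Longrightarrow> b \<in> carrier A \<Longrightarrow> a \<otimes>\<^bsub>A\<^esub> b \<in> carrier A"
    for \<phi> k and A :: "('x, 'y) monoid_scheme" and B :: "('z, 'w) monoid_scheme"
    using that unfolding character_space_def by (auto simp: hom_def Pi_iff image_subset_iff)
  have closedG: "a \<otimes>\<^bsub>G\<^esub> b \<in> carrier G" if "a \<in> carrier G" "b \<in> carrier G" for a b
    using G that by (simp add: group.is_monoid monoid.m_closed)
  have closedH: "a \<otimes>\<^bsub>H\<^esub> b \<in> carrier H" if "a \<in> carrier H" "b \<in> carrier H" for a b
  proof -
    have "f (f' a \<otimes>\<^bsub>G\<^esub> f' b) = a \<otimes>\<^bsub>H\<^esub> b" using f fc' inv' that by (auto simp: iso_def hom_def)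
    then show ?thesis using fc[OF closedG[OF fc'[OF that(1)] fc'[OF that(2)]]] by simp
  qed
  have ext: "\<phi> a = undefined" if "\<phi> \<in> character_space A" "a \<notin> carrier A" for \<phi> a and A :: "('x, 'y) monoid_scheme"
    using that by (auto simp: character_space_def extensional_def)
  show ?thesis
  proof (rule homeomorphic_function_spacesI[where f = "\<lambda>\<phi>. restrict (\<phi> \<circ> f') (carrier H)" and g = "\<lambda>\<phi>. restrict (\<phi> \<circ> f) (carrier G)"])
    show "continuous_on S (\<lambda>x. restrict (x \<circ> f') (carrier H) i)" for S i
      by (cases "i \<in> carrier H") (simp_all add: continuous_on_coordinate)
    show "continuous_on S (\<lambda>x. restrict (x \<circ> f) (carrier G) i)" for S i
      by (cases "i \<in> carrier G") (simp_all add: continuous_on_coordinate)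
    show "restrict (\<phi> \<circ> f') (carrier H) \<in> character_space H" if "\<phi> \<in> character_space G" for \<phi>
      using f' that closedH by (intro pull) (auto simp: iso_def)
    show "restrict (\<phi> \<circ> f) (carrier G) \<in> character_space G" if "\<phi> \<in> character_space H" for \<phi>
      using f that closedG by (intro pull) (auto simp: iso_def)
    show "restrict (restrict (\<phi> \<circ> f') (carrier H) \<circ> f) (carrier G) = \<phi>" if "\<phi> \<in> character_space G" for \<phi>
      using ext[OF that] fc inv by (auto simp: restrict_def fun_eq_iff)
    show "restrict (restrict (\<phi> \<circ> f) (carrier G) \<circ> f') (carrier H) = \<phi>" if "\<phi> \<in> character_space H" for \<phi>
      using ext[OF that] fc' inv' by (auto simp: restrict_def fun_eq_iff)
  qed
qed

text \<open>\<open>G\<close> is exhausted by the \<open>H i\<close>, on each of which every character factors through \<open>k i\<close>. A character is therefore given by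
  its values \<open>c i\<close> on the elements \<open>m i\<close>, and \<open>bond\<close> becomes the relation between the coordinates of a
  point of the solenoid.\<close>

lemma character_space_homeomorphic_solenoid:
  fixes H :: "nat \<Rightarrow> 'g set" and k :: "nat \<Rightarrow> 'g \<Rightarrow> int"
  assumes H: "\<And>i. H i \<subseteq> H (Suc i)" "(\<Union>i. H i) = carrier G"
    and hom: "\<And>i a b. a \<in> H i \<Longrightarrow> b \<in> H i \<Longrightarrow> a \<otimes>\<^bsub>G\<^esub> b \<in> H i" "\<And>i a b. a \<in> H i \<Longrightarrow> b \<in> H i \<Longrightarrow> k i (a \<otimes>\<^bsub>G\<^esub> b) = k i a + k i b"
    and bond: "\<And>i a. a \<in> H i \<Longrightarrow> k (Suc i) a = int (n i) * k i a"
    and m: "\<And>i. m i \<in> H i" "\<And>i. k i (m i) = 1"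
    and gen: "\<And>\<phi> i a. \<phi> \<in> character_space G \<Longrightarrow> a \<in> H i \<Longrightarrow> \<phi> a = \<phi> (m i) powi k i a"
  shows "character_space G homeomorphic solenoid n"
proof -
  define I where "I a = (LEAST i. a \<in> H i)" for a
  define F where "F c = restrict (\<lambda>a. c (I a) powi k (I a) a) (carrier G)" for c :: "nat \<Rightarrow> complex"
  have Hmono: "H i \<subseteq> H j" if "i \<le> j" for i j using lift_Suc_mono_le[of H, OF H(1) that] .
  have HG: "H i \<subseteq> carrier G" for i using H(2) by blast
  have sol: "norm (c i) = 1" "c i = c (Suc i) ^ n i" "c i \<noteq> 0" if "c \<in> solenoid n" for c i
  proof -
    have *: "c i \<in> sphere 0 1 \<and> c i = c (Suc i) ^ n i" using that unfolding solenoid_def by blast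
    show 1: "norm (c i) = 1" using conjunct1[OF *] by simp
    show "c i = c (Suc i) ^ n i" using conjunct2[OF *] .
    show "c i \<noteq> 0" using 1 by auto
  qed
  have FI: "F c a = c j powi k j a" if c: "c \<in> solenoid n" and a: "a \<in> H j" for c a j
  proof -
    have "a \<in> H (I a)" unfolding I_def using a by (rule LeastI)
    have "I a \<le> j" unfolding I_def using a by (rule Least_le)
    have "c (I a) powi k (I a) a = c j powi k j a"
      using \<open>I a \<le> j\<close>
    proof (induction j rule: dec_induct)
      case (step i)
      have "a \<in> H i" using Hmono[OF step.hyps(1)] \<open>a \<in> H (I a)\<close> by blast
      then have "c (Suc i) powi k (Suc i) a = c (Suc i) powi (int (n i) * k i a)" by (simp only: bond)
      also have "\<dots> = c i powi k i a"
        using sol(2)[OF c, of i] by (simp add: power_int_mult)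
      finally show ?case using step.IH by simp
    qed simp
    then show ?thesis using a HG by (auto simp: F_def)
  qed
  have ext: "\<phi> a = undefined" if "\<phi> \<in> character_space G" "a \<notin> carrier G" for \<phi> a
    using that by (auto simp: character_space_def extensional_def)
  show ?thesis
  proof (rule homeomorphic_function_spacesI[where f = "\<lambda>\<phi> i. \<phi> (m i)" and g = F])
    show "continuous_on (character_space G) (\<lambda>\<phi>. \<phi> (m i))" for i by (rule continuous_on_coordinate)
    show "continuous_on (solenoid n) (\<lambda>c. F c a)" for a
    proof (cases "a \<in> carrier G")
      case True
      have "continuous_on (solenoid n) (\<lambda>c. c (I a) powi k (I a) a)"
        using sol(3) by (intro continuous_on_power_int continuous_on_coordinate) auto
      then show ?thesis using True by (simp add: F_def)
    next
      case False
      then show ?thesis by (simp add: F_def)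
    qed
    show "(\<lambda>i. \<phi> (m i)) \<in> solenoid n" if \<phi>: "\<phi> \<in> character_space G" for \<phi>
    proof -
      have "\<phi> (m i) \<in> sphere 0 1" for i
        using \<phi> m(1)[of i] HG unfolding character_space_def by blast
      moreover have "\<phi> (m i) = \<phi> (m (Suc i)) ^ n i" for i
      proof -
        have "\<phi> (m i) = \<phi> (m (Suc i)) powi k (Suc i) (m i)"
          using m(1) H(1) by (intro gen[OF \<phi>]) blast
        then show ?thesis using bond[OF m(1)[of i]] m(2)[of i] by simp
      qed
      ultimately show ?thesis unfolding solenoid_def by blast
    qed
    show "F c \<in> character_space G" if c: "c \<in> solenoid n" for c
    proof -
      have "F c a \<in> sphere 0 1" if "a \<in> carrier G" for a
        using that sol(1)[OF c] by (simp add: F_def norm_power_int)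
      moreover have "F c (a \<otimes>\<^bsub>G\<^esub> b) = F c a * F c b" if ab: "a \<in> carrier G" "b \<in> carrier G" for a b
      proof -
        obtain i j where "a \<in> H i" "b \<in> H j" using ab H(2) by blast
        then have ab: "a \<in> H (max i j)" "b \<in> H (max i j)" using Hmono[of i "max i j"] Hmono[of j "max i j"] by auto
        show ?thesis
          unfolding FI[OF c hom(1)[OF ab]] FI[OF c ab(1)] FI[OF c ab(2)] hom(2)[OF ab]
          using sol(3)[OF c] by (simp add: power_int_add)
      qed
      moreover have "F c \<in> extensional (carrier G)" by (simp add: F_def)
      ultimately show ?thesis unfolding character_space_def by auto
    qed
    show "F (\<lambda>i. \<phi> (m i)) = \<phi>" if \<phi>: "\<phi> \<in> character_space G" for \<phi>
    proof
      fix a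
      show "F (\<lambda>i. \<phi> (m i)) a = \<phi> a"
      proof (cases "a \<in> carrier G")
        case True
        then obtain i where "a \<in> H i" using H(2) by blast
        then have "a \<in> H (I a)" unfolding I_def by (rule LeastI)
        then show ?thesis using gen[OF \<phi>] True by (simp add: F_def)
      qed (use ext[OF \<phi>] in \<open>simp add: F_def\<close>)
    qed
    show "(\<lambda>i. F c (m i)) = c" if "c \<in> solenoid n" for c
      using FI[OF that m(1)] m(2) by simp
  qed
qed

text \<open>The first coordinates of a point of a solenoid are powers of the later ones.\<close>

lemma solenoid_shift: "solenoid n homeomorphic solenoid (\<lambda>i. n (i + k))"
proof (induction k)
  case (Suc k)
  let ?n = "\<lambda>i. n (i + k)"
  have "solenoid ?n homeomorphic solenoid (\<lambda>i. ?n (Suc i))"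
  proof (rule homeomorphic_function_spacesI[where f = "\<lambda>c i. c (Suc i)" and g = "\<lambda>c i. case i of 0 \<Rightarrow> c 0 ^ ?n 0 | Suc j \<Rightarrow> c j"])
    show "continuous_on S (\<lambda>c. c (Suc i))" for i and S :: "(nat \<Rightarrow> complex) set" by (rule continuous_on_coordinate)
    show "continuous_on S (\<lambda>c. case i of 0 \<Rightarrow> c 0 ^ ?n 0 | Suc j \<Rightarrow> c j)" for i and S :: "(nat \<Rightarrow> complex) set"
      by (cases i) (auto intro!: continuous_intros continuous_on_coordinate)
    show "(\<lambda>i. case i of 0 \<Rightarrow> c 0 ^ ?n 0 | Suc j \<Rightarrow> c j) \<in> solenoid ?n" if "c \<in> solenoid (\<lambda>i. ?n (Suc i))" for c
    proof -
      have c: "c i \<in> sphere 0 1 \<and> c i = c (Suc i) ^ ?n (Suc i)" for i using that unfolding solenoid_def by blast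
      have "(case i of 0 \<Rightarrow> c 0 ^ ?n 0 | Suc j \<Rightarrow> c j) \<in> sphere 0 1" for i
        using c[of 0, THEN conjunct1] c[THEN conjunct1] by (cases i) (simp_all add: norm_power)
      moreover have "(case i of 0 \<Rightarrow> c 0 ^ ?n 0 | Suc j \<Rightarrow> c j) = c i ^ ?n i" for i
      proof (cases i)
        case (Suc j)
        show ?thesis using c[of j, THEN conjunct2] by (simp only: Suc nat.case)
      qed simp
      ultimately show ?thesis unfolding solenoid_def mem_Collect_eq nat.case by blast
    qed
    show "(\<lambda>i. case i of 0 \<Rightarrow> c (Suc 0) ^ ?n 0 | Suc j \<Rightarrow> c (Suc j)) = c" if "c \<in> solenoid ?n" for c
    proof
      have "c 0 = c (Suc 0) ^ ?n 0" using that unfolding solenoid_def by blast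
      then show "(case i of 0 \<Rightarrow> c (Suc 0) ^ ?n 0 | Suc j \<Rightarrow> c (Suc j)) = c i" for i by (cases i) simp_all
    qed
    show "(\<lambda>i. c (Suc i)) \<in> solenoid (\<lambda>i. ?n (Suc i))" if "c \<in> solenoid ?n" for c
      using that unfolding solenoid_def by blast
  qed simp
  then have "solenoid n homeomorphic solenoid (\<lambda>i. ?n (Suc i))" using Suc.IH homeomorphic_trans by blast
  then show ?case by simp
qed (simp add: homeomorphic_refl)

abbreviation path_class :: "'a::topological_space set \<Rightarrow> (real \<Rightarrow> 'a) \<Rightarrow> (real \<Rightarrow> 'a) set" where
  "path_class X p \<equiv> {q. homotopic_paths X p q}"

lemma carrier_fundamental_group: "carrier (fundamental_group X x) = path_class X ` loops X x"
  by (auto simp: fundamental_group_def)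

lemma homotopic_paths_conjugate_join:
  fixes X :: "'a::real_normed_vector set"
  assumes b: "path b0" "path_image b0 \<subseteq> X" "path b1" "path_image b1 \<subseteq> X" "path b2" "path_image b2 \<subseteq> X"
    and p: "path p" "path_image p \<subseteq> X" and q: "path q" "path_image q \<subseteq> X"
    and ends: "pathfinish b0 = pathstart p" "pathfinish b1 = pathfinish p" "pathfinish p = pathstart q" "pathfinish b2 = pathfinish q"
    and base: "pathstart b0 = x" "pathstart b1 = x" "pathstart b2 = x"
  shows "homotopic_paths X ((b0 +++ (p +++ reversepath b1)) +++ (b1 +++ (q +++ reversepath b2)))
           (b0 +++ ((p +++ q) +++ reversepath b2))"
proof -
  let ?Q = "q +++ reversepath b2"
  note [trans] = homotopic_paths_trans
  note simps = path_image_join path_image_reversepath b p q ends base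
  have Q: "path ?Q" "path_image ?Q \<subseteq> X" "pathstart ?Q = pathfinish p" using b q ends by (auto simp: path_image_join)
  have "homotopic_paths X (reversepath b1 +++ (b1 +++ ?Q)) ((reversepath b1 +++ b1) +++ ?Q)"
    by (rule homotopic_paths_assoc) (use b q ends in \<open>auto simp: path_image_join\<close>)
  also have "homotopic_paths X ((reversepath b1 +++ b1) +++ ?Q) (linepath (pathstart ?Q) (pathstart ?Q) +++ ?Q)"
  proof (rule homotopic_paths_join)
    show "homotopic_paths X (reversepath b1 +++ b1) (linepath (pathstart ?Q) (pathstart ?Q))"
      using homotopic_paths_linv[of b1 X] b ends Q(3) by simp
    show "homotopic_paths X ?Q ?Q" using Q by simp
  qed (use b ends in auto)
  also have "homotopic_paths X (linepath (pathstart ?Q) (pathstart ?Q) +++ ?Q) ?Q"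
    by (rule homotopic_paths_lid[OF Q(1,2)])
  finally have 1: "homotopic_paths X (reversepath b1 +++ (b1 +++ ?Q)) ?Q" .
  have R: "path (b1 +++ ?Q)" "path_image (b1 +++ ?Q) \<subseteq> X" using b q ends by (auto simp: path_image_join)
  have "homotopic_paths X ((p +++ reversepath b1) +++ (b1 +++ ?Q)) (p +++ (reversepath b1 +++ (b1 +++ ?Q)))"
    by (rule homotopic_paths_sym[OF homotopic_paths_assoc]) (use b p q ends in \<open>auto simp: path_image_join\<close>)
  also have "homotopic_paths X \<dots> (p +++ ?Q)"
    by (rule homotopic_paths_join[OF _ 1]) (use p b ends in auto)
  also have "homotopic_paths X (p +++ ?Q) ((p +++ q) +++ reversepath b2)"
    by (rule homotopic_paths_assoc) (use b p q ends in auto)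
  finally have 2: "homotopic_paths X ((p +++ reversepath b1) +++ (b1 +++ ?Q)) ((p +++ q) +++ reversepath b2)" .
  have "homotopic_paths X ((b0 +++ (p +++ reversepath b1)) +++ (b1 +++ ?Q)) (b0 +++ ((p +++ reversepath b1) +++ (b1 +++ ?Q)))"
    by (rule homotopic_paths_sym[OF homotopic_paths_assoc]) (use b p q ends base in \<open>auto simp: path_image_join\<close>)
  also have "homotopic_paths X \<dots> (b0 +++ ((p +++ q) +++ reversepath b2))"
    by (rule homotopic_paths_join[OF _ 2]) (use b p ends in auto)
  finally show ?thesis .
qed

lemma path_class_eq: "homotopic_paths X p q \<Longrightarrow> path_class X p = path_class X q"
  using homotopic_paths_sym homotopic_paths_trans by blast

text \<open>A loop at \<open>x\<close> is made of a path by choosing a path from \<open>x\<close> to each point. Since characters have commutative values, the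
  choice made at \<open>x\<close> itself does not affect loops.\<close>

lemma character_of_fundamental_group:
  fixes U W :: "'a::real_normed_vector set"
  assumes U: "path_connected U" "U \<subseteq> W" "x \<in> U" and \<phi>: "\<phi> \<in> character_space (fundamental_group W x)"
  obtains \<omega> where "path_character U \<omega>" "\<And>p. p \<in> loops U x \<Longrightarrow> \<phi> (path_class W p) = \<omega> p"
proof -
  let ?G = "fundamental_group W x"
  have "\<exists>b. path b \<and> path_image b \<subseteq> U \<and> pathstart b = x \<and> pathfinish b = y" if "y \<in> U" for y
    using U(1,3) that unfolding path_connected_def by blast
  then obtain b where b: "\<And>y. y \<in> U \<Longrightarrow> path (b y) \<and> path_image (b y) \<subseteq> U \<and> pathstart (b y) = x \<and> pathfinish (b y) = y"
    by metis
  define c where "c p = b (pathstart p) +++ (p +++ reversepath (b (pathfinish p)))" for p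
  define \<omega> where "\<omega> p = \<phi> (path_class W (c p))" for p
  have loopsUW: "loops U x \<subseteq> loops W x" using U(2) by (auto simp: loops_def)
  have in_U: "pathstart p \<in> U" "pathfinish p \<in> U" if "path_image p \<subseteq> U" for p
    using that pathstart_in_path_image pathfinish_in_path_image by blast+
  have c_loop: "c p \<in> loops U x" if "path p" "path_image p \<subseteq> U" for p
    using b[OF in_U(1)[OF that(2)]] b[OF in_U(2)[OF that(2)]] that
    by (auto simp: c_def loops_def path_image_join)
  have mult: "\<phi> (path_class W (p +++ q)) = \<phi> (path_class W p) * \<phi> (path_class W q)" if "p \<in> loops W x" "q \<in> loops W x" for p q
  proof -
    have "\<phi> (path_class W p \<otimes>\<^bsub>?G\<^esub> path_class W q) = \<phi> (path_class W p) * \<phi> (path_class W q)"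
      using \<phi> that unfolding character_space_def carrier_fundamental_group by blast
    then show ?thesis unfolding fundamental_group_mult[OF that] .
  qed
  have nz: "\<phi> (path_class W p) \<noteq> 0" if "p \<in> loops W x" for p
  proof -
    have "\<phi> (path_class W p) \<in> sphere 0 1"
      using \<phi> that unfolding character_space_def carrier_fundamental_group by blast
    then show ?thesis by auto
  qed
  have hom: "\<phi> (path_class W p) = \<phi> (path_class W q)" if "homotopic_paths U p q" for p q
    using path_class_eq[OF homotopic_paths_subset[OF that U(2)]] by simp
  have char: "path_character U \<omega>"
  proof (rule path_characterI)
    show "\<omega> p \<noteq> 0" if "path p" "path_image p \<subseteq> U" for p
      unfolding \<omega>_def using c_loop[OF that] loopsUW by (intro nz) blast
    show "\<omega> p = \<omega> q" if h: "homotopic_paths U p q" for p q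
    proof -
      have e: "pathstart q = pathstart p" "pathfinish q = pathfinish p" 
        using homotopic_paths_imp_pathstart[OF h] homotopic_paths_imp_pathfinish[OF h] by auto
      have p: "path_image p \<subseteq> U" using homotopic_paths_imp_subset[OF h] by blast
      have "homotopic_paths U (c p) (c q)"
        unfolding c_def e using b[OF in_U(1)[OF p]] b[OF in_U(2)[OF p]] h e
        by (intro homotopic_paths_join) (auto simp: homotopic_paths_refl)
      then show ?thesis unfolding \<omega>_def by (rule hom)
    qed
    show "\<omega> (p +++ q) = \<omega> p * \<omega> q"
      if pq: "path p" "path_image p \<subseteq> U" "path q" "path_image q \<subseteq> U" "pathfinish p = pathstart q" for p q
    proof -
      have "homotopic_paths U (c p +++ c q) (c (p +++ q))"
        unfolding c_def pathstart_join pathfinish_join pq(5)[symmetric]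
        using b[OF in_U(1)[OF pq(2)]] b[OF in_U(2)[OF pq(2)]] b[OF in_U(2)[OF pq(4)]] pq
        by (intro homotopic_paths_conjugate_join[where x = x]) auto
      from hom[OF this] show ?thesis
        unfolding \<omega>_def using mult[of "c p" "c q"] c_loop[OF pq(1,2)] c_loop[OF pq(3,4)] loopsUW by (metis subsetD)
    qed
  qed
  have bx: "b x \<in> loops U x" "reversepath (b x) \<in> loops U x" using b[OF U(3)] by (auto simp: loops_def)
  have \<omega>p: "\<omega> p = \<phi> (path_class W (b x)) * \<phi> (path_class W (reversepath (b x))) * \<phi> (path_class W p)" if "p \<in> loops U x" for p
  proof -
    have ends: "pathstart p = x" "pathfinish p = x" using that by (auto simp: loops_def)
    have l: "b x \<in> loops W x" "reversepath (b x) \<in> loops W x" "p \<in> loops W x" using bx that loopsUW by blast+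
    then show ?thesis unfolding \<omega>_def c_def ends using mult loops_join[OF l(3,2)] by simp
  qed
  let ?c = "\<lambda>_::real. x"
  have cl: "?c \<in> loops U x" using U(3) by (auto simp: loops_def path_def path_image_def pathstart_def pathfinish_def)
  have "\<omega> ?c = 1" using cl by (intro path_character_const[OF char]) (auto simp: loops_def)
  moreover have "\<phi> (path_class W ?c) = 1"
  proof -
    have "?c +++ ?c = ?c" by (auto simp: joinpaths_def)
    then show ?thesis using mult[of ?c ?c] nz[of ?c] cl loopsUW by auto
  qed
  ultimately have "\<phi> (path_class W (b x)) * \<phi> (path_class W (reversepath (b x))) = 1" using \<omega>p[OF cl] by simp
  then have "\<phi> (path_class W p) = \<omega> p" if "p \<in> loops U x" for p using \<omega>p[OF that] by simp
  then show ?thesis by (rule that[OF char])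
qed

section \<open>Complements of solenoids\<close>

lemma homeomorphism_open_torus:
  fixes h :: "complex \<times> complex \<Rightarrow> 'a::topological_space"
  assumes "homeomorphism std_solid_torus T h g"
  shows "homeomorphism (ball 0 1 \<times> sphere 0 1) (h ` (ball 0 1 \<times> sphere 0 1)) h g"
  by (rule homeomorphism_of_subsets[OF assms]) (use assms in \<open>auto simp: homeomorphism_def\<close>)

text \<open>This leaves a collar between the solid torus and the next one, in which the meridian lives.\<close>

lemma torus_in_smaller_torus:
  fixes h :: "complex \<times> complex \<Rightarrow> 'a::t2_space"
  assumes hom: "homeomorphism std_solid_torus T h g" and C: "compact C" "C \<noteq> {}" "C \<subseteq> h ` (ball 0 1 \<times> sphere 0 1)"
  obtains r where "0 \<le> r" "r < 1" "C \<subseteq> h ` (cball 0 r \<times> sphere 0 1)"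
proof -
  have h: "h ` std_solid_torus = T" "continuous_on T g" "\<And>x. x \<in> std_solid_torus \<Longrightarrow> g (h x) = x"
    using hom by (auto simp: homeomorphism_def)
  have "h ` (ball 0 1 \<times> sphere 0 1) \<subseteq> T" using h(1) by auto
  then have CT: "C \<subseteq> T" using C(3) by blast
  have "continuous_on C (\<lambda>y. norm (fst (g y)))"
    by (intro continuous_intros continuous_on_subset[OF h(2) CT])
  then obtain y where y: "y \<in> C" "\<And>y'. y' \<in> C \<Longrightarrow> norm (fst (g y')) \<le> norm (fst (g y))"
    using continuous_attains_sup[OF C(1,2)] by blast
  have gC: "\<exists>x\<in>ball 0 1 \<times> sphere 0 1. y' = h x \<and> g y' = x" if "y' \<in> C" for y'
    using that C(3) h(3) by force
  show ?thesis
  proof (rule that[of "norm (fst (g y))"])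
    show "norm (fst (g y)) < 1" using gC[OF y(1)] by auto
    show "C \<subseteq> h ` (cball 0 (norm (fst (g y))) \<times> sphere 0 1)"
    proof
      fix y' assume y': "y' \<in> C"
      obtain x where "x \<in> ball 0 1 \<times> sphere 0 1" "y' = h x" "g y' = x" using gC[OF y'] by blast
      then show "y' \<in> h ` (cball 0 (norm (fst (g y))) \<times> sphere 0 1)" using y(2)[OF y'] by (cases x) auto
    qed
  qed simp
qed

lemma simply_connected_S3: "simply_connected S3"
  by (rule simply_connected_sphere) simp

lemma loop_null_S3:
  assumes "path p" "path_image p \<subseteq> S3" "pathfinish p = pathstart p"
  shows "homotopic_paths S3 p (\<lambda>_. pathstart p)"
  using simply_connected_S3 assms unfolding simply_connected_eq_contractible_path linepath_refl by blast

lemma unit_int_power: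
  fixes e :: "nat \<Rightarrow> int"
  assumes "\<And>i. e i = 1 \<or> e i = -1"
  shows "(\<Prod>j<i. e j) = 1 \<or> (\<Prod>j<i. e j) = -1"
proof (induction i)
  case (Suc i)
  then show ?case using assms[of i] by auto
qed simp

text \<open>The closed tori \<open>K i\<close>, slightly smaller than \<open>T i\<close>, have the same intersection, and their complements \<open>U i\<close> exhaust the complement of the
  solenoid. On loops in \<open>U i\<close> the characters are the powers of the winding number \<open>w i\<close> of the \<open>i\<close>-th linking function, and passing from
  \<open>i\<close> to \<open>i + 1\<close> multiplies \<open>w\<close> by \<open>\<plusminus> n i\<close>. The accumulated signs \<open>\<delta> i\<close> are absorbed in \<open>k\<close>.\<close>

theorem character_space_torus_tower:
  fixes h :: "nat \<Rightarrow> complex \<times> complex \<Rightarrow> real^4"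
  assumes T: "\<And>i. solid_torus_param (h i) (T i)" "\<And>i. tame (T i)"
    and int: "\<And>i. T (Suc i) \<subseteq> top_of_set S3 interior_of T i"
    and braid: "\<And>i. \<exists>K. transitive_closed_braid (n i) K \<and> core (h (Suc i)) = h i ` K"
    and n: "\<And>i. n i > 0" and x: "x \<in> S3" "x \<notin> T 0"
  shows "character_space (fundamental_group (S3 - (\<Inter>i. T i)) x) homeomorphic solenoid n"
proof -
  define W where "W = S3 - (\<Inter>i. T i)"
  let ?G = "fundamental_group W x"
  let ?D = "ball 0 1 \<times> sphere 0 1 :: (complex \<times> complex) set"
  have "\<exists>g. homeomorphism std_solid_torus (T i) (h i) g" for i using T(1) unfolding solid_torus_param_def by blast
  then obtain g where g: "\<And>i. homeomorphism std_solid_torus (T i) (h i) (g i)" by metis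
  have TS: "T i \<subseteq> S3" for i using T(1) unfolding solid_torus_param_def by blast
  define V where "V i = h i ` ?D" for i
  have hV: "homeomorphism ?D (V i) (h i) (g i)" for i unfolding V_def by (rule homeomorphism_open_torus[OF g])
  have opV: "openin (top_of_set S3) (V i)" for i
    unfolding V_def by (rule open_torus_openin_sphere(1)[OF g TS T(2)])
  have TV: "T (Suc i) \<subseteq> V i" for i
    unfolding V_def by (rule subset_trans[OF int open_torus_openin_sphere(2)[OF g TS T(2)]])
  have hT: "h i ` std_solid_torus = T i" for i using g[of i] by (simp add: homeomorphism_def)
  have VT: "V i \<subseteq> T i" for i unfolding V_def hT[symmetric] by auto
  have cT: "compact (T i)" for i
    unfolding hT[symmetric] using g[of i] by (intro compact_continuous_image compact_Times) (auto simp: homeomorphism_def)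
  have neT: "T i \<noteq> {}" for i unfolding hT[symmetric] by auto
  have "\<exists>r. 0 \<le> r \<and> r < 1 \<and> T (Suc i) \<subseteq> h i ` (cball 0 r \<times> sphere 0 1)" for i
    by (rule torus_in_smaller_torus[OF g[of i] cT neT TV[of i, unfolded V_def]]) (intro exI conjI)
  then obtain r where r: "\<And>i. 0 \<le> r i" "\<And>i. r i < 1" "\<And>i. T (Suc i) \<subseteq> h i ` (cball 0 (r i) \<times> sphere 0 1)"
    by metis
  define K where "K i = h i ` (cball 0 (r i) \<times> sphere 0 1)" for i
  define U where "U i = S3 - K i" for i
  define s where "s i = (1 + r i) / 2" for i
  have s: "r i < s i" "0 < s i" "s i < 1" for i using r(1,2)[of i] by (auto simp: s_def)
  have TK: "T (Suc i) \<subseteq> K i" for i using r(3) by (simp add: K_def)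
  have KV: "K i \<subseteq> V i" for i unfolding K_def using homeomorphism_torus_diff(2)[OF hV r(2)] .
  have KT: "K i \<subseteq> T i" for i using KV VT by blast
  have Tdec: "T j \<subseteq> T i" if "i \<le> j" for i j
    using TK KT lift_Suc_antimono_le[of T, OF _ that] by blast
  have UU: "U i \<subseteq> U (Suc i)" for i using TK[of i] KT[of "Suc i"] unfolding U_def by blast
  have Umono: "U i \<subseteq> U j" if "i \<le> j" for i j using lift_Suc_mono_le[of U, OF UU that] .
  have UW: "U i \<subseteq> W" for i using TK[of i] unfolding U_def W_def by blast
  have xU: "x \<in> U i" for i using x Tdec[of 0 i] KT[of i] unfolding U_def by blast
  have pcU: "path_connected (U i)" for i
    unfolding U_def K_def by (rule path_connected_torus_complement[OF hV opV r(1,2)])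
  have exhaust: "\<exists>j. C \<subseteq> U j" if C: "compact C" "C \<subseteq> W" for C
  proof (rule ccontr)
    assume "\<not> ?thesis"
    then have "C \<inter> T j \<noteq> {}" for j using C(2) KT[of j] unfolding U_def W_def by blast
    then have "(\<Inter>j. C \<inter> T j) \<noteq> {}"
      using Tdec C(1) cT by (intro compact_nest) (auto intro: compact_Int)
    then show False using C(2) unfolding W_def by blast
  qed
  have coreK: "core (h (Suc i)) \<subseteq> K i" for i
    using TK[of i] hT[of "Suc i"] unfolding core_def by auto
  have coreK': "core (h i) \<subseteq> K i" for i using r(1)[of i] unfolding core_def K_def by auto
  have "\<exists>u. continuous_on (S3 - core (h i)) u \<and> (\<forall>y\<in>S3 - core (h i). u y \<noteq> 0) \<and>
     (\<forall>s. 0 < s \<longrightarrow> s < 1 \<longrightarrow> winding_number (u \<circ> meridian (h i) s) 0 = 1)" for i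
    using linking_function[OF hV[of i] opV] by metis
  then obtain u where u: "\<And>i. continuous_on (S3 - core (h i)) (u i)" "\<And>i y. y \<in> S3 - core (h i) \<Longrightarrow> u i y \<noteq> 0"
    "\<And>i s. 0 < s \<Longrightarrow> s < 1 \<Longrightarrow> winding_number (u i \<circ> meridian (h i) s) 0 = 1" by metis
  have uU: "continuous_on (U i) (u i)" "y \<in> U i \<Longrightarrow> u i y \<noteq> 0" for i y
    using continuous_on_subset[OF u(1)[of i], of "U i"] u(2)[of y i] coreK'[of i] unfolding U_def by blast+
  have "\<exists>e::int. (e = 1 \<or> e = -1) \<and> winding_number (u (Suc i) \<circ> meridian (h i) (s i)) 0 = of_int (e * int (n i))" for i
  proof -
    obtain B where B: "transitive_closed_braid (n i) B" "core (h (Suc i)) = h i ` B" using braid by blast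
    have "V (Suc i) \<subseteq> h i ` (cball 0 (r i) \<times> sphere 0 1)" using VT r(3) by blast
    from winding_number_closed_braid[OF hV hV opV opV s this n B u(1,2,3)] show ?thesis by metis
  qed
  then obtain e where e: "\<And>i. e i = 1 \<or> e i = (-1::int)"
    "\<And>i. winding_number (u (Suc i) \<circ> meridian (h i) (s i)) 0 = of_int (e i * int (n i))" by metis
  define \<delta> where "\<delta> i = (\<Prod>j<i. e j)" for i
  have \<delta>: "\<delta> i = 1 \<or> \<delta> i = -1" "\<delta> (Suc i) = \<delta> i * e i" "e i * e i = 1" "\<delta> i * \<delta> i = 1" for i
  proof -
    show 1: "\<delta> i = 1 \<or> \<delta> i = -1" unfolding \<delta>_def using e(1) by (rule unit_int_power)
    show "\<delta> (Suc i) = \<delta> i * e i" by (simp add: \<delta>_def)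
    show "e i * e i = 1" using e(1)[of i] by auto
    show "\<delta> i * \<delta> i = 1" using 1 by auto
  qed

  define w where "w i p = (THE k. winding_number (u i \<circ> p) 0 = of_int k)" for i p
  have w: "winding_number (u i \<circ> p) 0 = of_int (w i p)" if p: "path p" "path_image p \<subseteq> U i" "pathfinish p = pathstart p" for i p
  proof -
    have "winding_number (u i \<circ> p) 0 \<in> \<int>"
      using path_continuous_image[OF p(1) continuous_on_subset[OF uU(1) p(2)]] uU(2) p
      by (intro integer_winding_number) (auto simp: path_image_compose pathfinish_compose pathstart_compose)
    then obtain k where k: "winding_number (u i \<circ> p) 0 = of_int k" by (auto elim: Ints_cases)
    then show ?thesis unfolding w_def by simp
  qed
  have contD: "continuous_on ?D (h i)" for i using hV[of i] by (simp add: homeomorphism_def)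
  have mer: "path (meridian (h i) (s i))" "path_image (meridian (h i) (s i)) \<subseteq> U i"
    "pathfinish (meridian (h i) (s i)) = pathstart (meridian (h i) (s i))" for i
  proof -
    note pm = path_meridian[OF contD s(2,3), of i]
    show "path (meridian (h i) (s i))" "pathfinish (meridian (h i) (s i)) = pathstart (meridian (h i) (s i))" by (fact pm)+
    have "sphere 0 (s i) \<times> sphere 0 1 \<subseteq> {z. r i < norm z \<and> norm z < 1} \<times> (sphere 0 1 :: complex set)" using s by auto
    then have "h i ` (sphere 0 (s i) \<times> sphere 0 1) \<subseteq> V i - K i"
      unfolding K_def homeomorphism_torus_diff(1)[OF hV r(2)] by blast
    then show "path_image (meridian (h i) (s i)) \<subseteq> U i"
      using pm(2) VT[of i] TS[of i] unfolding U_def by blast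
  qed
  have w_Suc: "w (Suc i) p = e i * int (n i) * w i p" if p: "p \<in> loops (U i) x" for i p
  proof -
    have p': "path p" "path_image p \<subseteq> U i" "pathfinish p = pathstart p" using p by (auto simp: loops_def)
    have "path_image p \<subseteq> S3" using p'(2) unfolding U_def by blast
    from loop_null_S3[OF p'(1) this p'(3)] have null: "homotopic_paths S3 p (\<lambda>_. pathstart p)" .
    have sub: "S3 - K i \<subseteq> S3 - core (h (Suc i))" using coreK by blast
    have nz: "u (Suc i) y \<noteq> 0" if "y \<in> S3 - K i" for y by (rule u(2)) (use that sub in blast)
    have "winding_number (u (Suc i) \<circ> p) 0 = winding_number (u (Suc i) \<circ> meridian (h i) (s i)) 0 * winding_number (u i \<circ> p) 0"
      by (rule winding_number_proportional[OF hV opV r(1) s(1,3) K_def uU[unfolded U_def] u(3)[OF s(2,3)]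
            continuous_on_subset[OF u(1) sub] nz p'(1) p'(2)[unfolded U_def] p'(3) null])
    then have "(of_int (w (Suc i) p) :: complex) = of_int (e i * int (n i) * w i p)"
      using w[OF p'] w[of p "Suc i"] p' UU[of i] unfolding e(2) by auto
    then show ?thesis by (simp only: of_int_eq_iff)
  qed
  have w_join: "w i (p +++ q) = w i p + w i q" if "p \<in> loops (U i) x" "q \<in> loops (U i) x" for i p q
  proof -
    have p: "path p" "path_image p \<subseteq> U i" "pathstart p = x" "pathfinish p = x" and
      q: "path q" "path_image q \<subseteq> U i" "pathstart q = x" "pathfinish q = x" using that by (auto simp: loops_def)
    have "winding_number (u i \<circ> (p +++ q)) 0 = winding_number (u i \<circ> p) 0 + winding_number (u i \<circ> q) 0"
      unfolding path_compose_join
      using path_continuous_image[OF p(1) continuous_on_subset[OF uU(1) p(2)]] path_continuous_image[OF q(1) continuous_on_subset[OF uU(1) q(2)]]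
        uU(2) p q
      by (intro winding_number_join) (auto simp: path_image_compose pathfinish_compose pathstart_compose)
    then have "(of_int (w i (p +++ q)) :: complex) = of_int (w i p + w i q)"
      using w[of p i] w[of q i] w[of "p +++ q" i] p q by (simp add: path_image_join)
    then show ?thesis by (simp only: of_int_eq_iff)
  qed
  have w_cong: "w i p = w i q" if pq: "p \<in> loops (U i) x" "q \<in> loops (U i) x" "homotopic_paths W p q" for i p q
  proof -
    obtain F where F: "continuous_on ({0..1} \<times> {0..1::real}) F" "F \<in> {0..1::real} \<times> {0..1} \<rightarrow> W"
      "\<forall>t\<in>{0..1}. F (0, t) = p t" "\<forall>t\<in>{0..1}. F (1, t) = q t"
      "\<forall>t\<in>{0..1}. pathstart (F \<circ> Pair t) = pathstart p \<and> pathfinish (F \<circ> Pair t) = pathfinish p"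
      using pq(3) unfolding homotopic_paths by blast
    have "compact (F ` ({0..1} \<times> {0..1}))" using F(1) by (intro compact_continuous_image compact_Times) auto
    then obtain j0 where j0: "F ` ({0..1} \<times> {0..1}) \<subseteq> U j0" using exhaust[of "F ` ({0..1} \<times> {0..1})"] F(2) by blast
    define j where "j = max i j0"
    have j: "F \<in> {0..1} \<times> {0..1} \<rightarrow> U j" "i \<le> j" using j0 Umono[of j0 j] unfolding j_def by auto
    have "homotopic_paths (U j) p q" unfolding homotopic_paths using F j(1) by blast
    then have "homotopic_paths (- {0}) (u j \<circ> p) (u j \<circ> q)"
      using uU by (intro homotopic_paths_continuous_image[where S = "U j"]) auto
    then have eq: "winding_number (u j \<circ> p) 0 = winding_number (u j \<circ> q) 0" by (rule winding_number_homotopic_paths)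
    have in_j: "p \<in> loops (U j) x" "q \<in> loops (U j) x" using that Umono[OF j(2)] by (auto simp: loops_def)
    have "(of_int (w j p) :: complex) = of_int (w j q)"
      using eq w[of p j] w[of q j] in_j by (simp add: loops_def)
    then have "w j p = w j q" by (simp only: of_int_eq_iff)
    \<comment> \<open>Descend from \<open>j\<close> to \<open>i\<close>: the factors \<open>n k\<close> are nonzero.\<close>
    moreover have "w j p = w j q \<Longrightarrow> w i p = w i q"
      using j(2)
    proof (induction j rule: dec_induct)
      case (step k)
      have "p \<in> loops (U k) x" "q \<in> loops (U k) x" using that Umono[OF step.hyps(1)] by (auto simp: loops_def)
      then have "e k * int (n k) * w k p = e k * int (n k) * w k q" using step.prems w_Suc by simp
      moreover have "e k * int (n k) \<noteq> 0" using e(1)[of k] n[of k] by auto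
      ultimately have "w k p = w k q" by simp
      then show ?case by (rule step.IH)
    qed
    ultimately show ?thesis by blast
  qed

  \<comment> \<open>Run through the meridian backwards if \<open>\<delta> i = -1\<close>, so that the sign cancels in \<open>k\<close> below.\<close>
  have "\<exists>l\<in>loops (U i) x. w i l = \<delta> i" for i
  proof -
    let ?m = "meridian (h i) (s i)"
    have "pathstart ?m \<in> U i" using mer(2)[of i] pathstart_in_path_image by blast
    then obtain c where c: "path c" "path_image c \<subseteq> U i" "pathstart c = x" "pathfinish c = pathstart ?m"
      using pcU xU unfolding path_connected_def by metis
    let ?l = "c +++ (?m +++ reversepath c)"
    have l: "?l \<in> loops (U i) x" using c mer[of i] by (auto simp: loops_def path_image_join)
    have comp: "path (u i \<circ> p)" "0 \<notin> path_image (u i \<circ> p)" if "path p" "path_image p \<subseteq> U i" for p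
      using path_continuous_image[OF that(1) continuous_on_subset[OF uU(1) that(2)]] uU(2)[of _ i] that(2)
      by (auto simp: path_image_compose)
    have rev: "u i \<circ> reversepath p = reversepath (u i \<circ> p)" for p by (auto simp: reversepath_def)
    have "winding_number (u i \<circ> ?l) 0 = winding_number (u i \<circ> ?m) 0"
      using comp[OF c(1,2)] comp[OF mer(1,2)] c mer(3)[of i] unfolding path_compose_join rev
      by (simp add: winding_number_join winding_number_reversepath path_image_join pathfinish_compose pathstart_compose)
    also have "\<dots> = 1" by (rule u(3)[OF s(2,3)])
    finally have "(of_int (w i ?l) :: complex) = of_int 1" using w[of ?l i] l by (simp add: loops_def)
    then have w1: "w i ?l = 1" by (simp only: of_int_eq_iff)
    have l': "reversepath ?l \<in> loops (U i) x" using l by (rule loops_reversepath)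
    have "winding_number (u i \<circ> reversepath ?l) 0 = - winding_number (u i \<circ> ?l) 0"
      unfolding rev using comp[of ?l] l by (intro winding_number_reversepath) (auto simp: loops_def)
    then have "(of_int (w i (reversepath ?l)) :: complex) = of_int (- w i ?l)"
      using w[of ?l i] w[of "reversepath ?l" i] l l' by (simp add: loops_def)
    then have "w i (reversepath ?l) = -1" unfolding w1 by (simp only: of_int_eq_iff)
    then show ?thesis using \<delta>(1)[of i] w1 l l' by metis
  qed
  then obtain l where l: "\<And>i. l i \<in> loops (U i) x" "\<And>i. w i (l i) = \<delta> i" by metis

  define H where "H i = path_class W ` loops (U i) x" for i
  define k where "k i A = \<delta> i * w i (SOME p. p \<in> loops (U i) x \<and> A = path_class W p)" for i A
  have loopsW: "loops (U i) x \<subseteq> loops W x" for i using UW by (auto simp: loops_def)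
  have k: "k i (path_class W p) = \<delta> i * w i p" if p: "p \<in> loops (U i) x" for i p
  proof -
    define q where "q = (SOME q. q \<in> loops (U i) x \<and> path_class W p = path_class W q)"
    have "q \<in> loops (U i) x \<and> path_class W p = path_class W q"
      unfolding q_def by (rule someI[of _ p]) (use p in simp)
    then have "homotopic_paths W p q" "q \<in> loops (U i) x"
      using homotopic_class_eq_iff[of p W x q] p loopsW by blast+
    then have "w i p = w i q" using w_cong p by blast
    then show ?thesis by (simp add: k_def q_def)
  qed
  have loopsU_Suc: "loops (U i) x \<subseteq> loops (U (Suc i)) x" for i using UU[of i] by (auto simp: loops_def)
  have "character_space ?G homeomorphic solenoid n"
  proof (rule character_space_homeomorphic_solenoid[where H = H and k = k and m = "\<lambda>i. path_class W (l i)"])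
    show "H i \<subseteq> H (Suc i)" for i using loopsU_Suc unfolding H_def by blast
    show "(\<Union>i. H i) = carrier ?G"
    proof
      show "(\<Union>i. H i) \<subseteq> carrier ?G" unfolding carrier_fundamental_group H_def using loopsW by blast
      show "carrier ?G \<subseteq> (\<Union>i. H i)"
        unfolding carrier_fundamental_group
      proof (rule image_subsetI)
        fix p assume p: "p \<in> loops W x"
        then obtain j where "path_image p \<subseteq> U j"
          using exhaust[of "path_image p"] compact_path_image by (auto simp: loops_def)
        then have "p \<in> loops (U j) x" using p by (auto simp: loops_def)
        then show "path_class W p \<in> (\<Union>i. H i)" unfolding H_def by blast
      qed
    qed
    show "a \<otimes>\<^bsub>?G\<^esub> b \<in> H i" "k i (a \<otimes>\<^bsub>?G\<^esub> b) = k i a + k i b" if ab: "a \<in> H i" "b \<in> H i" for i a b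
    proof -
      obtain p q where p: "p \<in> loops (U i) x" "a = path_class W p" and q: "q \<in> loops (U i) x" "b = path_class W q"
        using ab unfolding H_def by blast
      have pq: "a \<otimes>\<^bsub>?G\<^esub> b = path_class W (p +++ q)"
        using fundamental_group_mult[of p W x q] p q loopsW by blast
      have l: "p +++ q \<in> loops (U i) x" using p(1) q(1) by (rule loops_join)
      show "a \<otimes>\<^bsub>?G\<^esub> b \<in> H i" unfolding pq H_def using l by blast
      show "k i (a \<otimes>\<^bsub>?G\<^esub> b) = k i a + k i b"
        using k[OF l] k[OF p(1)] k[OF q(1)] w_join[OF p(1) q(1)] pq p(2) q(2) by (simp add: distrib_left)
    qed
    show "k (Suc i) a = int (n i) * k i a" if ai: "a \<in> H i" for i a
    proof -
      obtain p where p: "p \<in> loops (U i) x" "a = path_class W p" using ai unfolding H_def by blast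
      have p': "p \<in> loops (U (Suc i)) x" using p(1) loopsU_Suc by blast
      have "k (Suc i) a = \<delta> i * (e i * e i) * int (n i) * w i p"
        unfolding p(2) k[OF p'] w_Suc[OF p(1)] \<delta>(2) by (simp only: mult.assoc)
      then show ?thesis unfolding \<delta>(3) p(2) k[OF p(1)] by simp
    qed
    show "path_class W (l i) \<in> H i" for i unfolding H_def using l(1) by blast
    show "k i (path_class W (l i)) = 1" for i unfolding k[OF l(1)] l(2) by (rule \<delta>(4))
    show "\<phi> a = \<phi> (path_class W (l i)) powi k i a" if \<phi>: "\<phi> \<in> character_space ?G" and a: "a \<in> H i" for \<phi> i a
    proof -
      obtain \<omega> where \<omega>: "path_character (U i) \<omega>" "\<And>p. p \<in> loops (U i) x \<Longrightarrow> \<phi> (path_class W p) = \<omega> p"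
        using character_of_fundamental_group[OF pcU UW xU \<phi>] by metis
      define z where "z = \<omega> (meridian (h i) (s i))"
      have "z \<noteq> 0" unfolding z_def by (rule path_character_nonzero[OF \<omega>(1) mer(1,2)])
      then obtain y where y: "exp y = z" by (metis exp_Ln)
      have \<omega>w: "\<omega> p = z powi w i p" if p: "p \<in> loops (U i) x" for p
      proof -
        have p': "path p" "path_image p \<subseteq> U i" "pathfinish p = pathstart p" using p by (auto simp: loops_def)
        have "path_image p \<subseteq> S3" using p'(2) unfolding U_def by blast
        note null = loop_null_S3[OF p'(1) this p'(3)]
        let ?\<eta> = "\<lambda>p. \<omega> p * exp (- y * winding_number (u i \<circ> p) 0)"
        have "path_character (U i) ?\<eta>"
          by (intro path_character_mult \<omega>(1) path_character_winding uU)
        moreover have "?\<eta> (meridian (h i) (s i)) = 1"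
          using \<open>z \<noteq> 0\<close> y u(3)[OF s(2,3), of i] by (simp add: z_def[symmetric] exp_minus)
        ultimately have "?\<eta> p = 1"
          using p'(1,2) unfolding U_def K_def
          by (rule character_trivial_if_meridian_trivial[where \<omega> = ?\<eta>, OF hV opV r(1) s(1,3) _ _ _ _ null])
        then have "\<omega> p * exp (- (of_int (w i p) * y)) = 1" unfolding w[OF p'] by (simp add: mult.commute)
        then have "\<omega> p = exp (of_int (w i p) * y)" by (simp add: exp_minus field_simps)
        also have "\<dots> = exp y powi w i p" by (simp add: exp_power_int)
        finally show ?thesis by (simp add: y)
      qed
      obtain p where p: "p \<in> loops (U i) x" "a = path_class W p" using a unfolding H_def by blast
      have "\<phi> (path_class W (l i)) powi k i a = z powi (\<delta> i * (\<delta> i * w i p))"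
        unfolding \<omega>(2)[OF l(1)] \<omega>w[OF l(1)] l(2) p(2) k[OF p(1)] by (simp only: power_int_mult)
      also have "\<dots> = z powi w i p" using \<delta>(4)[of i] by (simp flip: mult.assoc)
      also have "\<dots> = \<phi> a" unfolding p(2) \<omega>(2)[OF p(1)] \<omega>w[OF p(1)] ..
      finally show ?thesis ..
    qed
  qed
  then show ?thesis unfolding W_def .
qed

text \<open>Finitely many tori at the beginning of the sequence may contain the base point; they can be dropped, as this does not change the solenoid.\<close>

theorem character_space_solenoid_complement:
  assumes S: "embedded_solenoid S" and x: "x \<in> S3 - S"
  shows "character_space (fundamental_group (S3 - S) x) homeomorphic S"
proof -
  obtain n T where n: "\<And>i. n i > 0" and hom: "S homeomorphic solenoid n" and T: "defining_tori n T" and ST: "S = (\<Inter>i. T i)"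
    using S unfolding embedded_solenoid_def by blast
  obtain h where h': "\<forall>i. solid_torus_param (h i) (T i) \<and> tame (T i)"
    "\<forall>i. T (Suc i) \<subseteq> top_of_set S3 interior_of T i"
    "\<forall>i. \<exists>K. transitive_closed_braid (n i) K \<and> core (h (Suc i)) = h i ` K"
    using T unfolding defining_tori_def by (elim exE conjE) (rule that)
  have h: "solid_torus_param (h i) (T i)" "tame (T i)" "T (Suc i) \<subseteq> top_of_set S3 interior_of T i"
    "\<exists>K. transitive_closed_braid (n i) K \<and> core (h (Suc i)) = h i ` K" for i
    by (rule h'(1)[rule_format, THEN conjunct1] h'(1)[rule_format, THEN conjunct2] h'(2)[rule_format] h'(3)[rule_format])+
  obtain k where k: "x \<notin> T k" using x ST by blast
  have dec: "T (Suc i) \<subseteq> T i" for i by (rule subset_trans[OF h(3) interior_of_subset])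
  have Tdec: "T j \<subseteq> T i" if "i \<le> j" for i j using lift_Suc_antimono_le[of T, OF dec that] .
  have "(\<Inter>i. T (i + k)) = S"
    unfolding ST using Tdec[OF le_add1] by (intro equalityI INT_greatest) blast+
  moreover have "character_space (fundamental_group (S3 - (\<Inter>i. T (i + k))) x) homeomorphic solenoid (\<lambda>i. n (i + k))"
    using h n x k
    by (intro character_space_torus_tower[where h = "\<lambda>i. h (i + k)" and T = "\<lambda>i. T (i + k)"]) auto
  moreover have "solenoid (\<lambda>i. n (i + k)) homeomorphic S"
    using hom solenoid_shift[of n k] homeomorphic_sym homeomorphic_trans by blast
  ultimately show ?thesis using homeomorphic_trans by metis
qed

theorem mainTheorem4:
  fixes S S' :: "(real^4) set" and x x' :: "real^4"
  assumes "embedded_solenoid S" and "embedded_solenoid S'"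
    and "\<not> S homeomorphic S'"
    and "x \<in> S3 - S" and "x' \<in> S3 - S'"
  shows "\<not> fundamental_group (S3 - S) x \<cong> fundamental_group (S3 - S') x'"
proof
  assume "fundamental_group (S3 - S) x \<cong> fundamental_group (S3 - S') x'"
  then have "character_space (fundamental_group (S3 - S) x) homeomorphic character_space (fundamental_group (S3 - S') x')"
    by (rule character_space_iso[OF group_fundamental_group[OF assms(4)]])
  then have "S homeomorphic character_space (fundamental_group (S3 - S') x')"
    by (rule homeomorphic_trans[OF homeomorphic_sym[THEN iffD1, OF character_space_solenoid_complement[OF assms(1,4)]]])
  then have "S homeomorphic S'"
    by (rule homeomorphic_trans[OF _ character_space_solenoid_complement[OF assms(2,5)]])
  then show False using assms(3) by blast
qed

end
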